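(* If a (finite) directed graph $G$ has a complete source, then the complex $\Delta(G)$ is shellable. In particular, $\Delta(G_n)$ is shellable for any $n\ge1$. More precisely, $\Delta(G_n)$ is homotopy equivalent to a wedge of $(n-1)^{n-1}$ spheres of dimension $n-2$, and the representatives of the cohomology classes are labeled by the spanning directed trees of $G_n$ having vertex $1$ as a leaf.
   Context: A directed graph $G$ is a pair $(V(G),E(G))$ with $E(G)\subseteq V(G)\times V(G)\setminus\{(x,x)\}$; $(x,y)$ is an edge from $x$ to $y$, written $x\to y$. A directed tree with root $x$ is a directed graph in which every vertex $y$ is reached from $x$ by a unique directed path; a directed forest is a disjoint union of directed trees with no edges between different ones. $\Delta(G)$ is the simplicial complex whose vertices are the edges of $G$ and whose faces are (the edge sets of) all directed forests which are subgraphs of $G$. A vertex $x$ is a complete source of $G$ if $(x\to y)\in E(G)$ for all $y\in V(G)\setminus\{x\}$. $G_n$ is the complete directed graph on the vertex set $[n]=\{1,\dots,n\}$ with all $n(n-1)$ edges. A simplicial complex is shellable if there is an ordering $F_1,\dots,F_t$ of its maximal faces such that $F_{i+1}\cap(\bigcup_{j\le i}F_j)$ is a pure simplicial complex of dimension $\dim F_{i+1}-1$ for all $1\le i\le t-1$. A vertex is a leaf of a directed tree if no edge of the tree starts at it. The last assertion means that the cochains taking the value $1$ on one such tree (a maximal face of $\Delta(G_n)$) and $0$ on all other maximal faces represent a basis of $\widetilde H^{n-2}(\Delta(G_n);\mathbb{Z})$. *)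

theory Defs
  imports "HOL-Homology.Homology" "Graph_Theory.Graph_Theory"
begin

section \<open>Directed trees and forests\<close>

text \<open>Paths are walks: vertices may repeat. With simple paths instead, the two-vertex digraph
  with both arcs would count as a tree.\<close>

definition directed_tree :: "'a pair_pre_digraph \<Rightarrow> 'a \<Rightarrow> bool" where
  "directed_tree T x \<longleftrightarrow> pair_loopfree_digraph T \<and> x \<in> pverts T \<and>
     (\<forall>y\<in>pverts T. \<exists>!p. pre_digraph.awalk (with_proj T) x p y)"

definition directed_forest :: "'a pair_pre_digraph \<Rightarrow> bool" where
  "directed_forest F \<longleftrightarrow> (\<exists>\<T>. (\<forall>T\<in>\<T>. \<exists>x. directed_tree T x) \<and>
     pairwise (\<lambda>S T. disjnt (pverts S) (pverts T)) \<T> \<and>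
     pverts F = (\<Union>T\<in>\<T>. pverts T) \<and> parcs F = (\<Union>T\<in>\<T>. parcs T))"

definition forest_complex :: "'a pair_pre_digraph \<Rightarrow> ('a \<times> 'a) set set" where
  "forest_complex G =
     {parcs F |F. directed_forest F \<and> subgraph (with_proj F) (with_proj G)}"

definition complete_source :: "'a pair_pre_digraph \<Rightarrow> 'a \<Rightarrow> bool" where
  "complete_source G x \<longleftrightarrow> x \<in> pverts G \<and> (\<forall>y\<in>pverts G - {x}. (x, y) \<in> parcs G)"

definition complete_digraph_upto :: "nat \<Rightarrow> nat pair_pre_digraph" where
  "complete_digraph_upto n =
     \<lparr>pverts = {1..n}, parcs = {(i, j). i \<in> {1..n} \<and> j \<in> {1..n} \<and> i \<noteq> j}\<rparr>"

definition spanning_directed_trees :: "'a pair_pre_digraph \<Rightarrow> 'a pair_pre_digraph set" where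
  "spanning_directed_trees G =
     {T. (\<exists>x. directed_tree T x) \<and> spanning (with_proj T) (with_proj G)}"

definition is_leaf :: "'a pair_pre_digraph \<Rightarrow> 'a \<Rightarrow> bool" where
  "is_leaf T v \<longleftrightarrow> v \<in> pverts T \<and> (\<forall>y. (v, y) \<notin> parcs T)"


section \<open>Abstract simplicial complexes\<close>

text \<open>A complex is given by its set of faces, including the empty face, which has
  dimension \<open>-1\<close>.\<close>

definition face_dim :: "'v set \<Rightarrow> int" where
  "face_dim \<sigma> = int (card \<sigma>) - 1"

definition facets :: "'v set set \<Rightarrow> 'v set set" where
  "facets K = {F \<in> K. \<forall>F'\<in>K. F \<subseteq> F' \<longrightarrow> F' = F}"

definition pure_of_dim :: "'v set set \<Rightarrow> int \<Rightarrow> bool" where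
  "pure_of_dim K d \<longleftrightarrow> K \<noteq> {} \<and> (\<forall>F\<in>facets K. face_dim F = d)"

text \<open>In the intersection, the facet \<open>Fs ! i\<close> stands for the full simplex
  \<open>Pow (Fs ! i)\<close> which it spans.\<close>

definition shellable :: "'v set set \<Rightarrow> bool" where
  "shellable K \<longleftrightarrow> (\<exists>Fs. distinct Fs \<and> set Fs = facets K \<and>
     (\<forall>i. 1 \<le> i \<and> i < length Fs \<longrightarrow>
        pure_of_dim (Pow (Fs ! i) \<inter> (\<Union>j<i. Pow (Fs ! j))) (face_dim (Fs ! i) - 1)))"

text \<open>Points are given by barycentric coordinates. The subspace topology of the product is the
  usual one for finite complexes only.\<close>

definition realization :: "'v set set \<Rightarrow> ('v \<Rightarrow> real) topology" where
  "realization K = subtopology (powertop_real UNIV)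
     {\<alpha>. (\<forall>v. 0 \<le> \<alpha> v) \<and> {v. \<alpha> v \<noteq> 0} \<in> K \<and> (\<Sum>v | \<alpha> v \<noteq> 0. \<alpha> v) = 1}"


section \<open>Wedges of spheres\<close>

definition quotient_topology :: "'a topology \<Rightarrow> ('a \<times> 'a) set \<Rightarrow> 'a set topology" where
  "quotient_topology X r = topology (\<lambda>U. U \<subseteq> topspace X // r \<and> openin X (\<Union>U))"

lemma openin_quotient_topology:
  assumes "equiv (topspace X) r"
  shows "openin (quotient_topology X r) U \<longleftrightarrow> U \<subseteq> topspace X // r \<and> openin X (\<Union>U)"
proof -
  have "istopology (\<lambda>U. U \<subseteq> topspace X // r \<and> openin X (\<Union>U))"
    unfolding istopology_def
  proof (intro conjI allI impI)
    fix S T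
    assume S: "S \<subseteq> topspace X // r \<and> openin X (\<Union>S)"
      and T: "T \<subseteq> topspace X // r \<and> openin X (\<Union>T)"
    show "S \<inter> T \<subseteq> topspace X // r"
      using S by blast
    have "A = B" if "A \<in> S" "B \<in> T" "x \<in> A" "x \<in> B" for A B x
      using quotient_disj[OF assms, of A B] S T that by blast
    then have "\<Union>(S \<inter> T) = \<Union>S \<inter> \<Union>T"
      by blast
    then show "openin X (\<Union>(S \<inter> T))"
      using S T by (simp add: openin_Int)
  next
    fix \<K>
    assume K: "\<forall>S\<in>\<K>. S \<subseteq> topspace X // r \<and> openin X (\<Union>S)"
    show "\<Union>\<K> \<subseteq> topspace X // r"
      using K by blast
    have "\<Union>(\<Union>\<K>) = \<Union>(Union ` \<K>)"
      by blast
    moreover have "openin X (\<Union>(Union ` \<K>))"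
      by (rule openin_Union) (use K in auto)
    ultimately show "openin X (\<Union>(\<Union>\<K>))"
      by simp
  qed
  then show ?thesis
    by (simp add: quotient_topology_def topology_inverse')
qed

definition wedge_rel ::
    "('i \<Rightarrow> 'a topology) \<Rightarrow> ('i \<Rightarrow> 'a) \<Rightarrow> 'i set \<Rightarrow> (('i \<times> 'a) \<times> ('i \<times> 'a)) set" where
  "wedge_rel X b I = {(p, q). p \<in> topspace (sum_topology X I) \<and> q \<in> topspace (sum_topology X I) \<and>
     (p = q \<or> snd p = b (fst p) \<and> snd q = b (fst q))}"

lemma equiv_wedge_rel: "equiv (topspace (sum_topology X I)) (wedge_rel X b I)"
  by (rule equivI) (auto simp: wedge_rel_def refl_on_def sym_def trans_def)

text \<open>The empty wedge is the empty space here rather than a point.\<close>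

definition wedge_topology ::
    "('i \<Rightarrow> 'a topology) \<Rightarrow> ('i \<Rightarrow> 'a) \<Rightarrow> 'i set \<Rightarrow> ('i \<times> 'a) set topology" where
  "wedge_topology X b I = quotient_topology (sum_topology X I) (wedge_rel X b I)"

text \<open>The sphere of dimension \<open>-1\<close> is the empty space; a wedge of one such sphere is empty too.\<close>

definition sphere_topology :: "int \<Rightarrow> (nat \<Rightarrow> real) topology" where
  "sphere_topology d = (if d < 0 then discrete_topology {} else nsphere (nat d))"

definition wedge_of_spheres :: "nat \<Rightarrow> int \<Rightarrow> (nat \<times> (nat \<Rightarrow> real)) set topology" where
  "wedge_of_spheres m d =
     wedge_topology (\<lambda>_. sphere_topology d) (\<lambda>_ i. if i = 0 then 1 else 0) {..<m}"


section \<open>Reduced simplicial cohomology with integer coefficients\<close>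

text \<open>The cochain complex is augmented: the empty face carries the cochains of degree \<open>-1\<close>.
  Faces are oriented by a linear order \<open>r\<close> on the vertices, so the sign of the face
  \<open>\<sigma> - {v}\<close> of \<open>\<sigma>\<close> is determined by the number of vertices of \<open>\<sigma>\<close> preceding \<open>v\<close>.\<close>

definition cochain_group :: "'v set set \<Rightarrow> int \<Rightarrow> ('v set \<Rightarrow> int) monoid" where
  "cochain_group K k =
     \<lparr>carrier = {f. \<forall>\<sigma>. f \<sigma> \<noteq> 0 \<longrightarrow> \<sigma> \<in> K \<and> face_dim \<sigma> = k},
      monoid.mult = (\<lambda>f g \<sigma>. f \<sigma> + g \<sigma>), one = (\<lambda>_. 0)\<rparr>"

definition coboundary ::
    "('v \<times> 'v) set \<Rightarrow> 'v set set \<Rightarrow> int \<Rightarrow> ('v set \<Rightarrow> int) \<Rightarrow> 'v set \<Rightarrow> int" where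
  "coboundary r K k f \<sigma> =
     (if \<sigma> \<in> K \<and> face_dim \<sigma> = k + 1
      then \<Sum>v\<in>\<sigma>. (-1) ^ card {u \<in> \<sigma>. u \<noteq> v \<and> (u, v) \<in> r} * f (\<sigma> - {v}) else 0)"

definition cocycles :: "('v \<times> 'v) set \<Rightarrow> 'v set set \<Rightarrow> int \<Rightarrow> ('v set \<Rightarrow> int) set" where
  "cocycles r K k = kernel (cochain_group K k) (cochain_group K (k + 1)) (coboundary r K k)"

definition coboundaries :: "('v \<times> 'v) set \<Rightarrow> 'v set set \<Rightarrow> int \<Rightarrow> ('v set \<Rightarrow> int) set" where
  "coboundaries r K k = coboundary r K (k - 1) ` carrier (cochain_group K (k - 1))"

definition reduced_cohomology ::
    "('v \<times> 'v) set \<Rightarrow> 'v set set \<Rightarrow> int \<Rightarrow> ('v set \<Rightarrow> int) set monoid" where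
  "reduced_cohomology r K k =
     (cochain_group K k)\<lparr>carrier := cocycles r K k\<rparr> Mod coboundaries r K k"

definition cohomology_class ::
    "('v \<times> 'v) set \<Rightarrow> 'v set set \<Rightarrow> int \<Rightarrow> ('v set \<Rightarrow> int) \<Rightarrow> ('v set \<Rightarrow> int) set" where
  "cohomology_class r K k f = coboundaries r K k #>\<^bsub>cochain_group K k\<^esub> f"

definition indicator_cochain :: "'v set \<Rightarrow> 'v set \<Rightarrow> int" where
  "indicator_cochain F \<sigma> = (if \<sigma> = F then 1 else 0)"

definition finite_int_basis :: "('g, 'm) monoid_scheme \<Rightarrow> ('i \<Rightarrow> 'g) \<Rightarrow> 'i set \<Rightarrow> bool" where
  "finite_int_basis H b I \<longleftrightarrow> finite I \<and> b \<in> I \<rightarrow> carrier H \<and>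
     (\<forall>x\<in>carrier H. \<exists>!c. c \<in> I \<rightarrow>\<^sub>E (UNIV :: int set) \<and>
        x = finprod H (\<lambda>i. b i [^]\<^bsub>H\<^esub> c i) I)"

end

theory Submission
  imports Defs "HOL-Analysis.Analysis"
begin

text \<open>The faces of the complex are the arc sets that are acyclic and have at most one arc into each
  vertex. Call \<open>P\<close> the set of arcs that do not start at the complete source \<open>x\<close>. A forest
  \<open>N \<subseteq> P\<close> has exactly one completion \<open>T N\<close> to a spanning tree by arcs starting at \<open>x\<close>: join
  \<open>x\<close> to the roots of all the trees that do not contain it. Hence the face poset is the disjoint union
  of the intervals between \<open>N\<close> and \<open>T N\<close>. Listing the facets \<open>T N\<close> by increasing size of \<open>N\<close> gives
  a shelling. The critical facets are those with \<open>T N = N\<close>, the spanning trees with \<open>x\<close> as a leaf.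
  Without them the complex collapses, interval by interval, onto the simplex \<open>T {}\<close>, so modulo a
  contractible subcomplex it is a wedge of spheres, one for each critical facet. The same
  interval-wise contraction in cohomology gives the basis.\<close>

subsection \<open>Branchings\<close>

text \<open>Passing to a smaller face can only shrink its intersection with \<open>P\<close>. The
  faces with at most \<open>k\<close> arcs in \<open>P\<close>, apart from the critical ones,
  therefore form a subcomplex, and both the cohomological and the topological contraction go through
  the values of \<open>k\<close> one at a time, with a single interval active at each point or face.
  The laborious part is topological. The complex has to be compared with the wedge as a space, so
  the quotient by the acyclic part is handled with explicit maps: a collar of that part is opened
  inside each critical facet, and each facet gets a stereographic chart. All these maps are built
  from one kind of function, the minimum of the barycentric coordinates over a face. It is
  continuous and vanishes unless the face lies in the support, so maps that are described face by
  face can be written as one formula. The number of spheres comes from counting all branchings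
  without an arc out of \<open>x\<close>, by number of arcs, since only this refined count satisfies
  a recurrence. The case of one vertex stands apart: the only face is empty and the sphere has
  dimension -1.\<close>

definition branching :: "('a \<times> 'a) set \<Rightarrow> bool" where
  "branching \<sigma> \<longleftrightarrow> acyclic \<sigma> \<and> inj_on snd \<sigma>"

lemma branching_subset: "branching \<sigma> \<Longrightarrow> \<tau> \<subseteq> \<sigma> \<Longrightarrow> branching \<tau>"
  unfolding branching_def using acyclic_subset inj_on_subset by blast

lemma branching_unique_tail: "branching \<sigma> \<Longrightarrow> (u, v) \<in> \<sigma> \<Longrightarrow> (u', v) \<in> \<sigma> \<Longrightarrow> u = u'"
  unfolding branching_def inj_on_def by fastforce

lemma pcas_append: "pcas u (p @ q) w \<longleftrightarrow> (\<exists>v. pcas u p v \<and> pcas v q w)"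
  by (induction p arbitrary: u) auto

lemma rtrancl_iff_pcas: "(u, v) \<in> \<sigma>\<^sup>* \<longleftrightarrow> (\<exists>p. set p \<subseteq> \<sigma> \<and> pcas u p v)"
proof
  assume "(u, v) \<in> \<sigma>\<^sup>*"
  then show "\<exists>p. set p \<subseteq> \<sigma> \<and> pcas u p v"
  proof (induction rule: converse_rtrancl_induct)
    case base
    show ?case by (rule exI[of _ "[]"]) auto
  next
    case (step y z)
    then obtain p where "set p \<subseteq> \<sigma>" "pcas z p v" by blast
    with step(1) show ?case by (intro exI[of _ "(y, z) # p"]) auto
  qed
next
  have "set p \<subseteq> \<sigma> \<Longrightarrow> pcas u p v \<Longrightarrow> (u, v) \<in> \<sigma>\<^sup>*" for p
    by (induction p arbitrary: u) (auto intro: converse_rtrancl_into_rtrancl)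
  then show "\<exists>p. set p \<subseteq> \<sigma> \<and> pcas u p v \<Longrightarrow> (u, v) \<in> \<sigma>\<^sup>*" by blast
qed

section \<open>From trees and forests to branchings\<close>

lemma awalk_with_proj:
  "pre_digraph.awalk (with_proj G) u p v \<longleftrightarrow> u \<in> pverts G \<and> set p \<subseteq> parcs G \<and> pcas u p v"
  by (simp add: pre_digraph.awalk_def cas_with_proj_eq)

lemma directed_tree_wf:
  assumes "directed_tree T x" "(u, v) \<in> parcs T"
  shows "u \<in> pverts T" "v \<in> pverts T"
  using assms unfolding directed_tree_def
  by (auto dest: pair_wf_digraph.in_arcsD1 pair_wf_digraph.in_arcsD2
      pair_loopfree_digraph.axioms(1))

text \<open>Either defect would produce a second walk from the root: a cycle through
  \<open>v\<close> can be appended to a walk that reaches \<open>v\<close>, and two arcs into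
  \<open>v\<close> end two different walks to \<open>v\<close>.\<close>

lemma branching_directed_tree:
  assumes T: "directed_tree T x"
  shows "branching (parcs T)"
  unfolding branching_def
proof
  have ex1: "\<exists>!p. set p \<subseteq> parcs T \<and> pcas x p y" if "y \<in> pverts T" for y
    using T that unfolding directed_tree_def awalk_with_proj by blast
  show "acyclic (parcs T)"
    unfolding acyclic_def
  proof (intro allI notI)
    fix v assume "(v, v) \<in> (parcs T)\<^sup>+"
    then obtain w where w: "(v, w) \<in> parcs T" "(w, v) \<in> (parcs T)\<^sup>*"
      by (meson tranclD)
    then obtain q where q: "set q \<subseteq> parcs T" "pcas w q v"
      using rtrancl_iff_pcas by metis
    have v: "v \<in> pverts T" using directed_tree_wf[OF T w(1)] by simp
    obtain p where p: "set p \<subseteq> parcs T" "pcas x p v" using ex1[OF v] by blast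
    have "set (p @ (v, w) # q) \<subseteq> parcs T \<and> pcas x (p @ (v, w) # q) v"
      using p q w by (auto simp: pcas_append)
    then have "p @ (v, w) # q = p" using ex1[OF v] p by blast
    then show False by simp
  qed
  show "inj_on snd (parcs T)"
  proof (rule inj_onI, clarsimp)
    fix u u' v assume uv: "(u, v) \<in> parcs T" "(u', v) \<in> parcs T"
    have v: "u \<in> pverts T" "u' \<in> pverts T" "v \<in> pverts T"
      using directed_tree_wf[OF T] uv by blast+
    obtain p p' where p: "set p \<subseteq> parcs T" "pcas x p u" "set p' \<subseteq> parcs T" "pcas x p' u'"
      using ex1 v by metis
    have "set (p @ [(u, v)]) \<subseteq> parcs T \<and> pcas x (p @ [(u, v)]) v"
      "set (p' @ [(u', v)]) \<subseteq> parcs T \<and> pcas x (p' @ [(u', v)]) v"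
      using p uv by (auto simp: pcas_append)
    then have "p @ [(u, v)] = p' @ [(u', v)]" using ex1[OF v(3)] by blast
    then show "u = u'" by simp
  qed
qed

text \<open>Disjointness of the vertex sets makes every arc that touches a tree an arc of that tree
  (fact \<open>arc\<close>). Closed walks, and pairs of arcs with a common head, thus stay inside
  one tree.\<close>

lemma branching_directed_forest:
  assumes "directed_forest F"
  shows "branching (parcs F)"
proof -
  obtain \<T> where tree: "\<And>T. T \<in> \<T> \<Longrightarrow> \<exists>x. directed_tree T x"
    and disj: "\<And>S T v. S \<in> \<T> \<Longrightarrow> T \<in> \<T> \<Longrightarrow> v \<in> pverts S \<Longrightarrow> v \<in> pverts T \<Longrightarrow> S = T"
    and F: "parcs F = (\<Union>T\<in>\<T>. parcs T)"
  proof -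
    obtain \<T> where \<T>: "\<forall>T\<in>\<T>. \<exists>x. directed_tree T x"
      "pairwise (\<lambda>S T. disjnt (pverts S) (pverts T)) \<T>" "parcs F = (\<Union>T\<in>\<T>. parcs T)"
      using assms unfolding directed_forest_def by auto
    show ?thesis
      by (rule that[of \<T>]) (use \<T> in \<open>auto simp: pairwise_def disjnt_iff\<close>)
  qed
  have wf: "u \<in> pverts T \<and> v \<in> pverts T" if "T \<in> \<T>" "(u, v) \<in> parcs T" for T u v
    using tree[OF that(1)] directed_tree_wf that(2) by metis
  have br: "branching (parcs T)" if "T \<in> \<T>" for T
    using tree[OF that] branching_directed_tree by metis
  have arc: "(u, v) \<in> parcs T" if "(u, v) \<in> parcs F" "T \<in> \<T>" "u \<in> pverts T \<or> v \<in> pverts T" for u v T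
  proof -
    obtain S where "S \<in> \<T>" "(u, v) \<in> parcs S" using \<open>(u, v) \<in> parcs F\<close> unfolding F by blast
    then show ?thesis using that(2,3) disj wf by blast
  qed
  have path: "(u, v) \<in> (parcs F)\<^sup>+ \<Longrightarrow> T \<in> \<T> \<Longrightarrow> u \<in> pverts T \<Longrightarrow> (u, v) \<in> (parcs T)\<^sup>+ \<and> v \<in> pverts T" for u v T
  proof (induction rule: trancl_induct)
    case (base y)
    then show ?case using arc wf by blast
  next
    case (step y z)
    then have "(y, z) \<in> parcs T" using arc by blast
    then show ?case using step wf by (meson trancl.trancl_into_trancl)
  qed
  show ?thesis
    unfolding branching_def acyclic_def
  proof (intro conjI allI notI)
    fix v assume v: "(v, v) \<in> (parcs F)\<^sup>+"
    then obtain w where "(v, w) \<in> parcs F" by (meson tranclD)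
    then obtain T where T: "T \<in> \<T>" "v \<in> pverts T" unfolding F using wf by blast
    then have "(v, v) \<in> (parcs T)\<^sup>+" using path v by blast
    then show False using br[OF T(1)] unfolding branching_def acyclic_def by blast
  next
    show "inj_on snd (parcs F)"
    proof (rule inj_onI, clarsimp)
      fix u u' v assume uv: "(u, v) \<in> parcs F" "(u', v) \<in> parcs F"
      then obtain T where T: "T \<in> \<T>" "(u, v) \<in> parcs T" unfolding F by blast
      then have "(u', v) \<in> parcs T" using arc uv T wf by blast
      then show "u = u'" using br T branching_unique_tail by metis
    qed
  qed
qed

section \<open>From branchings back to trees and forests\<close>

lemma rooted_walk_unique:
  assumes "branching \<sigma>" "r \<notin> Range \<sigma>"
  shows "set p \<subseteq> \<sigma> \<Longrightarrow> set q \<subseteq> \<sigma> \<Longrightarrow> pcas r p y \<Longrightarrow> pcas r q y \<Longrightarrow> p = q"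
proof (induction p arbitrary: q y rule: rev_induct)
  case Nil
  show ?case
  proof (cases q rule: rev_cases)
    case (snoc q' e)
    then have "snd e = r" "e \<in> \<sigma>" using Nil by (auto simp: pcas_append)
    then show ?thesis using assms(2) by (metis Range.intros prod.collapse)
  qed simp
next
  case (snoc e p)
  have e: "snd e = y" "pcas r p (fst e)" "e \<in> \<sigma>"
    using snoc.prems by (auto simp: pcas_append)
  show ?case
  proof (cases q rule: rev_cases)
    case Nil
    then have "snd e = r" using snoc.prems e by simp
    then show ?thesis using assms(2) e(3) by (metis Range.intros prod.collapse)
  next
    case (snoc q' e')
    then have e': "snd e' = y" "pcas r q' (fst e')" "e' \<in> \<sigma>"
      using snoc.prems by (auto simp: pcas_append)
    \<comment> \<open>The walks are compared from their far ends: at most one arc enters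
      \<open>y\<close>, so the last arcs agree.\<close>
    then have "e = e'" using e assms(1) unfolding branching_def inj_on_def by metis
    then show ?thesis using snoc.IH[of q' "fst e"] snoc.prems snoc e e' by auto
  qed
qed

lemma directed_tree_below_root:
  assumes br: "branching \<sigma>" and r: "r \<notin> Range \<sigma>"
  shows "directed_tree \<lparr>pverts = \<sigma>\<^sup>* `` {r}, parcs = {(u, v) \<in> \<sigma>. (r, u) \<in> \<sigma>\<^sup>*}\<rparr> r"
    (is "directed_tree ?T r")
proof -
  have arcs: "set p \<subseteq> parcs ?T" if "set p \<subseteq> \<sigma>" "pcas u p v" "(r, u) \<in> \<sigma>\<^sup>*" for p u v
    using that
  proof (induction p arbitrary: u)
    case (Cons e p)
    then have "(r, snd e) \<in> \<sigma>\<^sup>*" by (cases e) (auto intro: rtrancl_into_rtrancl)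
    with Cons show ?case by (cases e) auto
  qed simp
  have "\<exists>!p. set p \<subseteq> parcs ?T \<and> pcas r p y" if "(r, y) \<in> \<sigma>\<^sup>*" for y
  proof -
    obtain p where p: "set p \<subseteq> \<sigma>" "pcas r p y" using \<open>(r, y) \<in> \<sigma>\<^sup>*\<close> rtrancl_iff_pcas by metis
    show ?thesis
    proof (rule ex1I)
      show "set p \<subseteq> parcs ?T \<and> pcas r p y" using arcs p by blast
      fix q assume "set q \<subseteq> parcs ?T \<and> pcas r q y"
      then show "q = p" using rooted_walk_unique[OF br r, of q p y] p by auto
    qed
  qed
  moreover have "pair_loopfree_digraph ?T"
    by unfold_locales
      (use br in \<open>auto simp: branching_def acyclic_def intro: rtrancl_into_rtrancl dest: r_into_trancl\<close>)
  ultimately show ?thesis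
    unfolding directed_tree_def awalk_with_proj by auto
qed

text \<open>Following arcs backwards terminates, since a finite acyclic relation is
  well-founded.\<close>

lemma branching_root_exists:
  assumes "branching \<sigma>" "finite \<sigma>"
  shows "\<exists>r. r \<notin> Range \<sigma> \<and> (r, v) \<in> \<sigma>\<^sup>*"
proof -
  have "wf \<sigma>" using assms finite_acyclic_wf unfolding branching_def by blast
  then show ?thesis
  proof (induction v rule: wf_induct_rule)
    case (less v)
    show ?case
    proof (cases "v \<in> Range \<sigma>")
      case True
      then obtain u where "(u, v) \<in> \<sigma>" by blast
      then show ?thesis using less by (meson rtrancl.rtrancl_into_rtrancl)
    qed blast
  qed
qed

lemma branching_root_unique:
  assumes "branching \<sigma>" "r \<notin> Range \<sigma>" "r' \<notin> Range \<sigma>" "(r, v) \<in> \<sigma>\<^sup>*" "(r', v) \<in> \<sigma>\<^sup>*"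
  shows "r = r'"
  using assms(4,5)
proof (induction rule: rtrancl_induct)
  case base
  then show ?case using assms(2) by (metis Range.intros rtranclE)
next
  case (step y z)
  then show ?case using assms(1,3) by (metis Range.intros branching_unique_tail rtranclE)
qed

lemma rtrancl_mem: "(u, v) \<in> \<sigma>\<^sup>* \<Longrightarrow> \<sigma> \<subseteq> V \<times> V \<Longrightarrow> u \<in> V \<or> v \<in> V \<Longrightarrow> u \<in> V \<and> v \<in> V"
  by (induction rule: rtrancl_induct) auto

text \<open>The trees are indexed by the vertices of \<open>V\<close> that no arc enters. A vertex
  on no arc becomes a one-vertex tree, so the trees also cover \<open>V\<close>.\<close>

lemma directed_forest_branching:
  assumes br: "branching \<sigma>" and fin: "finite \<sigma>" and V: "\<sigma> \<subseteq> V \<times> V"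
  shows "directed_forest \<lparr>pverts = V, parcs = \<sigma>\<rparr>"
proof -
  define tr where "tr r = \<lparr>pverts = \<sigma>\<^sup>* `` {r}, parcs = {(u, v) \<in> \<sigma>. (r, u) \<in> \<sigma>\<^sup>*}\<rparr>" for r
  have root: "\<exists>r\<in>V - Range \<sigma>. (r, v) \<in> \<sigma>\<^sup>*" if "v \<in> V" for v
    using branching_root_exists[OF br fin, of v] rtrancl_mem[OF _ V] that by blast
  have "\<forall>T\<in>tr ` (V - Range \<sigma>). \<exists>r. directed_tree T r"
    using directed_tree_below_root[OF br] by (auto simp: tr_def)
  moreover have "disjnt (pverts (tr r)) (pverts (tr r'))"
    if "r \<in> V - Range \<sigma>" "r' \<in> V - Range \<sigma>" "tr r \<noteq> tr r'" for r r'
    using that branching_root_unique[OF br, of r r'] by (auto simp: tr_def disjnt_iff)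
  then have "pairwise (\<lambda>S T. disjnt (pverts S) (pverts T)) (tr ` (V - Range \<sigma>))"
    unfolding pairwise_def by blast
  moreover have "V = (\<Union>T\<in>tr ` (V - Range \<sigma>). pverts T)"
    using root rtrancl_mem[OF _ V] by (auto simp: tr_def)
  moreover have "\<sigma> = (\<Union>T\<in>tr ` (V - Range \<sigma>). parcs T)"
    using root V by (auto simp: tr_def)
  ultimately show ?thesis
    unfolding directed_forest_def by (intro exI[of _ "tr ` (V - Range \<sigma>)"]) simp
qed

text \<open>A face records arcs only, so the witnessing forest may be taken on all of
  \<open>pverts G\<close>, with isolated vertices added. Membership then becomes a condition on the
  arc set alone.\<close>

lemma forest_complex_eq:
  assumes "pair_digraph G"
  shows "forest_complex G = {\<sigma>. \<sigma> \<subseteq> parcs G \<and> branching \<sigma>}"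
proof (intro equalityI subsetI)
  fix \<sigma> assume "\<sigma> \<in> forest_complex G"
  then show "\<sigma> \<in> {\<sigma>. \<sigma> \<subseteq> parcs G \<and> branching \<sigma>}"
    using branching_directed_forest unfolding forest_complex_def subgraph_def by auto
next
  interpret pair_digraph G by fact
  fix \<sigma> assume s: "\<sigma> \<in> {\<sigma>. \<sigma> \<subseteq> parcs G \<and> branching \<sigma>}"
  have V: "\<sigma> \<subseteq> pverts G \<times> pverts G" using s wellformed' by auto
  have fin: "finite \<sigma>" using s pair_finite_arcs finite_subset by blast
  have "directed_forest \<lparr>pverts = pverts G, parcs = \<sigma>\<rparr>"
    using directed_forest_branching s fin V by blast
  moreover have "subgraph (with_proj \<lparr>pverts = pverts G, parcs = \<sigma>\<rparr>) (with_proj G)"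
    using s V unfolding subgraph_def compatible_def
    by (auto simp: wf_digraph_def intro: wf_digraph_axioms)
  ultimately show "\<sigma> \<in> forest_complex G"
    unfolding forest_complex_def by (force intro: exI[of _ "\<lparr>pverts = pverts G, parcs = \<sigma>\<rparr>"])
qed

section \<open>Counting roots\<close>

lemma card_branching_roots:
  assumes br: "branching \<sigma>" and V: "\<sigma> \<subseteq> V \<times> V" "finite V"
  shows "card (V - Range \<sigma>) = card V - card \<sigma>"
proof -
  have "card (Range \<sigma>) = card \<sigma>"
    using br unfolding branching_def by (metis Range_snd card_image)
  moreover have "Range \<sigma> \<subseteq> V" using V by auto
  ultimately show ?thesis using V by (metis card_Diff_subset finite_subset)
qed

text \<open>Exactly one root reaches \<open>u\<close>. The other roots are the heads at which a new
  arc from \<open>u\<close> may end without closing a cycle. The second claim shows that the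
  subtraction in the first is not truncated.\<close>

lemma card_foreign_roots:
  assumes br: "branching \<sigma>" and V: "\<sigma> \<subseteq> V \<times> V" "finite V" and u: "u \<in> V"
  shows "card {r \<in> V - Range \<sigma>. (r, u) \<notin> \<sigma>\<^sup>*} = card V - card \<sigma> - 1" "card \<sigma> < card V"
proof -
  have fin: "finite \<sigma>" using V by (meson finite_SigmaI finite_subset)
  obtain r where r: "r \<notin> Range \<sigma>" "(r, u) \<in> \<sigma>\<^sup>*" using branching_root_exists[OF br fin] by blast
  then have rV: "r \<in> V - Range \<sigma>" using rtrancl_mem[OF _ V(1)] u by blast
  have "{r \<in> V - Range \<sigma>. (r, u) \<notin> \<sigma>\<^sup>*} = (V - Range \<sigma>) - {r}"
    using branching_root_unique[OF br _ r(1) _ r(2)] r rV by blast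
  then show "card {r \<in> V - Range \<sigma>. (r, u) \<notin> \<sigma>\<^sup>*} = card V - card \<sigma> - 1"
    using rV V card_branching_roots[OF br V] by (simp add: card_Diff_subset)
  have "card (V - Range \<sigma>) > 0" using rV V by (auto simp: card_gt_0_iff)
  then show "card \<sigma> < card V" using card_branching_roots[OF br V] by simp
qed

lemma branching_insert_iff:
  assumes "branching \<sigma>" "(u, v) \<notin> \<sigma>"
  shows "branching (insert (u, v) \<sigma>) \<longleftrightarrow> v \<notin> Range \<sigma> \<and> (v, u) \<notin> \<sigma>\<^sup>*"
  using assms unfolding branching_def acyclic_insert by (auto simp: inj_on_def image_iff)

subsection \<open>Partitioned complexes\<close>

text \<open>The set \<open>\<sigma> \<inter> P\<close> is the label of a face: by
  \<open>T_Int\<close> and \<open>subset_T\<close>, the faces with label \<open>N\<close> are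
  exactly those between \<open>N\<close> and \<open>T N\<close>. By \<open>card_T\<close> the
  complex is pure, and \<open>m\<close> is the number of vertices of a facet, so the dimension is
  \<open>m - 1\<close>. Shelling, cohomology and homotopy type are all derived from these
  assumptions.\<close>

locale partitioned_complex =
  fixes K :: "'v set set" and P :: "'v set" and T :: "'v set \<Rightarrow> 'v set" and m :: nat
  assumes finite_verts: "finite (\<Union>K)"
    and empty_face: "{} \<in> K"
    and face_subset: "\<sigma> \<in> K \<Longrightarrow> \<tau> \<subseteq> \<sigma> \<Longrightarrow> \<tau> \<in> K"
    and T_face: "N \<in> K \<Longrightarrow> N \<subseteq> P \<Longrightarrow> T N \<in> K"
    and T_Int: "N \<in> K \<Longrightarrow> N \<subseteq> P \<Longrightarrow> T N \<inter> P = N"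
    and card_T: "N \<in> K \<Longrightarrow> N \<subseteq> P \<Longrightarrow> card (T N) = m"
    and subset_T: "\<sigma> \<in> K \<Longrightarrow> \<sigma> \<subseteq> T (\<sigma> \<inter> P)"
begin

lemma finite_K: "finite K"
  using finite_verts finite_UnionD by blast

lemma finite_face: "\<sigma> \<in> K \<Longrightarrow> finite \<sigma>"
  using finite_verts by (meson Union_upper finite_subset)

lemma Int_face: "\<sigma> \<in> K \<Longrightarrow> \<sigma> \<inter> P \<in> K"
  using face_subset by blast

lemma card_face: "\<sigma> \<in> K \<Longrightarrow> card \<sigma> \<le> m"
  using subset_T[of \<sigma>] card_T[OF Int_face] T_face[OF Int_face] finite_face
  by (metis card_mono inf_le2)

lemma T_supset: "N \<in> K \<Longrightarrow> N \<subseteq> P \<Longrightarrow> N \<subseteq> T N"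
  using T_Int by blast

lemma facet_iff: "F \<in> facets K \<longleftrightarrow> F \<in> K \<and> card F = m"
proof
  assume "F \<in> facets K"
  then have F: "F \<in> K" "\<And>F'. F' \<in> K \<Longrightarrow> F \<subseteq> F' \<Longrightarrow> F' = F" unfolding facets_def by auto
  then have "T (F \<inter> P) = F" using subset_T T_face[OF Int_face] by simp
  then show "F \<in> K \<and> card F = m" using F(1) card_T[OF Int_face[OF F(1)]] by simp
next
  assume F: "F \<in> K \<and> card F = m"
  have "F' = F" if "F' \<in> K" "F \<subseteq> F'" for F'
    using card_face[OF that(1)] finite_face[OF that(1)] F that(2) card_seteq[of F' F] by simp
  then show "F \<in> facets K" using F unfolding facets_def by blast
qed

lemma facet_eq_T: "F \<in> K \<Longrightarrow> card F = m \<Longrightarrow> F = T (F \<inter> P)"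
  by (metis Int_face T_face card_T card_subset_eq finite_face inf_le2 subset_T)

lemma facets_eq: "facets K = T ` {N \<in> K. N \<subseteq> P}"
  using facet_iff facet_eq_T T_face card_T Int_face by (auto intro!: image_eqI)

lemma inj_on_T: "inj_on T {N \<in> K. N \<subseteq> P}"
  by (rule inj_onI) (metis (mono_tags, lifting) T_Int mem_Collect_eq)

text \<open>For \<open>e\<close> in \<open>N\<close>, the ridge \<open>T N - {e}\<close> has the
  smaller label \<open>N - {e}\<close> and so lies in the earlier facet \<open>T (N - {e})\<close>.
  Conversely, what \<open>T N\<close> shares with an earlier facet misses some \<open>e\<close> in
  \<open>N\<close> and is contained in such a ridge.\<close>

lemma shelling_step:
  assumes i: "1 \<le> i" "i < length Ns" and Ns: "set Ns = {N \<in> K. N \<subseteq> P}" "distinct Ns"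
    and sorted: "sorted (map card Ns)"
  shows "pure_of_dim (Pow (map T Ns ! i) \<inter> (\<Union>j<i. Pow (map T Ns ! j))) (face_dim (map T Ns ! i) - 1)"
    (is "pure_of_dim ?I _")
proof -
  have N: "Ns ! j \<in> K" "Ns ! j \<subseteq> P" if "j < length Ns" for j
    using Ns(1) that nth_mem by blast+
  have I: "?I = {F. F \<subseteq> T (Ns ! i) \<and> (\<exists>j<i. F \<subseteq> T (Ns ! j))}"
    using i by auto
  have "face_dim F = face_dim (T (Ns ! i)) - 1" if "F \<in> facets ?I" for F
  proof -
    have "F \<in> ?I" and maximal: "\<And>F'. F' \<in> ?I \<Longrightarrow> F \<subseteq> F' \<Longrightarrow> F' = F"
      using that unfolding facets_def by simp_all
    then obtain j where F: "F \<subseteq> T (Ns ! i)" and j: "j < i" "F \<subseteq> T (Ns ! j)"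
      unfolding I by blast
    have Ni: "Ns ! i \<in> K" "Ns ! i \<subseteq> P" and Nj: "Ns ! j \<in> K" "Ns ! j \<subseteq> P"
      using N i j by auto
    have "card (Ns ! j) \<le> card (Ns ! i)"
      using sorted j i by (simp add: sorted_iff_nth_mono)
    moreover have "Ns ! j \<noteq> Ns ! i" using Ns(2) i j by (simp add: nth_eq_iff_index_eq)
    \<comment> \<open>The order by size excludes that \<open>Ns ! i\<close> is contained in
      \<open>Ns ! j\<close>. As \<open>e\<close> lies in \<open>P\<close>, it is missing from
      \<open>T (Ns ! j)\<close> as well.\<close>
    ultimately obtain e where e: "e \<in> Ns ! i" "e \<notin> Ns ! j"
      using card_seteq[of "Ns ! j" "Ns ! i"] finite_face[OF Nj(1)] by blast
    have eT: "e \<in> T (Ns ! i)" using e T_supset[OF Ni] by blast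
    have "e \<notin> T (Ns ! j)" using e T_Int[OF Nj] Ni(2) by blast
    then have sub: "F \<subseteq> T (Ns ! i) - {e}" using F j(2) by blast
    define N' where "N' = Ns ! i - {e}"
    have "N' \<in> K" "N' \<subseteq> P" using face_subset[OF Ni(1)] Ni(2) unfolding N'_def by blast+
    then have "N' \<in> set Ns" using Ns(1) by blast
    then obtain l where l: "l < length Ns" "Ns ! l = N'" by (meson in_set_conv_nth)
    have "card (Ns ! l) < card (Ns ! i)"
      unfolding l N'_def using card_Diff1_less[OF finite_face[OF Ni(1)] e(1)] .
    moreover have "card (Ns ! i) \<le> card (Ns ! l)" if "i \<le> l"
      using sorted l(1) that by (simp add: sorted_iff_nth_mono)
    ultimately have "l < i" by (meson leD leI)
    have "(T (Ns ! i) - {e}) \<inter> P = N'" using T_Int[OF Ni] unfolding N'_def by blast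
    moreover have "T (Ns ! i) - {e} \<in> K" using face_subset[OF T_face[OF Ni]] by blast
    ultimately have "T (Ns ! i) - {e} \<subseteq> T (Ns ! l)" using subset_T[of "T (Ns ! i) - {e}"] l by simp
    then have "T (Ns ! i) - {e} \<in> ?I" using \<open>l < i\<close> unfolding I by blast
    then have "T (Ns ! i) - {e} = F" using maximal sub by blast
    then have "card (T (Ns ! i)) = Suc (card F)"
      using card_Suc_Diff1[OF finite_face[OF T_face[OF Ni]] eT] by simp
    then show ?thesis unfolding face_dim_def by simp
  qed
  moreover have "?I \<noteq> {}" using i unfolding I by (auto intro!: exI[of _ "{}"] exI[of _ 0])
  ultimately show ?thesis unfolding pure_of_dim_def using i(2) by (auto simp del: UN_simps)
qed

theorem shellable: "shellable K"
proof -
  have "finite {N \<in> K. N \<subseteq> P}" using finite_K by simp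
  from finite_distinct_list[OF this]
  obtain xs where xs: "set xs = {N \<in> K. N \<subseteq> P}" "distinct xs" by (elim exE conjE)
  define Ns where "Ns = sort_key card xs"
  have Ns: "set Ns = {N \<in> K. N \<subseteq> P}" "distinct Ns" "sorted (map card Ns)"
    unfolding Ns_def set_sort distinct_sort using xs by (simp_all only: sorted_sort_key)
  show ?thesis
    unfolding shellable_def
  proof (intro exI[of _ "map T Ns"] conjI allI impI)
    show "distinct (map T Ns)" using Ns inj_on_T by (simp add: distinct_map)
    show "set (map T Ns) = facets K" using Ns facets_eq by simp
    fix i assume "1 \<le> i \<and> i < length (map T Ns)"
    then show "pure_of_dim (Pow (map T Ns ! i) \<inter> (\<Union>j<i. Pow (map T Ns ! j))) (face_dim (map T Ns ! i) - 1)"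
      using shelling_step[OF _ _ Ns(1,2,3)] by simp
  qed
qed

end

subsection \<open>Forests of a digraph with a complete source\<close>

text \<open>By reflexivity, the condition \<open>(r, x) \<notin> N\<^sup>*\<close> also excludes
  \<open>r = x\<close>, so no loop is added.\<close>

definition source_completion :: "'a set \<Rightarrow> 'a \<Rightarrow> ('a \<times> 'a) set \<Rightarrow> ('a \<times> 'a) set" where
  "source_completion V x N = N \<union> Pair x ` {r \<in> V - Range N. (r, x) \<notin> N\<^sup>*}"

text \<open>A cycle has to use an added arc \<open>(x, r)\<close> and return from \<open>r\<close>
  to \<open>x\<close>. Added arcs start at \<open>x\<close>, so the return can be cut at its first
  visit to \<open>x\<close> and then runs in \<open>N\<close>, against the choice of
  \<open>r\<close>.\<close>

lemma branching_source_completion: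
  assumes br: "branching N"
  shows "branching (source_completion V x N)" (is "branching ?M")
proof -
  have reach: "(a, x) \<in> ?M\<^sup>* \<Longrightarrow> (a, x) \<in> N\<^sup>*" for a
  proof (induction rule: converse_rtrancl_induct)
    case (step a b)
    then show ?case
      by (auto simp: source_completion_def intro: converse_rtrancl_into_rtrancl)
  qed simp
  have path: "(a, b) \<in> ?M\<^sup>+ \<Longrightarrow> (a, b) \<in> N\<^sup>+ \<or> (a, x) \<in> ?M\<^sup>* \<and> (\<exists>r. (x, r) \<in> ?M - N \<and> (r, b) \<in> ?M\<^sup>*)" for a b
  proof (induction rule: trancl_induct)
    case (base b)
    then show ?case by (auto simp: source_completion_def)
  next
    case (step b c)
    show ?case
    proof (cases "(b, c) \<in> N")
      case True
      with step show ?thesis by (meson rtrancl.rtrancl_into_rtrancl trancl.trancl_into_trancl)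
    next
      case False
      then have "b = x" using step(2) by (auto simp: source_completion_def)
      then show ?thesis using step False by (metis DiffI rtrancl.rtrancl_refl trancl_into_rtrancl)
    qed
  qed
  have "False" if "(a, a) \<in> ?M\<^sup>+" for a
  proof -
    have "(a, a) \<notin> N\<^sup>+" using br unfolding branching_def acyclic_def by blast
    then have "(a, x) \<in> ?M\<^sup>* \<and> (\<exists>r. (x, r) \<in> ?M - N \<and> (r, a) \<in> ?M\<^sup>*)"
      using path[OF that] by simp
    then obtain r where r: "(a, x) \<in> ?M\<^sup>*" "(x, r) \<in> ?M - N" "(r, a) \<in> ?M\<^sup>*"
      by metis
    then have "(r, x) \<in> N\<^sup>*" using reach by (meson rtrancl_trans)
    then show False using r(2) by (auto simp: source_completion_def)
  qed
  moreover have "inj_on snd ?M"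
    using br unfolding branching_def source_completion_def inj_on_def by (auto simp: Range_iff)
  ultimately show ?thesis unfolding branching_def acyclic_def by blast
qed

lemma card_source_completion:
  assumes br: "branching N" and V: "N \<subseteq> V \<times> V" "finite V" "x \<in> V" and N: "x \<notin> Domain N"
  shows "card (source_completion V x N) = card V - 1"
proof -
  have "N \<inter> Pair x ` {r \<in> V - Range N. (r, x) \<notin> N\<^sup>*} = {}" using N by auto
  moreover have "finite N" using V by (meson finite_SigmaI finite_subset)
  ultimately show ?thesis
    using card_foreign_roots[OF br V(1,2,3)] V(2) unfolding source_completion_def
    by (subst card_Un_disjoint) (auto simp: card_image inj_on_def)
qed

lemma partitioned_forest_complex:
  assumes G: "pair_digraph G" and x: "complete_source G x"
  shows "partitioned_complex (forest_complex G) {e. fst e \<noteq> x} (source_completion (pverts G) x)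
    (card (pverts G) - 1)"
proof
  interpret pair_digraph G by fact
  note forests = forest_complex_eq[OF G]
  have V: "parcs G \<subseteq> pverts G \<times> pverts G" using wellformed' by auto
  have xV: "x \<in> pverts G" using x unfolding complete_source_def by blast
  show "finite (\<Union>(forest_complex G))"
    by (rule finite_subset[OF _ pair_finite_arcs]) (auto simp: forests)
  show "{} \<in> forest_complex G" unfolding forests by (simp add: branching_def acyclic_def)
  show "\<tau> \<in> forest_complex G" if "\<sigma> \<in> forest_complex G" "\<tau> \<subseteq> \<sigma>" for \<sigma> \<tau>
    using that branching_subset unfolding forests by blast
  fix N assume N: "N \<in> forest_complex G" "N \<subseteq> {e. fst e \<noteq> x}"
  have NV: "branching N" "N \<subseteq> pverts G \<times> pverts G" "x \<notin> Domain N"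
    using N V unfolding forests by auto
  have "source_completion (pverts G) x N \<subseteq> parcs G"
    using N x unfolding forests source_completion_def complete_source_def by auto
  then show "source_completion (pverts G) x N \<in> forest_complex G"
    using branching_source_completion[OF NV(1)] unfolding forests by simp
  show "source_completion (pverts G) x N \<inter> {e. fst e \<noteq> x} = N"
    using N unfolding source_completion_def by auto
  show "card (source_completion (pverts G) x N) = card (pverts G) - 1"
    using card_source_completion[OF NV(1,2) pair_finite_verts xV NV(3)] .
next
  interpret pair_digraph G by fact
  fix \<sigma> assume "\<sigma> \<in> forest_complex G"
  then have s: "\<sigma> \<subseteq> parcs G" "branching \<sigma>" unfolding forest_complex_eq[OF G] by auto
  show "\<sigma> \<subseteq> source_completion (pverts G) x (\<sigma> \<inter> {e. fst e \<noteq> x})"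
  proof
    fix e assume e: "e \<in> \<sigma>"
    obtain u v where [simp]: "e = (u, v)" by (cases e)
    show "e \<in> source_completion (pverts G) x (\<sigma> \<inter> {e. fst e \<noteq> x})"
    proof (cases "u = x")
      case True
      \<comment> \<open>An arc \<open>(x, v)\<close> of \<sigma> is the only arc into
        \<open>v\<close>, and a path from \<open>v\<close> to \<open>x\<close> would close a cycle
        with it. So \<open>v\<close> is one of the roots that the completion joins to
        \<open>x\<close>.\<close>
      have "v \<notin> Range (\<sigma> \<inter> {e. fst e \<noteq> x})"
        using branching_unique_tail[OF s(2)] e True by fastforce
      moreover have "(v, x) \<notin> (\<sigma> \<inter> {e. fst e \<noteq> x})\<^sup>*"
      proof
        assume "(v, x) \<in> (\<sigma> \<inter> {e. fst e \<noteq> x})\<^sup>*"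
        then have "(v, x) \<in> \<sigma>\<^sup>*" by (rule rtrancl_mono[THEN subsetD, rotated]) simp
        then have "(v, v) \<in> \<sigma>\<^sup>+" using e True by (simp add: rtrancl_into_trancl1)
        then show False using s(2) unfolding branching_def acyclic_def by blast
      qed
      moreover have "v \<in> pverts G" using e s(1) wellformed' by auto
      ultimately show ?thesis using True unfolding source_completion_def by auto
    next
      case False
      then show ?thesis using e unfolding source_completion_def by simp
    qed
  qed
qed

subsection \<open>Counting branchings\<close>

definition branchings_avoiding :: "'a set \<Rightarrow> 'a \<Rightarrow> nat \<Rightarrow> ('a \<times> 'a) set set" where
  "branchings_avoiding V x k = {N. N \<subseteq> V \<times> V \<and> branching N \<and> x \<notin> Domain N \<and> card N = k}"

lemma finite_branchings_avoiding: "finite V \<Longrightarrow> finite (branchings_avoiding V x k)"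
  by (rule finite_subset[of _ "Pow (V \<times> V)"]) (auto simp: branchings_avoiding_def)

text \<open>Pitman's double counting: adding an arc to a branching with \<open>k\<close> arcs means choosing the
  tail among the vertices other than \<open>x\<close> and the head among the foreign roots.\<close>

lemma card_branchings_avoiding_Suc:
  assumes V: "finite V" "x \<in> V"
  shows "Suc k * card (branchings_avoiding V x (Suc k)) =
    (card V - 1) * (card V - 1 - k) * card (branchings_avoiding V x k)"
proof -
  let ?B = "branchings_avoiding V x"
  define ext where "ext N = {e. e \<notin> N \<and> insert e N \<in> ?B (Suc k)}" for N
  have fin: "finite N" if "N \<in> ?B j" for N j
    using that V(1) unfolding branchings_avoiding_def by (auto intro: finite_subset)
  have ext: "card (ext N) = (card V - 1) * (card V - 1 - k)" if N: "N \<in> ?B k" for N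
  proof -
    have NV: "N \<subseteq> V \<times> V" "branching N" "x \<notin> Domain N" "card N = k"
      using N unfolding branchings_avoiding_def by auto
    have "ext N = (SIGMA u:V - {x}. {v \<in> V - Range N. (v, u) \<notin> N\<^sup>*})"
    proof (rule Set.set_eqI, rule iffI)
      fix e assume "e \<in> ext N"
      then show "e \<in> (SIGMA u:V - {x}. {v \<in> V - Range N. (v, u) \<notin> N\<^sup>*})"
        using branching_insert_iff[OF NV(2), of "fst e" "snd e"]
        unfolding ext_def branchings_avoiding_def by (cases e) auto
    next
      fix e assume e: "e \<in> (SIGMA u:V - {x}. {v \<in> V - Range N. (v, u) \<notin> N\<^sup>*})"
      then have "e \<notin> N" by (auto simp: Range_iff)
      then show "e \<in> ext N"
        using e branching_insert_iff[OF NV(2), of "fst e" "snd e"] NV fin[OF N]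
        unfolding ext_def branchings_avoiding_def by (cases e) auto
    qed
    moreover have "card {v \<in> V - Range N. (v, u) \<notin> N\<^sup>*} = card V - 1 - k" if "u \<in> V - {x}" for u
      using card_foreign_roots(1)[OF NV(2,1) V(1), of u] that NV(4) by simp
    ultimately show ?thesis using V by (simp add: card_SigmaI)
  qed
  have card_ext: "card (SIGMA M:?B (Suc k). M) = Suc k * card (?B (Suc k))"
  proof -
    have "card (SIGMA M:?B (Suc k). M) = (\<Sum>M\<in>?B (Suc k). card M)"
      by (intro card_SigmaI ballI finite_branchings_avoiding[OF V(1)] fin)
    also have "\<dots> = (\<Sum>M\<in>?B (Suc k). Suc k)"
      by (intro sum.cong refl) (simp add: branchings_avoiding_def)
    finally show ?thesis by simp
  qed
  have "bij_betw (\<lambda>(M, e). (M - {e}, e)) (SIGMA M:?B (Suc k). M) (SIGMA N:?B k. ext N)"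
  proof (rule bij_betw_byWitness[where f' = "\<lambda>(N, e). (insert e N, e)"])
    have "M - {e} \<in> ?B k \<and> e \<in> ext (M - {e})" if "M \<in> ?B (Suc k)" "e \<in> M" for M e
      using that branching_subset[of M "M - {e}"]
      by (auto simp: branchings_avoiding_def ext_def insert_absorb card_Diff_singleton)
    then show "(\<lambda>(M, e). (M - {e}, e)) ` (SIGMA M:?B (Suc k). M) \<subseteq> (SIGMA N:?B k. ext N)"
      by (auto simp del: insert_iff)
  qed (auto simp: ext_def insert_absorb)
  then have "card (SIGMA M:?B (Suc k). M) = card (SIGMA N:?B k. ext N)"
    by (rule bij_betw_same_card)
  moreover have "card (SIGMA N:?B k. ext N) = (card V - 1) * (card V - 1 - k) * card (?B k)"
  proof (subst card_SigmaI)
    have "ext N \<subseteq> V \<times> V" for N unfolding ext_def branchings_avoiding_def by auto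
    then show "\<forall>N\<in>?B k. finite (ext N)" using V(1) by (meson finite_SigmaI finite_subset)
  qed (use finite_branchings_avoiding[OF V(1)] ext in auto)
  ultimately show ?thesis using card_ext by simp
qed

text \<open>The closed form satisfies the recurrence by the absorption identities for binomial
  coefficients, after cancelling \<open>Suc k\<close>. For \<open>k = card V - 1\<close> the
  binomial coefficient is 1 and only the power remains.\<close>

lemma card_branchings_avoiding:
  assumes V: "finite V" "x \<in> V"
  shows "card (branchings_avoiding V x k) = (card V - 1 choose k) * (card V - 1) ^ k"
proof (induction k)
  case 0
  have "branchings_avoiding V x 0 = {{}}"
    using V(1) by (auto simp: branchings_avoiding_def branching_def acyclic_def finite_subset card_eq_0_iff)
  then show ?case by simp
next
  case (Suc k)
  have "Suc k * (card V - 1 choose Suc k) = (card V - 1 - k) * (card V - 1 choose k)"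
    by (metis binomial_absorb_comp binomial_absorption)
  then have "Suc k * card (branchings_avoiding V x (Suc k)) =
      Suc k * ((card V - 1 choose Suc k) * (card V - 1) ^ Suc k)"
    unfolding card_branchings_avoiding_Suc[OF V] Suc.IH
    by (metis (no_types, opaque_lifting) mult.assoc mult.left_commute power_Suc)
  then show ?case by (simp only: mult_cancel1 nat.simps simp_thms)
qed

subsection \<open>Coboundaries\<close>

text \<open>The incidence sign in \<open>coboundary\<close>, isolated so that its values on a face
  and on the subfaces can be compared.\<close>

definition osign :: "('v \<times> 'v) set \<Rightarrow> 'v set \<Rightarrow> 'v \<Rightarrow> int" where
  "osign r \<sigma> v = (-1) ^ card {u \<in> \<sigma>. u \<noteq> v \<and> (u, v) \<in> r}"

lemma osign_sq [simp]: "osign r \<sigma> v * osign r \<sigma> v = 1"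
  unfolding osign_def by (simp flip: power_mult_distrib)

lemma osign_remove:
  assumes "finite \<sigma>" "v \<in> \<sigma>" "u \<noteq> v"
  shows "osign r (\<sigma> - {v}) u = (if (v, u) \<in> r then - osign r \<sigma> u else osign r \<sigma> u)"
proof (cases "(v, u) \<in> r")
  case True
  let ?S = "{w \<in> \<sigma>. w \<noteq> u \<and> (w, u) \<in> r}"
  have "finite ?S" "v \<in> ?S" using assms True by auto
  from card_Suc_Diff1[OF this] have "card ?S = Suc (card (?S - {v}))" by simp
  moreover have "{w \<in> \<sigma> - {v}. w \<noteq> u \<and> (w, u) \<in> r} = ?S - {v}" by auto
  ultimately show ?thesis using True unfolding osign_def by simp
next
  case False
  then have "{w \<in> \<sigma> - {v}. w \<noteq> u \<and> (w, u) \<in> r} = {w \<in> \<sigma>. w \<noteq> u \<and> (w, u) \<in> r}" by auto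
  then show ?thesis using False unfolding osign_def by simp
qed

text \<open>Exactly one of \<open>u\<close> and \<open>v\<close> precedes the other, so exactly one
  of the two signs flips when the other vertex is removed. This minus sign makes coning a
  contracting homotopy.\<close>

lemma osign_swap:
  assumes "linear_order_on E r" "finite \<sigma>" "\<sigma> \<subseteq> E" "u \<in> \<sigma>" "v \<in> \<sigma>" "u \<noteq> v"
  shows "osign r (\<sigma> - {v}) u * osign r (\<sigma> - {u}) v = - (osign r \<sigma> u * osign r \<sigma> v)"
proof -
  have "(u, v) \<in> r \<longleftrightarrow> (v, u) \<notin> r"
    using assms unfolding linear_order_on_def partial_order_on_def total_on_def antisym_def by blast
  then show ?thesis using assms by (simp add: osign_remove)
qed

lemma coboundary_osign:
  "coboundary r K k f \<sigma> =
    (if \<sigma> \<in> K \<and> face_dim \<sigma> = k + 1 then \<Sum>v\<in>\<sigma>. osign r \<sigma> v * f (\<sigma> - {v}) else 0)"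
  unfolding coboundary_def osign_def by simp

lemma coboundary_add:
  "coboundary r K k (\<lambda>\<sigma>. f \<sigma> + g \<sigma>) \<sigma> = coboundary r K k f \<sigma> + coboundary r K k g \<sigma>"
  unfolding coboundary_osign by (simp add: ring_distribs sum.distrib)

lemma coboundary_diff:
  "coboundary r K k (\<lambda>\<sigma>. f \<sigma> - g \<sigma>) \<sigma> = coboundary r K k f \<sigma> - coboundary r K k g \<sigma>"
  unfolding coboundary_osign by (simp add: ring_distribs sum_subtractf)

lemma cochain_iff:
  "f \<in> carrier (cochain_group K k) \<longleftrightarrow> (\<forall>\<sigma>. f \<sigma> \<noteq> 0 \<longrightarrow> \<sigma> \<in> K \<and> face_dim \<sigma> = k)"
  by (simp add: cochain_group_def)

lemma coboundary_cochain: "coboundary r K k f \<in> carrier (cochain_group K (k + 1))"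
  by (auto simp: cochain_iff coboundary_def split: if_splits)

lemma coboundary_cochain_pred: "coboundary r K (k - 1) f \<in> carrier (cochain_group K k)"
  using coboundary_cochain[of r K "k - 1" f] by simp

text \<open>Removing two vertices in either order leaves the same face, with opposite signs.\<close>

lemma coboundary_coboundary:
  assumes K: "\<And>\<sigma>. \<sigma> \<in> K \<Longrightarrow> finite \<sigma> \<and> \<sigma> \<subseteq> E" "\<And>\<sigma> \<tau>. \<sigma> \<in> K \<Longrightarrow> \<tau> \<subseteq> \<sigma> \<Longrightarrow> \<tau> \<in> K"
    and r: "linear_order_on E r" and l: "l = k + 1"
  shows "coboundary r K l (coboundary r K k f) \<sigma> = 0"
proof (cases "\<sigma> \<in> K \<and> face_dim \<sigma> = k + 2")
  case True
  \<comment> \<open>The value 0 on the diagonal lets both sums range over all of \<sigma>, so that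
    exchanging the sums turns antisymmetry into vanishing.\<close>
  define G where "G v u = (if u = v then 0 else osign r \<sigma> v * osign r (\<sigma> - {v}) u * f (\<sigma> - {v} - {u}))" for v u
  have s: "finite \<sigma>" "\<sigma> \<subseteq> E" using K True by auto
  have "coboundary r K l (coboundary r K k f) \<sigma> = (\<Sum>v\<in>\<sigma>. osign r \<sigma> v * coboundary r K k f (\<sigma> - {v}))"
    using True l unfolding coboundary_osign[of r K l] by simp
  also have "\<dots> = (\<Sum>v\<in>\<sigma>. \<Sum>u\<in>\<sigma>. G v u)"
  proof (rule sum.cong[OF refl])
    fix v assume v: "v \<in> \<sigma>"
    have "\<sigma> - {v} \<in> K" "face_dim (\<sigma> - {v}) = k + 1"
      using True K(2)[of \<sigma> "\<sigma> - {v}"] card_Suc_Diff1[OF s(1) v] by (auto simp: face_dim_def)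
    then have "osign r \<sigma> v * coboundary r K k f (\<sigma> - {v}) = (\<Sum>u\<in>\<sigma> - {v}. G v u)"
      unfolding coboundary_osign by (simp add: G_def sum_distrib_left mult.assoc)
    also have "\<dots> = (\<Sum>u\<in>\<sigma>. G v u)"
      using v s(1) by (simp add: sum.remove G_def)
    finally show "osign r \<sigma> v * coboundary r K k f (\<sigma> - {v}) = (\<Sum>u\<in>\<sigma>. G v u)" .
  qed
  finally have *: "coboundary r K l (coboundary r K k f) \<sigma> = (\<Sum>v\<in>\<sigma>. \<Sum>u\<in>\<sigma>. G v u)" .
  have anti: "G v u = - G u v" if "v \<in> \<sigma>" "u \<in> \<sigma>" for u v
  proof (cases "u = v")
    case False
    have "\<sigma> - {v} - {u} = \<sigma> - {u} - {v}" by auto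
    moreover have "(v, u) \<in> r \<longleftrightarrow> (u, v) \<notin> r"
      using r s that False unfolding linear_order_on_def partial_order_on_def total_on_def antisym_def by blast
    ultimately show ?thesis using False that s(1) by (simp add: G_def osign_remove)
  qed (simp add: G_def)
  have "(\<Sum>v\<in>\<sigma>. \<Sum>u\<in>\<sigma>. G v u) = - (\<Sum>v\<in>\<sigma>. \<Sum>u\<in>\<sigma>. G u v)"
    unfolding sum_negf[symmetric] by (intro sum.cong refl anti)
  also have "(\<Sum>v\<in>\<sigma>. \<Sum>u\<in>\<sigma>. G u v) = (\<Sum>v\<in>\<sigma>. \<Sum>u\<in>\<sigma>. G v u)" by (rule sum.swap)
  finally show ?thesis using * by simp
next
  case False
  then show ?thesis using l unfolding coboundary_osign[of r K l] by auto
qed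

context partitioned_complex
begin

subsection \<open>The acyclic part\<close>

text \<open>By \<open>card_T\<close>, having \<open>m\<close> elements amounts to
  \<open>T N = N\<close>: these are the intervals with a single face.\<close>

definition critical :: "'v set set" where
  "critical = {N \<in> K. N \<subseteq> P \<and> card N = m}"

text \<open>The choice depends on the label only. Adding or removing the apex therefore stays inside
  one interval and pairs off its faces.\<close>

definition apex :: "'v set \<Rightarrow> 'v" where
  "apex N = (SOME v. v \<in> T N - N)"

definition cone_part :: "'v set set" where
  "cone_part = K - critical"

lemma cone_part_face: "\<sigma> \<in> cone_part \<Longrightarrow> \<sigma> \<in> K"
  unfolding cone_part_def by blast

text \<open>Critical faces have the maximal size \<open>m\<close> and are never proper subfaces, so
  deleting them leaves a complex.\<close>

lemma cone_part_subset: "\<sigma> \<in> cone_part \<Longrightarrow> \<tau> \<subseteq> \<sigma> \<Longrightarrow> \<tau> \<in> cone_part"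
  using face_subset[of \<sigma> \<tau>] card_face[of \<sigma>] finite_face[of \<sigma>] card_seteq[of \<sigma> \<tau>]
  unfolding cone_part_def critical_def by auto

lemma T_proper:
  assumes "\<sigma> \<in> cone_part"
  shows "\<sigma> \<inter> P \<subset> T (\<sigma> \<inter> P)"
proof -
  have s: "\<sigma> \<in> K" "\<sigma> \<notin> critical" using assms unfolding cone_part_def by auto
  have N: "\<sigma> \<inter> P \<in> K" "\<sigma> \<inter> P \<subseteq> P" using Int_face[OF s(1)] by auto
  have "\<sigma> \<inter> P \<noteq> T (\<sigma> \<inter> P)"
  proof
    assume eq: "\<sigma> \<inter> P = T (\<sigma> \<inter> P)"
    then have "\<sigma> \<inter> P = \<sigma>" using subset_T[OF s(1)] by blast
    then show False using s eq card_T[OF N] N unfolding critical_def by auto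
  qed
  then show ?thesis using T_supset[OF N] by blast
qed

lemma insert_cone_part:
  assumes s: "\<sigma> \<in> cone_part" and v: "v \<in> T (\<sigma> \<inter> P)" "v \<notin> \<sigma> \<inter> P"
  shows "v \<notin> P" "insert v \<sigma> \<inter> P = \<sigma> \<inter> P" "insert v \<sigma> \<in> cone_part"
proof -
  have N: "\<sigma> \<in> K" "\<sigma> \<inter> P \<in> K" "\<sigma> \<inter> P \<subseteq> P" using s Int_face cone_part_face by auto
  show vP: "v \<notin> P" using T_Int[OF N(2,3)] v by blast
  then show "insert v \<sigma> \<inter> P = \<sigma> \<inter> P" by blast
  have "insert v \<sigma> \<in> K" using face_subset[OF T_face[OF N(2,3)]] subset_T[OF N(1)] v by blast
  then show "insert v \<sigma> \<in> cone_part" using vP unfolding cone_part_def critical_def by auto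
qed

lemma apex:
  assumes "\<sigma> \<in> cone_part"
  shows "apex (\<sigma> \<inter> P) \<in> T (\<sigma> \<inter> P)" "apex (\<sigma> \<inter> P) \<notin> \<sigma> \<inter> P"
proof -
  have "\<exists>v. v \<in> T (\<sigma> \<inter> P) - \<sigma> \<inter> P" using T_proper[OF assms] by blast
  from someI_ex[OF this] show "apex (\<sigma> \<inter> P) \<in> T (\<sigma> \<inter> P)" "apex (\<sigma> \<inter> P) \<notin> \<sigma> \<inter> P"
    unfolding apex_def by simp_all
qed

lemma insert_apex:
  assumes "\<sigma> \<in> cone_part"
  shows "apex (\<sigma> \<inter> P) \<notin> P" "insert (apex (\<sigma> \<inter> P)) \<sigma> \<inter> P = \<sigma> \<inter> P"
    "insert (apex (\<sigma> \<inter> P)) \<sigma> \<in> cone_part"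
  using insert_cone_part[OF assms apex[OF assms]] .

subsection \<open>Top cohomology\<close>

text \<open>Coning with the apex is a contracting homotopy on each interval; between intervals it has
  error terms only towards larger \<open>N\<close>, so iterating it kills a cocycle level by level.\<close>

definition cone_op :: "('v \<times> 'v) set \<Rightarrow> ('v set \<Rightarrow> int) \<Rightarrow> 'v set \<Rightarrow> int" where
  "cone_op r f \<tau> = (let v = apex (\<tau> \<inter> P) in
     if \<tau> \<in> cone_part \<and> v \<notin> \<tau> then osign r (insert v \<tau>) v * f (insert v \<tau>) else 0)"

lemma cone_op_cochain:
  assumes "f \<in> carrier (cochain_group K k)"
  shows "cone_op r f \<in> carrier (cochain_group K (k - 1))"
  unfolding cochain_iff
proof (intro allI impI)
  fix \<tau> assume t: "cone_op r f \<tau> \<noteq> 0"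
  let ?v = "apex (\<tau> \<inter> P)"
  have v: "\<tau> \<in> cone_part" "?v \<notin> \<tau>" "f (insert ?v \<tau>) \<noteq> 0"
    using t unfolding cone_op_def Let_def by (auto split: if_splits)
  then have "\<tau> \<in> K" "finite \<tau>" "face_dim (insert ?v \<tau>) = k"
    using assms cone_part_face finite_face unfolding cochain_iff by auto
  then show "\<tau> \<in> K \<and> face_dim \<tau> = k - 1" using v(2) by (simp add: face_dim_def)
qed

text \<open>Removing a vertex of \<open>P\<close> leads to a smaller label, where \<open>f\<close>
  and \<open>cone_op r f\<close> vanish. The remaining terms keep the label and hence the apex, so
  the computation is that of the contracting homotopy of a cone.\<close>

lemma cone_op_step:
  assumes r: "linear_order_on E r" "\<Union>K \<subseteq> E"
    and f: "f \<in> carrier (cochain_group K j)"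
    and cocycle: "\<And>\<sigma>. \<sigma> \<in> cone_part \<Longrightarrow> coboundary r K j f \<sigma> = 0"
    and vanish: "\<And>\<sigma>. \<sigma> \<in> cone_part \<Longrightarrow> card (\<sigma> \<inter> P) < k \<Longrightarrow> f \<sigma> = 0"
    and s: "\<sigma> \<in> cone_part" "card (\<sigma> \<inter> P) \<le> k"
  shows "coboundary r K (j - 1) (cone_op r f) \<sigma> = f \<sigma>"
proof (cases "face_dim \<sigma> = j")
  case False
  then show ?thesis using f unfolding coboundary_osign cochain_iff by auto
next
  case True
  have sK: "\<sigma> \<in> K" "finite \<sigma>" using s(1) cone_part_face finite_face by auto
  let ?v = "apex (\<sigma> \<inter> P)"
  have cob: "coboundary r K (j - 1) (cone_op r f) \<sigma> = (\<Sum>u\<in>\<sigma>. osign r \<sigma> u * cone_op r f (\<sigma> - {u}))"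
    using True sK unfolding coboundary_osign by simp
  have lower: "card ((\<sigma> - {u}) \<inter> P) < k" if "u \<in> \<sigma> \<inter> P" for u
  proof -
    have "card ((\<sigma> - {u}) \<inter> P) < card (\<sigma> \<inter> P)"
      using that sK(2) by (intro psubset_card_mono) auto
    then show ?thesis using s(2) by simp
  qed
  have sub: "\<sigma> - {u} \<in> cone_part" for u using cone_part_subset[OF s(1)] by blast
  have P0: "cone_op r f (\<sigma> - {u}) = 0" if "u \<in> \<sigma> \<inter> P" for u
    using vanish[OF insert_apex(3)[OF sub]] lower[OF that] insert_apex(2)[OF sub, of u]
    unfolding cone_op_def Let_def by simp
  have nP: "(\<sigma> - {u}) \<inter> P = \<sigma> \<inter> P" if "u \<notin> P" for u using that by blast
  show ?thesis
  proof (cases "?v \<in> \<sigma>")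
    case True
    have vP: "?v \<notin> P" using insert_apex(1)[OF s(1)] .
    \<comment> \<open>For \<open>u\<close> outside \<open>P\<close> the smaller face still contains
      its own apex, where \<open>cone_op\<close> is 0. Only the face opposite the apex
      contributes.\<close>
    have "cone_op r f (\<sigma> - {u}) = 0" if "u \<in> \<sigma> - {?v}" for u
      using that True P0[of u] nP[of u] by (cases "u \<in> P") (auto simp: cone_op_def Let_def)
    then have "coboundary r K (j - 1) (cone_op r f) \<sigma> = osign r \<sigma> ?v * cone_op r f (\<sigma> - {?v})"
      unfolding cob using True sK(2) by (simp add: sum.remove)
    also have "cone_op r f (\<sigma> - {?v}) = osign r \<sigma> ?v * f \<sigma>"
      using sub[of ?v] nP[OF vP] True by (simp add: cone_op_def Let_def insert_absorb)
    finally show ?thesis by (simp flip: mult.assoc)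
  next
    case False
    \<comment> \<open>The cocycle condition on the cone over \<sigma> expresses
      \<open>f \<sigma>\<close> through the faces of the cone that contain the apex, and these are
      the values that \<open>cone_op\<close> reads.\<close>
    define \<rho> where "\<rho> = insert ?v \<sigma>"
    have rho: "\<rho> \<in> cone_part" "\<rho> \<inter> P = \<sigma> \<inter> P" "finite \<rho>" "\<rho> - {?v} = \<sigma>"
      using insert_apex(3)[OF s(1)] insert_apex(2)[OF s(1)] sK False unfolding \<rho>_def by auto
    have rhoE: "\<rho> \<subseteq> E" using rho(1) cone_part_face r(2) by blast
    have dim: "face_dim \<rho> = j + 1"
      using \<open>face_dim \<sigma> = j\<close> False sK(2) unfolding \<rho>_def face_dim_def by simp
    have "0 = (\<Sum>w\<in>\<rho>. osign r \<rho> w * f (\<rho> - {w}))"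
      using cocycle[OF rho(1)] rho(1) cone_part_face dim unfolding coboundary_osign by auto
    also have "\<dots> = osign r \<rho> ?v * f \<sigma> + (\<Sum>u\<in>\<sigma>. osign r \<rho> u * f (\<rho> - {u}))"
      using rho False sK(2) by (simp add: \<rho>_def)
    finally have cyc: "(\<Sum>u\<in>\<sigma>. osign r \<rho> u * f (\<rho> - {u})) = - (osign r \<rho> ?v * f \<sigma>)" by simp
    have "osign r \<sigma> u * cone_op r f (\<sigma> - {u}) = - osign r \<rho> ?v * (osign r \<rho> u * f (\<rho> - {u}))"
      if u: "u \<in> \<sigma>" for u
    proof (cases "u \<in> P")
      case True
      have "(\<rho> - {u}) \<inter> P = (\<sigma> - {u}) \<inter> P" using rho(2) by blast
      then have "f (\<rho> - {u}) = 0"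
        using vanish[OF cone_part_subset[OF rho(1)], of "\<rho> - {u}"] lower[of u] u True by auto
      then show ?thesis using P0[of u] u True by simp
    next
      case False
      have uv: "u \<noteq> ?v" using u \<open>?v \<notin> \<sigma>\<close> by blast
      have "insert ?v (\<sigma> - {u}) = \<rho> - {u}" using uv unfolding \<rho>_def by blast
      then have "cone_op r f (\<sigma> - {u}) = osign r (\<rho> - {u}) ?v * f (\<rho> - {u})"
        using sub[of u] nP[OF False] \<open>?v \<notin> \<sigma>\<close> by (simp add: cone_op_def Let_def)
      moreover have "osign r \<sigma> u * osign r (\<rho> - {u}) ?v = - (osign r \<rho> u * osign r \<rho> ?v)"
        using osign_swap[OF r(1) rho(3) rhoE, of u ?v] u uv rho(4) by (simp add: \<rho>_def)
      ultimately show ?thesis by (simp flip: mult.assoc)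
    qed
    then have "coboundary r K (j - 1) (cone_op r f) \<sigma>
        = - osign r \<rho> ?v * (\<Sum>u\<in>\<sigma>. osign r \<rho> u * f (\<rho> - {u}))"
      unfolding cob sum_distrib_left by (intro sum.cong) auto
    also have "\<dots> = f \<sigma>" unfolding cyc by (simp flip: mult.assoc)
    finally show ?thesis .
  qed
qed

text \<open>The values of \<open>f\<close> are matched label size by label size: once
  \<open>g\<close> is right below size \<open>k\<close>, the error \<open>f'\<close> is a cocycle
  vanishing there, and its cone corrects size \<open>k\<close>. No label has more than
  \<open>m\<close> elements.\<close>

lemma cone_part_cocycle:
  assumes r: "linear_order_on E r" "\<Union>K \<subseteq> E"
    and f: "f \<in> carrier (cochain_group K j)"
    and cocycle: "\<And>\<sigma>. \<sigma> \<in> cone_part \<Longrightarrow> coboundary r K j f \<sigma> = 0"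
  shows "\<exists>g \<in> carrier (cochain_group K (j - 1)). \<forall>\<sigma>\<in>cone_part. f \<sigma> = coboundary r K (j - 1) g \<sigma>"
proof -
  have "\<exists>g \<in> carrier (cochain_group K (j - 1)).
      \<forall>\<sigma>\<in>cone_part. card (\<sigma> \<inter> P) < k \<longrightarrow> f \<sigma> = coboundary r K (j - 1) g \<sigma>" for k
  proof (induction k)
    case 0
    show ?case by (rule bexI[of _ "\<lambda>_. 0"]) (auto simp: cochain_iff)
  next
    case (Suc k)
    then obtain g where g: "g \<in> carrier (cochain_group K (j - 1))"
      "\<And>\<sigma>. \<sigma> \<in> cone_part \<Longrightarrow> card (\<sigma> \<inter> P) < k \<Longrightarrow> f \<sigma> = coboundary r K (j - 1) g \<sigma>"
      by blast
    define f' where "f' \<sigma> = f \<sigma> - coboundary r K (j - 1) g \<sigma>" for \<sigma>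
    have f'1: "f' \<in> carrier (cochain_group K j)"
      using f coboundary_cochain_pred[of r K j g] unfolding f'_def cochain_iff by (metis diff_0_right)
    have "coboundary r K j (coboundary r K (j - 1) g) \<sigma> = 0" for \<sigma>
      by (rule coboundary_coboundary[OF _ _ r(1)]) (use finite_face face_subset r(2) in auto)
    then have f'2: "coboundary r K j f' \<sigma> = 0" if "\<sigma> \<in> cone_part" for \<sigma>
      using cocycle[OF that] unfolding f'_def coboundary_diff by simp
    have f'3: "f' \<sigma> = 0" if "\<sigma> \<in> cone_part" "card (\<sigma> \<inter> P) < k" for \<sigma>
      using g(2)[OF that] unfolding f'_def by simp
    let ?g = "\<lambda>\<sigma>. g \<sigma> + cone_op r f' \<sigma>"
    have "?g \<in> carrier (cochain_group K (j - 1))"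
      using g(1) cone_op_cochain[OF f'1, of r] unfolding cochain_iff by (metis add_0)
    moreover have "f \<sigma> = coboundary r K (j - 1) ?g \<sigma>" if "\<sigma> \<in> cone_part" "card (\<sigma> \<inter> P) < Suc k" for \<sigma>
      using cone_op_step[OF r f'1 f'2 f'3, of k \<sigma>] that f'_def[of \<sigma>] unfolding coboundary_add by simp
    ultimately show ?case by blast
  qed
  then obtain g where g: "g \<in> carrier (cochain_group K (j - 1))"
    "\<And>\<sigma>. \<sigma> \<in> cone_part \<Longrightarrow> card (\<sigma> \<inter> P) < Suc m \<Longrightarrow> f \<sigma> = coboundary r K (j - 1) g \<sigma>"
    by blast
  have "card (\<sigma> \<inter> P) < Suc m" if "\<sigma> \<in> cone_part" for \<sigma>
    using card_face[OF Int_face[OF cone_part_face[OF that]]] by simp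
  then show ?thesis using g by blast
qed

end

section \<open>Cochain groups and cohomology classes as cosets\<close>

lemma cochain_group_simps [simp]:
  "f \<otimes>\<^bsub>cochain_group K k\<^esub> g = (\<lambda>\<sigma>. f \<sigma> + g \<sigma>)"
  "\<one>\<^bsub>cochain_group K k\<^esub> = (\<lambda>_. 0)"
  by (simp_all add: cochain_group_def)

lemma comm_group_cochain_group: "comm_group (cochain_group K k)"
proof (rule comm_groupI)
  fix f assume f: "f \<in> carrier (cochain_group K k)"
  have "(\<lambda>\<sigma>. - f \<sigma>) \<in> carrier (cochain_group K k)" using f by (simp add: cochain_iff)
  moreover have "(\<lambda>\<sigma>. - f \<sigma>) \<otimes>\<^bsub>cochain_group K k\<^esub> f = \<one>\<^bsub>cochain_group K k\<^esub>" by simp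
  ultimately show "\<exists>g\<in>carrier (cochain_group K k). g \<otimes>\<^bsub>cochain_group K k\<^esub> f = \<one>\<^bsub>cochain_group K k\<^esub>"
    by blast
next
  fix f g assume "f \<in> carrier (cochain_group K k)" "g \<in> carrier (cochain_group K k)"
  then show "f \<otimes>\<^bsub>cochain_group K k\<^esub> g \<in> carrier (cochain_group K k)"
    unfolding cochain_iff cochain_group_simps by (metis add_0)
qed (auto simp: cochain_iff fun_eq_iff)

lemma cochain_group_inv:
  assumes "f \<in> carrier (cochain_group K k)"
  shows "inv\<^bsub>cochain_group K k\<^esub> f = (\<lambda>\<sigma>. - f \<sigma>)"
proof -
  interpret comm_group "cochain_group K k" by (rule comm_group_cochain_group)
  show ?thesis by (rule inv_equality) (use assms in \<open>auto simp: cochain_iff\<close>)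
qed

lemma cochain_group_int_pow:
  assumes "f \<in> carrier (cochain_group K k)"
  shows "f [^]\<^bsub>cochain_group K k\<^esub> (c :: int) = (\<lambda>\<sigma>. c * f \<sigma>)"
proof -
  interpret comm_group "cochain_group K k" by (rule comm_group_cochain_group)
  have pow: "f [^]\<^bsub>cochain_group K k\<^esub> n = (\<lambda>\<sigma>. int n * f \<sigma>)" for n :: nat
    by (induction n) (auto simp: algebra_simps)
  have "f [^]\<^bsub>cochain_group K k\<^esub> nat (- c) \<in> carrier (cochain_group K k)"
    using assms by simp
  from cochain_group_inv[OF this] show ?thesis
    unfolding int_pow_def2 by (auto simp: pow)
qed

lemma coboundaries_subset: "coboundaries r K k \<subseteq> carrier (cochain_group K k)"
  unfolding coboundaries_def using coboundary_cochain_pred by blast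

lemma subgroup_coboundaries: "subgroup (coboundaries r K k) (cochain_group K k)"
proof -
  interpret comm_group "cochain_group K k" by (rule comm_group_cochain_group)
  show ?thesis
  proof (rule subgroupI)
    show "coboundaries r K k \<noteq> {}" unfolding coboundaries_def cochain_group_def by auto
    fix f assume f: "f \<in> coboundaries r K k"
    then obtain g where g: "g \<in> carrier (cochain_group K (k - 1))" "f = coboundary r K (k - 1) g"
      unfolding coboundaries_def by blast
    have "(\<lambda>\<sigma>. - f \<sigma>) = coboundary r K (k - 1) (\<lambda>\<sigma>. - g \<sigma>)"
      unfolding g(2) coboundary_osign by (auto simp: fun_eq_iff sum_negf)
    moreover have "(\<lambda>\<sigma>. - g \<sigma>) \<in> carrier (cochain_group K (k - 1))" using g(1) by (simp add: cochain_iff)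
    ultimately have "(\<lambda>\<sigma>. - f \<sigma>) \<in> coboundaries r K k" unfolding coboundaries_def by blast
    moreover have "f \<in> carrier (cochain_group K k)" using f coboundaries_subset by blast
    ultimately show "inv\<^bsub>cochain_group K k\<^esub> f \<in> coboundaries r K k" by (simp add: cochain_group_inv)
  next
    fix f f' assume "f \<in> coboundaries r K k" "f' \<in> coboundaries r K k"
    then obtain g g' where g: "g \<in> carrier (cochain_group K (k - 1))" "f = coboundary r K (k - 1) g"
      "g' \<in> carrier (cochain_group K (k - 1))" "f' = coboundary r K (k - 1) g'"
      unfolding coboundaries_def by blast
    have "(\<lambda>\<sigma>. f \<sigma> + f' \<sigma>) = coboundary r K (k - 1) (\<lambda>\<sigma>. g \<sigma> + g' \<sigma>)"
      unfolding g(2,4) coboundary_add ..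
    moreover have "(\<lambda>\<sigma>. g \<sigma> + g' \<sigma>) \<in> carrier (cochain_group K (k - 1))"
      using g(1,3) unfolding cochain_iff by (metis add_0)
    ultimately show "f \<otimes>\<^bsub>cochain_group K k\<^esub> f' \<in> coboundaries r K k"
      unfolding coboundaries_def by auto
  qed (rule coboundaries_subset)
qed

lemma cohomology_class_eq_iff:
  assumes "f \<in> carrier (cochain_group K k)" "g \<in> carrier (cochain_group K k)"
  shows "cohomology_class r K k f = cohomology_class r K k g \<longleftrightarrow> (\<lambda>\<sigma>. f \<sigma> - g \<sigma>) \<in> coboundaries r K k"
proof -
  interpret comm_group "cochain_group K k" by (rule comm_group_cochain_group)
  note sub = subgroup_coboundaries[of r K k]
  have mem: "f \<in> cohomology_class r K k g \<longleftrightarrow> (\<lambda>\<sigma>. f \<sigma> - g \<sigma>) \<in> coboundaries r K k"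
    unfolding cohomology_class_def r_coset_def by (force simp: fun_eq_iff)
  show ?thesis
    using mem repr_independence[OF _ assms(2) sub, of f] rcos_self[OF assms(1) sub]
    unfolding cohomology_class_def by auto
qed

context partitioned_complex
begin

text \<open>In top degree every cochain is a cocycle. Subtracting the coboundary that matches it on
  \<open>cone_part\<close> leaves a cochain supported on the critical facets, and its values there
  are the coefficients. They are unique because a coboundary that vanishes on
  \<open>cone_part\<close> is the coboundary of a cochain that is itself a coboundary, hence
  0.\<close>

theorem cohomology_basis:
  assumes r: "linear_order_on E r" "\<Union>K \<subseteq> E" and d: "d = int m - 1"
    and I: "finite I" "bij_betw \<phi> I critical"
  shows "finite_int_basis (reduced_cohomology r K d) (\<lambda>i. cohomology_class r K d (indicator_cochain (\<phi> i))) I"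
proof -
  let ?C = "cochain_group K d"
  let ?H = "reduced_cohomology r K d"
  let ?cl = "cohomology_class r K d"
  interpret C: comm_group ?C by (rule comm_group_cochain_group)
  have "coboundary r K d f \<sigma> = 0" for f \<sigma>
    using card_face[of \<sigma>] d unfolding coboundary_def face_dim_def by auto
  then have top: "coboundary r K d f = (\<lambda>_. 0)" for f by (rule ext)
  have "cocycles r K d = carrier ?C" unfolding cocycles_def kernel_def top by auto
  then have H: "?H = ?C Mod coboundaries r K d"
    unfolding reduced_cohomology_def by (simp add: cochain_group_def)
  note sub = subgroup_coboundaries[of r K d]
  have normal: "coboundaries r K d \<lhd> ?C" using sub C.normal_iff_subgroup by blast
  interpret H: comm_group ?H unfolding H by (rule C.abelian_FactGroup[OF sub])
  have cl_hom: "?cl f \<otimes>\<^bsub>?H\<^esub> ?cl g = ?cl (\<lambda>\<sigma>. f \<sigma> + g \<sigma>)" if "f \<in> carrier ?C" "g \<in> carrier ?C" for f g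
    using normal.r_coset_hom_Mod[OF normal] that unfolding hom_def cohomology_class_def H by simp
  have cl_pow: "?cl f [^]\<^bsub>?H\<^esub> (c :: int) = ?cl (\<lambda>\<sigma>. c * f \<sigma>)" if "f \<in> carrier ?C" for f c
    using normal.FactGroup_int_pow[OF normal that, of c] cochain_group_int_pow[OF that, of c]
    unfolding cohomology_class_def H by simp
  have cl_carrier: "carrier ?H = ?cl ` carrier ?C"
    unfolding H carrier_FactGroup cohomology_class_def ..
  have phi: "\<phi> i \<in> K \<and> face_dim (\<phi> i) = d" if "i \<in> I" for i
    using I(2) that d unfolding bij_betw_def critical_def face_dim_def by auto
  have ind: "indicator_cochain (\<phi> i) \<in> carrier ?C" if "i \<in> I" for i
    using phi[OF that] by (auto simp: cochain_iff indicator_cochain_def)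
  \<comment> \<open>Partial index sets \<open>J\<close> serve the induction that evaluates
    \<open>finprod\<close>.\<close>
  define comb where "comb J c \<sigma> = (\<Sum>i\<in>J. c i * indicator_cochain (\<phi> i) \<sigma>)" for J and c :: "'a \<Rightarrow> int" and \<sigma>
  have comb: "comb J c \<in> carrier ?C" if "J \<subseteq> I" for J c
    unfolding cochain_iff
  proof (intro allI impI)
    fix \<sigma> assume "comb J c \<sigma> \<noteq> 0"
    then obtain i where "i \<in> J" "indicator_cochain (\<phi> i) \<sigma> \<noteq> 0"
      unfolding comb_def by (auto elim: sum.not_neutral_contains_not_neutral)
    then show "\<sigma> \<in> K \<and> face_dim \<sigma> = d" using ind[of i] that unfolding cochain_iff by blast
  qed
  have comb_phi: "comb I c (\<phi> i) = c i" if "i \<in> I" for c i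
  proof -
    have "comb I c (\<phi> i) = (\<Sum>j\<in>I. if j = i then c i else 0)"
      unfolding comb_def using I(2) that
      by (intro sum.cong) (auto simp: indicator_cochain_def bij_betw_def inj_on_def)
    then show ?thesis using I(1) that by simp
  qed
  have comb_0: "comb I c \<sigma> = 0" if "\<sigma> \<notin> critical" for c \<sigma>
    unfolding comb_def using I(2) that
    by (intro sum.neutral) (auto simp: indicator_cochain_def bij_betw_def)
  have finprod: "finprod ?H (\<lambda>i. ?cl (indicator_cochain (\<phi> i)) [^]\<^bsub>?H\<^esub> c i) J = ?cl (comb J c)"
    if "J \<subseteq> I" for J and c :: "'a \<Rightarrow> int"
  proof -
    have "finite J" using that I(1) finite_subset by blast
    then show ?thesis using that
    proof (induction rule: finite_induct)
      case empty
      have "?cl (comb {} c) = \<one>\<^bsub>?H\<^esub>"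
        using C.coset_mult_one[OF coboundaries_subset] unfolding cohomology_class_def H comb_def by simp
      then show ?case by simp
    next
      case (insert i J)
      have i: "i \<in> I" and J: "J \<subseteq> I" using insert by auto
      have ci: "(\<lambda>\<sigma>. c j * indicator_cochain (\<phi> j) \<sigma>) \<in> carrier ?C" if "j \<in> I" for j
        using ind[OF that] by (auto simp: cochain_iff)
      then have "?cl (\<lambda>\<sigma>. c j * indicator_cochain (\<phi> j) \<sigma>) \<in> carrier ?H" if "j \<in> I" for j
        using that unfolding cl_carrier by blast
      then have "finprod ?H (\<lambda>i. ?cl (indicator_cochain (\<phi> i)) [^]\<^bsub>?H\<^esub> c i) (insert i J)
          = ?cl (\<lambda>\<sigma>. c i * indicator_cochain (\<phi> i) \<sigma>) \<otimes>\<^bsub>?H\<^esub> ?cl (comb J c)"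
        using insert J i by (subst H.finprod_insert) (auto simp: cl_pow[OF ind])
      also have "\<dots> = ?cl (comb (insert i J) c)"
      proof -
        have "comb (insert i J) c = (\<lambda>\<sigma>. c i * indicator_cochain (\<phi> i) \<sigma> + comb J c \<sigma>)"
          by (rule ext) (use insert.hyps in \<open>simp add: comb_def\<close>)
        then show ?thesis unfolding cl_hom[OF ci[OF i] comb[OF J]] by simp
      qed
      finally show ?case .
    qed
  qed
  show ?thesis
    unfolding finite_int_basis_def
  proof (intro conjI ballI)
    show "finite I" by (rule I(1))
    show "(\<lambda>i. ?cl (indicator_cochain (\<phi> i))) \<in> I \<rightarrow> carrier ?H"
      using ind unfolding cl_carrier by blast
    fix x assume "x \<in> carrier ?H"
    then obtain f where f: "f \<in> carrier ?C" "x = ?cl f" unfolding cl_carrier by blast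
    obtain g where g: "g \<in> carrier (cochain_group K (d - 1))"
      "\<And>\<sigma>. \<sigma> \<in> cone_part \<Longrightarrow> f \<sigma> = coboundary r K (d - 1) g \<sigma>"
      using cone_part_cocycle[OF r f(1)] unfolding top by blast
    define c where "c = (\<lambda>i\<in>I. f (\<phi> i) - coboundary r K (d - 1) g (\<phi> i))"
    have "f \<sigma> - comb I c \<sigma> = coboundary r K (d - 1) g \<sigma>" for \<sigma>
    proof (cases "\<sigma> \<in> critical")
      case True
      then obtain i where "i \<in> I" "\<sigma> = \<phi> i" using I(2) unfolding bij_betw_def by blast
      then show ?thesis using comb_phi by (simp add: c_def)
    next
      case False
      have "f \<sigma> = coboundary r K (d - 1) g \<sigma>"
      proof (cases "\<sigma> \<in> K")
        case True
        then show ?thesis using False g(2) unfolding cone_part_def by blast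
      next
        case False
        then have "f \<sigma> = 0" using f(1) unfolding cochain_iff by blast
        then show ?thesis using False by (simp add: coboundary_def)
      qed
      then show ?thesis using comb_0[OF False] by simp
    qed
    then have "(\<lambda>\<sigma>. f \<sigma> - comb I c \<sigma>) \<in> coboundaries r K d"
      using g(1) unfolding coboundaries_def by (auto simp: fun_eq_iff)
    then have xc: "x = ?cl (comb I c)"
      using cohomology_class_eq_iff[OF f(1) comb[OF subset_refl]] f(2) by blast
    show "\<exists>!c. c \<in> I \<rightarrow>\<^sub>E (UNIV :: int set) \<and>
        x = finprod ?H (\<lambda>i. ?cl (indicator_cochain (\<phi> i)) [^]\<^bsub>?H\<^esub> c i) I"
      unfolding finprod[OF subset_refl]
    proof (rule ex1I[of _ c])
      show "c \<in> I \<rightarrow>\<^sub>E UNIV \<and> x = ?cl (comb I c)" using xc by (simp add: c_def)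
      fix c' assume c': "c' \<in> I \<rightarrow>\<^sub>E (UNIV :: int set) \<and> x = ?cl (comb I c')"
      then have "(\<lambda>\<sigma>. comb I c' \<sigma> - comb I c \<sigma>) \<in> coboundaries r K d"
        using cohomology_class_eq_iff[OF comb comb] xc by blast
      then obtain h where h: "h \<in> carrier (cochain_group K (d - 1))"
        "(\<lambda>\<sigma>. comb I c' \<sigma> - comb I c \<sigma>) = coboundary r K (d - 1) h"
        unfolding coboundaries_def by blast
      have "coboundary r K (d - 1) h \<sigma> = 0" if "\<sigma> \<in> cone_part" for \<sigma>
        using fun_cong[OF h(2), of \<sigma>] comb_0 that unfolding cone_part_def by simp
      then obtain h' where h': "\<And>\<sigma>. \<sigma> \<in> cone_part \<Longrightarrow> h \<sigma> = coboundary r K (d - 1 - 1) h' \<sigma>"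
        using cone_part_cocycle[OF r h(1)] by blast
      have hh: "h = coboundary r K (d - 1 - 1) h'"
      proof
        fix \<sigma>
        show "h \<sigma> = coboundary r K (d - 1 - 1) h' \<sigma>"
        proof (cases "\<sigma> \<in> K \<and> face_dim \<sigma> = d - 1")
          case True
          \<comment> \<open>Critical faces have dimension \<open>d\<close>, so the solution on
            \<open>cone_part\<close> covers every face that can carry \<open>h\<close>.\<close>
          then have "\<sigma> \<in> cone_part" using d unfolding cone_part_def critical_def face_dim_def by auto
          then show ?thesis by (rule h')
        next
          case False
          then show ?thesis using h(1) by (auto simp: cochain_iff coboundary_def)
        qed
      qed
      have "coboundary r K (d - 1) h \<sigma> = 0" for \<sigma>
        unfolding hh by (rule coboundary_coboundary[OF _ _ r(1)]) (use finite_face face_subset r(2) in auto)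
      then have "comb I c' (\<phi> i) = comb I c (\<phi> i)" for i
        using fun_cong[OF h(2), of "\<phi> i"] by simp
      then have "c' i = c i" if "i \<in> I" for i using comb_phi[OF that] by metis
      then show "c' = c" using c' PiE_ext[of c' I "\<lambda>_. UNIV" c] by (simp add: c_def)
    qed
  qed
qed

end

subsection \<open>Quotients by contractible subspaces\<close>

lemma homotopic_with_imp_exists:
  assumes "homotopic_with P X Y f g"
  obtains h where "continuous_map (prod_topology (top_of_set {0..1::real}) X) Y h"
    "\<And>x. h (0, x) = f x" "\<And>x. h (1, x) = g x" "\<And>t. t \<in> {0..1} \<Longrightarrow> P (\<lambda>x. h (t, x))"
  using assms unfolding homotopic_with_def by blast

text \<open>As \<open>g\<close> is constant on the fibres of \<open>q\<close>, it factors through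
  \<open>Y\<close>, and the factor \<open>p\<close> is the homotopy inverse. The homotopy from the
  identity to \<open>g\<close> descends to \<open>Y\<close> because each of its stages respects the
  fibres.\<close>

lemma homotopy_equivalent_quotient:
  assumes q: "quotient_map X Y q"
    and hom: "homotopic_with (\<lambda>f. \<forall>x\<in>topspace X. \<forall>y\<in>topspace X. q x = q y \<longrightarrow> q (f x) = q (f y)) X X id g"
    and g: "\<And>x y. x \<in> topspace X \<Longrightarrow> y \<in> topspace X \<Longrightarrow> q x = q y \<Longrightarrow> g x = g y"
  shows "X homotopy_equivalent_space Y"
proof -
  let ?I = "top_of_set {0..1::real}"
  have gc: "continuous_map X X g" using homotopic_with_imp_continuous_maps[OF hom] by blast
  have qc: "continuous_map X Y q" using q by (rule quotient_imp_continuous_map)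
  have qim: "q ` topspace X = topspace Y" using q by (rule quotient_imp_surjective_map)
  obtain p where p: "continuous_map Y X p" "\<And>x. x \<in> topspace X \<Longrightarrow> p (q x) = g x"
    by (rule quotient_map_lift_exists[OF q gc], erule (2) g) blast
  obtain k where k: "continuous_map (prod_topology ?I X) X k"
    "\<And>x. k (0, x) = id x" "\<And>x. k (1, x) = g x"
    and comp: "\<And>t. t \<in> {0..1} \<Longrightarrow> \<forall>x\<in>topspace X. \<forall>y\<in>topspace X. q x = q y \<longrightarrow> q (k (t, x)) = q (k (t, y))"
    by (rule homotopic_with_imp_exists[OF hom], rule that; assumption)
  \<comment> \<open>To descend the homotopy, the product of \<open>q\<close> with the interval has
    to be a quotient map again. It is, because the interval is locally compact and
    Hausdorff.\<close>
  have Q: "quotient_map (prod_topology ?I X) (prod_topology ?I Y) (\<lambda>(t, x). (t, q x))"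
  proof (rule quotient_map_prod_right[OF _ _ q])
    have "locally_compact_space (top_of_set {0..1::real})"
      by (intro compact_imp_locally_compact_space) (simp add: compact_space_subtopology)
    then show "locally_compact_space ?I" .
    show "Hausdorff_space ?I \<or> regular_space ?I" by (simp add: Hausdorff_space_subtopology)
  qed
  have qk: "continuous_map (prod_topology ?I X) Y (q \<circ> k)"
    using continuous_map_compose[OF k(1) qc] .
  have resp: "(q \<circ> k) u = (q \<circ> k) v"
    if "u \<in> topspace (prod_topology ?I X)" "v \<in> topspace (prod_topology ?I X)"
      "(\<lambda>(t, x). (t, q x)) u = (\<lambda>(t, x). (t, q x)) v" for u v
  proof -
    obtain t x s y where u: "u = (t, x)" "v = (s, y)" by (metis surj_pair)
    then have tx: "t \<in> {0..1}" "x \<in> topspace X" "y \<in> topspace X" "q x = q y" and "s = t"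
      using that by simp_all
    then have "q (k (t, x)) = q (k (s, y))" using comp[rule_format, OF tx] by (simp only:)
    then show ?thesis unfolding u by (simp only: o_apply)
  qed
  obtain K where K: "continuous_map (prod_topology ?I Y) Y K"
    "\<And>u. u \<in> topspace (prod_topology ?I X) \<Longrightarrow> K ((\<lambda>(t, x). (t, q x)) u) = (q \<circ> k) u"
    by (rule quotient_map_lift_exists[OF Q qk], erule (2) resp) blast
  have K': "K (t, q x) = q (k (t, x))" if "t \<in> {0..1}" "x \<in> topspace X" for t x
    using K(2)[of "(t, x)"] that by simp
  have "homotopic_with (\<lambda>_. True) Y Y id (q \<circ> p)"
  proof (subst homotopic_with, simp, intro exI[of _ K] conjI ballI)
    show "continuous_map (prod_topology ?I Y) Y K" by (rule K(1))
    fix y assume "y \<in> topspace Y"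
    then obtain x where x: "x \<in> topspace X" "y = q x" using qim by blast
    show "K (0, y) = id y" using K'[of 0 x] x k(2) by simp
    show "K (1, y) = (q \<circ> p) y" using K'[of 1 x] x k(3) p(2) by simp
  qed simp
  moreover have "homotopic_with (\<lambda>_. True) X X id (p \<circ> q)"
  proof (rule homotopic_with_eq)
    show "homotopic_with (\<lambda>_. True) X X id g" by (rule homotopic_with_mono[OF hom]) simp
  qed (use p in auto)
  ultimately show ?thesis
    unfolding homotopy_equivalent_space_def using p(1) qc
    by (intro exI[of _ q] exI[of _ p] conjI homotopic_with_symD[of _ _ _ id])
qed

text \<open>The homotopy from the identity to \<open>f\<close> is continued by the contraction of
  \<open>S'\<close> composed with \<open>f\<close>.\<close>

lemma contractible_deformation:
  fixes f :: "'a :: topological_space \<Rightarrow> 'a"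
  assumes hom: "homotopic_with_canon (\<lambda>_. True) S S id f" and f: "f ` S \<subseteq> S'" and "S' \<subseteq> S"
    and S': "contractible S'"
  shows "contractible S"
proof -
  obtain a where a: "homotopic_with_canon (\<lambda>_. True) S' S' id (\<lambda>_. a)"
    using S' unfolding contractible_def by blast
  have "continuous_on S f" using homotopic_with_imp_continuous[OF hom] by blast
  then have "homotopic_with_canon (\<lambda>_. True) S S' (id \<circ> f) ((\<lambda>_. a) \<circ> f)"
    using f by (intro homotopic_with_compose_continuous_map_right[OF a]) auto
  then have "homotopic_with_canon (\<lambda>_. True) S S f (\<lambda>_. a)"
    using homotopic_with_subset_right[OF _ \<open>S' \<subseteq> S\<close>] by (simp add: o_def id_def)
  then show ?thesis unfolding contractible_def using homotopic_with_trans[OF hom] by blast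
qed

subsection \<open>Geometric realizations\<close>

definition geo :: "'v set set \<Rightarrow> ('v \<Rightarrow> real) set" where
  "geo K = {\<alpha>. (\<forall>v. 0 \<le> \<alpha> v) \<and> {v. \<alpha> v \<noteq> 0} \<in> K \<and> (\<Sum>v | \<alpha> v \<noteq> 0. \<alpha> v) = 1}"

lemma realization_geo: "realization K = top_of_set (geo K)"
  unfolding realization_def geo_def euclidean_product_topology ..

lemma geo_nonneg: "\<alpha> \<in> geo K \<Longrightarrow> 0 \<le> \<alpha> v"
  unfolding geo_def by blast

lemma geo_support: "\<alpha> \<in> geo K \<Longrightarrow> {v. \<alpha> v \<noteq> 0} \<in> K"
  unfolding geo_def by blast

lemma geo_mono: "K \<subseteq> L \<Longrightarrow> geo K \<subseteq> geo L"
  unfolding geo_def by blast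

lemma sum_support:
  fixes \<alpha> :: "'v \<Rightarrow> real"
  assumes "finite V" "{v. \<alpha> v \<noteq> 0} \<subseteq> V"
  shows "(\<Sum>v | \<alpha> v \<noteq> 0. \<alpha> v) = sum \<alpha> V"
  using assms by (intro sum.mono_neutral_left) auto

lemma geo_sum: "\<alpha> \<in> geo K \<Longrightarrow> finite V \<Longrightarrow> {v. \<alpha> v \<noteq> 0} \<subseteq> V \<Longrightarrow> sum \<alpha> V = 1"
  unfolding geo_def using sum_support[of V \<alpha>] by auto

lemma geoI:
  assumes "finite F" "\<And>v. 0 \<le> \<alpha> v" "\<And>v. v \<notin> F \<Longrightarrow> \<alpha> v = 0" "sum \<alpha> F = 1" "{v. \<alpha> v \<noteq> 0} \<in> K"
  shows "\<alpha> \<in> geo K"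
  unfolding geo_def using assms sum_support[of F \<alpha>] by auto

lemma continuous_on_coord [continuous_intros]:
  "continuous_on S (\<lambda>\<alpha> :: 'v \<Rightarrow> 'b :: topological_space. \<alpha> v)"
  using continuous_on_product_coordinates by (rule continuous_on_subset) simp

lemma continuous_on_Min [continuous_intros]:
  fixes f :: "'i \<Rightarrow> 'a :: topological_space \<Rightarrow> real"
  assumes "finite I" "I \<noteq> {}" "\<And>i. i \<in> I \<Longrightarrow> continuous_on S (f i)"
  shows "continuous_on S (\<lambda>x. Min ((\<lambda>i. f i x) ` I))"
  using assms
proof (induction rule: finite_ne_induct)
  case (insert i I)
  then have "(\<lambda>x. Min ((\<lambda>i. f i x) ` insert i I)) = (\<lambda>x. min (f i x) (Min ((\<lambda>i. f i x) ` I)))"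
    by (intro ext) simp
  with insert show ?case by (auto intro!: continuous_on_min)
qed simp

lemma homotopic_segment:
  fixes f :: "('v \<Rightarrow> real) \<Rightarrow> 'v \<Rightarrow> real"
  assumes f: "continuous_on S f"
    and seg: "\<And>\<alpha> t. \<alpha> \<in> S \<Longrightarrow> 0 \<le> t \<Longrightarrow> t \<le> 1 \<Longrightarrow> (\<lambda>v. (1 - t) * \<alpha> v + t * f \<alpha> v) \<in> S"
  shows "homotopic_with_canon (\<lambda>_. True) S S id f"
proof -
  let ?h = "\<lambda>(t :: real, \<alpha>) v. (1 - t) * \<alpha> v + t * f \<alpha> v"
  have "continuous_on ({0..1} \<times> S) ?h"
    unfolding case_prod_beta
  proof (intro continuous_on_coordinatewise_then_product continuous_intros)
    fix v
    have "continuous_on ({0..1::real} \<times> S) snd" by (intro continuous_intros)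
    then show "continuous_on ({0..1::real} \<times> S) (\<lambda>x. snd x v)"
      by (rule continuous_on_product_then_coordinatewise)
    have "continuous_on ({0..1::real} \<times> S) (f \<circ> snd)"
      by (intro continuous_on_compose continuous_intros continuous_on_subset[OF f]) auto
    then show "continuous_on ({0..1::real} \<times> S) (\<lambda>x. f (snd x) v)"
      unfolding o_def by (rule continuous_on_product_then_coordinatewise)
  qed
  moreover have "?h \<in> {0..1} \<times> S \<rightarrow> S" using seg by auto
  ultimately show ?thesis
    unfolding homotopic_with_def by (intro exI[of _ ?h]) auto
qed

lemma contractible_geo_Pow:
  assumes F: "finite F" "e \<in> F"
  shows "contractible (geo (Pow F))"
proof (rule contractible_deformation)
  let ?b = "\<lambda>v. if v = e then 1 else 0 :: real"
  show "homotopic_with_canon (\<lambda>_. True) (geo (Pow F)) (geo (Pow F)) id (\<lambda>_. ?b)"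
  proof (rule homotopic_segment)
    fix \<alpha> and t :: real assume a: "\<alpha> \<in> geo (Pow F)" and t: "0 \<le> t" "t \<le> 1"
    let ?c = "\<lambda>v. (1 - t) * \<alpha> v + t * ?b v"
    have supp: "{v. \<alpha> v \<noteq> 0} \<subseteq> F" using geo_support[OF a] by blast
    show "?c \<in> geo (Pow F)"
    proof (rule geoI[OF F(1)])
      show "0 \<le> ?c v" for v using geo_nonneg[OF a, of v] t by simp
      show "?c v = 0" if "v \<notin> F" for v using supp that F(2) by auto
      then show "{v. ?c v \<noteq> 0} \<in> Pow F" by blast
      have "sum ?c F = (1 - t) * sum \<alpha> F + t * sum ?b F"
        by (simp only: sum.distrib sum_distrib_left)
      then show "sum ?c F = 1" using geo_sum[OF a F(1) supp] F by simp
    qed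
  qed simp
  show "(\<lambda>_. ?b) ` geo (Pow F) \<subseteq> {?b}" by blast
  have "?b \<in> geo (Pow F)" by (rule geoI[OF F(1)]) (use F in auto)
  then show "{?b} \<subseteq> geo (Pow F)" by blast
  show "contractible {?b}"
    by (rule iffD1[OF contractible_space_top_of_set contractible_space_subtopology_singleton])
qed

section \<open>Minima of barycentric coordinates over a face\<close>

context partitioned_complex
begin

text \<open>On a realization, and for finite nonempty \<open>N\<close>, this is a continuous
  function that is positive exactly where the support contains \<open>N\<close>.\<close>

definition weight :: "'v set \<Rightarrow> ('v \<Rightarrow> real) \<Rightarrow> real" where
  "weight N \<alpha> = Min (\<alpha> ` N)"

lemma continuous_on_weight [continuous_intros]:
  "finite N \<Longrightarrow> N \<noteq> {} \<Longrightarrow> continuous_on S (weight N)"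
  unfolding weight_def by (intro continuous_intros)

lemma weight_le: "finite N \<Longrightarrow> v \<in> N \<Longrightarrow> weight N \<alpha> \<le> \<alpha> v"
  unfolding weight_def by simp

lemma weight_attained: "finite N \<Longrightarrow> N \<noteq> {} \<Longrightarrow> \<exists>v\<in>N. weight N \<alpha> = \<alpha> v"
proof -
  assume "finite N" "N \<noteq> {}"
  then have "Min (\<alpha> ` N) \<in> \<alpha> ` N" by (intro Min_in) auto
  then show ?thesis unfolding weight_def by auto
qed

lemma weight_nonneg: "\<alpha> \<in> geo L \<Longrightarrow> finite N \<Longrightarrow> N \<noteq> {} \<Longrightarrow> 0 \<le> weight N \<alpha>"
  using weight_attained geo_nonneg by metis

lemma weight_eq_0_iff:
  assumes "\<alpha> \<in> geo L" "finite N" "N \<noteq> {}"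
  shows "weight N \<alpha> = 0 \<longleftrightarrow> \<not> N \<subseteq> {v. \<alpha> v \<noteq> 0}"
proof
  assume "weight N \<alpha> = 0"
  then show "\<not> N \<subseteq> {v. \<alpha> v \<noteq> 0}" using weight_attained[OF assms(2,3), of \<alpha>] by auto
next
  assume "\<not> N \<subseteq> {v. \<alpha> v \<noteq> 0}"
  then obtain v where v: "v \<in> N" "\<alpha> v = 0" by blast
  then show "weight N \<alpha> = 0"
    using weight_nonneg[OF assms] weight_le[OF assms(2) v(1), of \<alpha>] by simp
qed

subsection \<open>Contractibility of the acyclic part\<close>

definition level :: "nat \<Rightarrow> 'v set set" where
  "level k = {\<sigma> \<in> cone_part. card (\<sigma> \<inter> P) \<le> k}"

text \<open>On level \<open>k\<close>, at most one \<open>N\<close> in the sum lies in the support of \<open>\<alpha>\<close>. The largest common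
  amount is moved from the arcs of \<open>N\<close> to the arcs of \<open>T N - N\<close>, which leaves the other points of
  the level fixed.\<close>

definition collapse :: "nat \<Rightarrow> ('v \<Rightarrow> real) \<Rightarrow> 'v \<Rightarrow> real" where
  "collapse k \<alpha> v = \<alpha> v + (\<Sum>N | N \<in> cone_part \<and> N \<subseteq> P \<and> card N = k.
     weight N \<alpha> * (if v \<in> N then - 1 else if v \<in> T N then k / card (T N - N) else 0))"

text \<open>If the label of the support has \<open>Suc k\<close> elements, it is the only set of
  nonzero weight in the sum; otherwise \<alpha> does not move. The segment stays in the simplex
  \<open>T N\<close>, and at its end a vertex of \<open>N\<close> where the minimum was attained has
  coordinate 0, so the label has shrunk.\<close>

lemma collapse_segment:
  assumes a: "\<alpha> \<in> geo (level (Suc k))" and t: "0 \<le> t" "t \<le> 1"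
  defines "\<gamma> \<equiv> \<lambda>v. (1 - t) * \<alpha> v + t * collapse (Suc k) \<alpha> v"
  shows "\<gamma> \<in> geo (level (Suc k))" "t = 1 \<Longrightarrow> \<gamma> \<in> geo (level k)"
proof -
  let ?s = "{v. \<alpha> v \<noteq> 0}"
  let ?N = "?s \<inter> P"
  let ?S = "{N. N \<in> cone_part \<and> N \<subseteq> P \<and> card N = Suc k}"
  have s: "?s \<in> cone_part" "card ?N \<le> Suc k" using geo_support[OF a] unfolding level_def by auto
  have finS: "finite ?S" using finite_K cone_part_face by (auto intro: finite_subset[of _ K])
  have fin: "finite ?s" "finite ?N" using s(1) cone_part_face finite_face by auto
  have finN: "finite N \<and> N \<noteq> {}" if "N \<in> ?S" for N
    using that finite_face[OF cone_part_face] by auto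
  have zero: "weight N \<alpha> = 0" if "N \<in> ?S" "N \<noteq> ?N" for N
  proof (rule ccontr)
    assume "weight N \<alpha> \<noteq> 0"
    then have "N \<subseteq> ?s" using weight_eq_0_iff[OF a, of N] finN[OF that(1)] by simp
    then have "N \<subseteq> ?N" using that(1) by blast
    moreover have "card ?N \<le> card N" using that(1) s(2) by simp
    ultimately show False using card_seteq[OF fin(2)] that(2) by blast
  qed
  have "\<gamma> \<in> geo (level (Suc k)) \<and> (t = 1 \<longrightarrow> \<gamma> \<in> geo (level k))"
  proof (cases "card ?N = Suc k")
    case False
    then have "weight N \<alpha> = 0" if "N \<in> ?S" for N using zero[OF that] that by blast
    then have "collapse (Suc k) \<alpha> v = \<alpha> v" for v
      unfolding collapse_def by (simp del: mult_minus_right mult_eq_0_iff add: sum.neutral)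
    then have "collapse (Suc k) \<alpha> = \<alpha>" by (rule ext)
    then have "\<gamma> = \<alpha>" unfolding \<gamma>_def by (intro ext) (simp add: algebra_simps)
    moreover have "\<alpha> \<in> geo (level k)"
      using a s False unfolding geo_def level_def by auto
    ultimately show ?thesis using a by blast
  next
    case True
    define \<mu> where "\<mu> = weight ?N \<alpha>"
    define X where "X = T ?N - ?N"
    have NS: "?N \<in> ?S" using True s(1) cone_part_subset by auto
    have NK: "?N \<in> K" "?N \<subseteq> P" using NS cone_part_face by auto
    have TK: "T ?N \<in> K" "finite (T ?N)" using T_face[OF NK] finite_face by auto
    have X: "finite X" "X \<noteq> {}" "?N \<inter> X = {}" "T ?N = ?N \<union> X" "X \<inter> P = {}"
      using TK T_proper[OF s(1)] T_supset[OF NK] T_Int[OF NK] unfolding X_def by auto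
    have mu: "0 \<le> \<mu>" "\<And>v. v \<in> ?N \<Longrightarrow> \<mu> \<le> \<alpha> v"
      using weight_nonneg[OF a] weight_le fin(2) finN[OF NS] unfolding \<mu>_def by auto
    have sT: "?s \<subseteq> T ?N" using subset_T s(1) cone_part_face by blast
    have coll: "collapse (Suc k) \<alpha> v = \<alpha> v + \<mu> * (if v \<in> ?N then - 1 else if v \<in> X then Suc k / card X else 0)" for v
    proof -
      have "(\<Sum>N\<in>?S. weight N \<alpha> * (if v \<in> N then - 1 else if v \<in> T N then Suc k / card (T N - N) else 0))
        = weight ?N \<alpha> * (if v \<in> ?N then - 1 else if v \<in> T ?N then Suc k / card (T ?N - ?N) else 0)"
        unfolding sum.remove[OF finS NS] using zero by (simp add: sum.neutral)
      then show ?thesis unfolding collapse_def \<mu>_def X_def by (simp only: Diff_iff) auto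
    qed
    have g: "\<gamma> v = \<alpha> v + t * \<mu> * (if v \<in> ?N then - 1 else if v \<in> X then Suc k / card X else 0)" for v
      unfolding \<gamma>_def coll by (simp add: algebra_simps)
    have tmu: "t * \<mu> \<le> \<mu>" "0 \<le> t * \<mu>" using t mu(1) by (auto intro: mult_left_le_one_le)
    have nonneg: "0 \<le> \<gamma> v" for v
      using geo_nonneg[OF a, of v] mu(2)[of v] tmu t(1) mu(1) X(3) unfolding g by auto
    have out: "\<gamma> v = 0" if "v \<notin> T ?N" for v using that sT X(4) unfolding g by auto
    have "sum \<gamma> (T ?N) = sum \<alpha> (T ?N) + t * \<mu> * (\<Sum>v\<in>T ?N. if v \<in> ?N then - 1 else if v \<in> X then Suc k / card X else 0)"
      unfolding g sum.distrib sum_distrib_left ..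
    also have "(\<Sum>v\<in>T ?N. if v \<in> ?N then - 1 else if v \<in> X then Suc k / card X else 0 :: real)
      = (\<Sum>v\<in>?N. - 1) + (\<Sum>v\<in>X. Suc k / card X)"
      unfolding X(4) by (subst sum.union_disjoint[OF fin(2) X(1,3)])
        (intro arg_cong2[of _ _ _ _ "(+)"] sum.cong; use X(3) in auto)
    \<comment> \<open>\<open>Suc k\<close> vertices lose one unit each and \<open>card X\<close>
      vertices gain \<open>Suc k / card X\<close> each, so the total mass is preserved.\<close>
    also have "\<dots> = 0" using True X(1,2) by (simp add: card_gt_0_iff)
    finally have sum1: "sum \<gamma> (T ?N) = 1" using geo_sum[OF a TK(2) sT] by simp
    have supp: "{v. \<gamma> v \<noteq> 0} \<subseteq> T ?N" using out by blast
    have "T ?N \<in> cone_part" using TK(1) X(2,4,5) unfolding cone_part_def critical_def by blast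
    then have cone: "{v. \<gamma> v \<noteq> 0} \<in> cone_part" using supp cone_part_subset by blast
    have sub: "{v. \<gamma> v \<noteq> 0} \<inter> P \<subseteq> ?N" using supp X(4,5) by blast
    have "card ({v. \<gamma> v \<noteq> 0} \<inter> P) \<le> Suc k" using card_mono[OF fin(2) sub] True by simp
    then have 1: "\<gamma> \<in> geo (level (Suc k))"
      using cone by (intro geoI[OF TK(2) nonneg out sum1]) (auto simp: level_def)
    have 2: "\<gamma> \<in> geo (level k)" if "t = 1"
    proof -
      obtain v where v: "v \<in> ?N" "\<mu> = \<alpha> v"
        using weight_attained[OF fin(2), of \<alpha>] finN[OF NS] unfolding \<mu>_def by blast
      then have "\<gamma> v = 0" using that unfolding g by simp
      then have "{v. \<gamma> v \<noteq> 0} \<inter> P \<subset> ?N" using sub v(1) by blast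
      from psubset_card_mono[OF fin(2) this] have "card ({v. \<gamma> v \<noteq> 0} \<inter> P) \<le> k"
        unfolding True by simp
      then show ?thesis using cone by (intro geoI[OF TK(2) nonneg out sum1]) (auto simp: level_def)
    qed
    show ?thesis using 1 2 by blast
  qed
  then show "\<gamma> \<in> geo (level (Suc k))" "t = 1 \<Longrightarrow> \<gamma> \<in> geo (level k)" by auto
qed

lemma continuous_on_collapse: "continuous_on S (collapse (Suc k))"
proof (intro continuous_on_coordinatewise_then_product)
  fix v
  have "finite N" if "card N = Suc k" for N :: "'v set"
    using that card.infinite[of N] by fastforce
  then show "continuous_on S (\<lambda>\<alpha>. collapse (Suc k) \<alpha> v)"
    unfolding collapse_def by (intro continuous_intros) auto
qed

lemma contractible_level:
  assumes "0 < m"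
  shows "contractible (geo (level k))"
proof (induction k)
  case 0
  have N: "{} \<in> K" "{} \<subseteq> P" using empty_face by auto
  \<comment> \<open>The assumption \<open>0 < m\<close> makes \<open>T {}\<close> nonempty; its full
    simplex is level 0.\<close>
  have T: "finite (T {})" "T {} \<noteq> {}" "T {} \<inter> P = {}" "T {} \<in> K"
    using card_T[OF N] T_Int[OF N] T_face[OF N] finite_face assms by auto
  have "level 0 = Pow (T {})"
  proof (intro equalityI subsetI)
    fix \<sigma> assume "\<sigma> \<in> level 0"
    then have "\<sigma> \<in> K" "\<sigma> \<inter> P = {}"
      using finite_face[of \<sigma>] cone_part_face[of \<sigma>] unfolding level_def by auto
    then show "\<sigma> \<in> Pow (T {})" using subset_T[of \<sigma>] by simp
  next
    fix \<sigma> assume s: "\<sigma> \<in> Pow (T {})"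
    have "T {} \<in> cone_part" using T unfolding cone_part_def critical_def by blast
    then have "\<sigma> \<in> cone_part" using s cone_part_subset by blast
    moreover have "\<sigma> \<inter> P = {}" using s T(3) by blast
    ultimately show "\<sigma> \<in> level 0" unfolding level_def by simp
  qed
  then show ?case using contractible_geo_Pow T by fastforce
next
  case (Suc k)
  show ?case
  proof (rule contractible_deformation[OF _ _ _ Suc.IH])
    show "homotopic_with_canon (\<lambda>_. True) (geo (level (Suc k))) (geo (level (Suc k))) id (collapse (Suc k))"
      by (rule homotopic_segment[OF continuous_on_collapse]) (rule collapse_segment(1))
    show "collapse (Suc k) ` geo (level (Suc k)) \<subseteq> geo (level k)"
      using collapse_segment(2)[of _ k 1] by auto
    show "geo (level k) \<subseteq> geo (level (Suc k))" by (rule geo_mono) (auto simp: level_def)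
  qed
qed

lemma contractible_cone_part: "0 < m \<Longrightarrow> contractible (geo cone_part)"
proof -
  have "card (\<sigma> \<inter> P) \<le> m" if "\<sigma> \<in> cone_part" for \<sigma>
    using card_face[OF Int_face[OF cone_part_face[OF that]]] .
  then have "level m = cone_part" unfolding level_def by blast
  then show "0 < m \<Longrightarrow> contractible (geo cone_part)" using contractible_level by metis
qed

end

context partitioned_complex
begin

subsection \<open>Collapsing the acyclic part inside the complex\<close>

lemma finite_critical: "finite critical"
  using finite_K unfolding critical_def by simp

lemma critical_finite_nonempty:
  assumes "0 < m" "N \<in> critical"
  shows "finite N" "N \<noteq> {}"
  using assms finite_face unfolding critical_def by auto

lemma cone_part_subset_K: "cone_part \<subseteq> K"
  unfolding cone_part_def by blast

lemma geo_cone_part_iff: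
  assumes "\<alpha> \<in> geo K"
  shows "\<alpha> \<in> geo cone_part \<longleftrightarrow> {v. \<alpha> v \<noteq> 0} \<notin> critical"
  using assms unfolding geo_def cone_part_def by blast

lemma weight_critical_0:
  assumes m: "0 < m" and a: "\<alpha> \<in> geo K" and N: "N \<in> critical" "{v. \<alpha> v \<noteq> 0} \<noteq> N"
  shows "weight N \<alpha> = 0"
proof (rule ccontr)
  assume "weight N \<alpha> \<noteq> 0"
  then have "N \<subseteq> {v. \<alpha> v \<noteq> 0}" using weight_eq_0_iff[OF a critical_finite_nonempty[OF m N(1)]] by simp
  moreover have "card {v. \<alpha> v \<noteq> 0} \<le> card N"
    using card_face[OF geo_support[OF a]] N(1) unfolding critical_def by simp
  ultimately show False using card_seteq[OF finite_face[OF geo_support[OF a]]] N(2) by blast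
qed

lemma weight_critical_pos:
  assumes m: "0 < m" and a: "\<alpha> \<in> geo K" and N: "N \<in> critical" "{v. \<alpha> v \<noteq> 0} = N"
  shows "0 < weight N \<alpha>" "weight N \<alpha> \<le> 1 / m" "sum \<alpha> N = 1"
proof -
  note fin = critical_finite_nonempty[OF m N(1)]
  show "0 < weight N \<alpha>"
    using weight_eq_0_iff[OF a fin] weight_nonneg[OF a fin] N(2) by (simp add: less_le)
  show sum: "sum \<alpha> N = 1" using geo_sum[OF a fin(1)] N(2) by blast
  have "(\<Sum>v\<in>N. weight N \<alpha>) \<le> sum \<alpha> N" by (intro sum_mono weight_le fin(1))
  then show "weight N \<alpha> \<le> 1 / m"
    using sum m N(1) unfolding critical_def by (simp add: field_simps)
qed

text \<open>\<open>push\<close> moves a critical facet radially away from its barycenter. At time 1, the points of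
  total weight at most \<open>1 / (2 * m)\<close> have reached the boundary and the barycenter is still fixed, so
  that a contraction of the acyclic part can be attached along the outer half.\<close>

definition total_weight :: "('v \<Rightarrow> real) \<Rightarrow> real" where
  "total_weight \<alpha> = (\<Sum>N\<in>critical. weight N \<alpha>)"

text \<open>The barycenter of a critical facet has weight \<open>1 / m\<close>, so the slack
  vanishes there and on the boundary, and both stay fixed. Up to weight \<open>1 / (2 * m)\<close>
  it equals the weight, so subtracting it brings the smallest coordinate to 0.\<close>

definition slack :: "'v set \<Rightarrow> ('v \<Rightarrow> real) \<Rightarrow> real" where
  "slack N \<alpha> = min (weight N \<alpha>) (1 / m - weight N \<alpha>)"

definition push :: "real \<Rightarrow> ('v \<Rightarrow> real) \<Rightarrow> 'v \<Rightarrow> real" where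
  "push t \<alpha> v = (\<alpha> v - t * (\<Sum>N\<in>critical. if v \<in> N then slack N \<alpha> else 0)) /
    (1 - t * m * (\<Sum>N\<in>critical. slack N \<alpha>))"

lemma cone_part_weights:
  assumes m: "0 < m" and a: "\<alpha> \<in> geo cone_part"
  shows "total_weight \<alpha> = 0" "push t \<alpha> = \<alpha>"
proof -
  have aK: "\<alpha> \<in> geo K" using a geo_mono[OF cone_part_subset_K] by blast
  have w: "weight N \<alpha> = 0" if "N \<in> critical" for N
    using weight_critical_0[OF m aK that] geo_support[OF a] that unfolding cone_part_def by blast
  then show "total_weight \<alpha> = 0" unfolding total_weight_def by simp
  have d: "slack N \<alpha> = 0" if "N \<in> critical" for N using w[OF that] unfolding slack_def by simp
  have "(\<Sum>N\<in>critical. if v \<in> N then slack N \<alpha> else 0) = 0" for v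
    by (intro sum.neutral) (simp add: d)
  moreover have "(\<Sum>N\<in>critical. slack N \<alpha>) = 0" by (simp add: d)
  ultimately show "push t \<alpha> = \<alpha>" unfolding push_def by (intro ext) simp
qed

text \<open>A support of maximal size contains no second critical facet, so the sums over
  \<open>critical\<close> reduce to one term.\<close>

lemma critical_weights:
  assumes m: "0 < m" and a: "\<alpha> \<in> geo K" and N: "N \<in> critical" "{v. \<alpha> v \<noteq> 0} = N"
  shows "total_weight \<alpha> = weight N \<alpha>"
    "push t \<alpha> v = (if v \<in> N then (\<alpha> v - t * slack N \<alpha>) / (1 - t * m * slack N \<alpha>) else 0)"
    "(\<Sum>M\<in>critical. slack M \<alpha>) = slack N \<alpha>"
proof -
  have w: "weight M \<alpha> = 0" if "M \<in> critical" "M \<noteq> N" for M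
    using weight_critical_0[OF m a that(1)] N(2) that(2) by blast
  show "total_weight \<alpha> = weight N \<alpha>"
    unfolding total_weight_def sum.remove[OF finite_critical N(1)] using w by (simp add: sum.neutral)
  have d: "slack M \<alpha> = 0" if "M \<in> critical" "M \<noteq> N" for M using w[OF that] unfolding slack_def by simp
  show D: "(\<Sum>M\<in>critical. slack M \<alpha>) = slack N \<alpha>"
    unfolding sum.remove[OF finite_critical N(1)] using d by (simp add: sum.neutral)
  have "(\<Sum>M\<in>critical. if v \<in> M then slack M \<alpha> else 0) = (if v \<in> N then slack N \<alpha> else 0)"
    unfolding sum.remove[OF finite_critical N(1)] using d by (simp add: sum.neutral)
  then show "push t \<alpha> v = (if v \<in> N then (\<alpha> v - t * slack N \<alpha>) / (1 - t * m * slack N \<alpha>) else 0)"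
    unfolding push_def D using N(2) by auto
qed

text \<open>The slack is at most each of two numbers with sum \<open>1 / m\<close>, hence at most
  half of it. This keeps the denominator of \<open>push\<close>, the mass left after
  \<open>m\<close> coordinates lose \<open>t * slack\<close> each, positive.\<close>

lemma slack_bounds:
  assumes m: "0 < m" and a: "\<alpha> \<in> geo K" and N: "N \<in> critical" "{v. \<alpha> v \<noteq> 0} = N"
  shows "0 \<le> slack N \<alpha>" "slack N \<alpha> \<le> weight N \<alpha>" "m * slack N \<alpha> \<le> 1 / 2"
proof -
  note w = weight_critical_pos[OF m a N]
  show "0 \<le> slack N \<alpha>" "slack N \<alpha> \<le> weight N \<alpha>" using w(1,2) unfolding slack_def by auto
  have "slack N \<alpha> \<le> weight N \<alpha>" "slack N \<alpha> \<le> 1 / m - weight N \<alpha>" unfolding slack_def by simp_all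
  then have "2 * slack N \<alpha> \<le> 1 / m" by linarith
  then show "m * slack N \<alpha> \<le> 1 / 2" using m by (simp add: field_simps)
qed

lemma push_denominator:
  assumes m: "0 < m" and a: "\<alpha> \<in> geo K" and t: "0 \<le> t" "t \<le> 1"
  shows "1 - t * real m * (\<Sum>N\<in>critical. slack N \<alpha>) > 0"
proof (cases "{v. \<alpha> v \<noteq> 0} \<in> critical")
  case True
  note d = slack_bounds[OF m a True refl]
  have "t * (m * slack {v. \<alpha> v \<noteq> 0} \<alpha>) \<le> 1 * (1 / 2)"
    using t d by (intro mult_mono) auto
  then show ?thesis unfolding critical_weights(3)[OF m a True refl] by simp
next
  case False
  then have "weight N \<alpha> = 0" if "N \<in> critical" for N using weight_critical_0[OF m a that] that by blast
  then have "slack N \<alpha> = 0" if "N \<in> critical" for N using that unfolding slack_def by simp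
  then show ?thesis by simp
qed

lemma push_geo:
  assumes m: "0 < m" and a: "\<alpha> \<in> geo K" and t: "0 \<le> t" "t \<le> 1"
  shows "push t \<alpha> \<in> geo K" "t = 1 \<Longrightarrow> total_weight \<alpha> \<le> 1 / (2 * m) \<Longrightarrow> push t \<alpha> \<in> geo cone_part"
proof -
  have "push t \<alpha> \<in> geo K \<and> (t = 1 \<and> total_weight \<alpha> \<le> 1 / (2 * m) \<longrightarrow> push t \<alpha> \<in> geo cone_part)"
  proof (cases "{v. \<alpha> v \<noteq> 0} \<in> critical")
    case False
    then have "\<alpha> \<in> geo cone_part" using geo_cone_part_iff[OF a] by simp
    then show ?thesis using cone_part_weights(2)[OF m] a by simp
  next
    case True
    define N where "N = {v. \<alpha> v \<noteq> 0}"
    have N: "N \<in> critical" "{v. \<alpha> v \<noteq> 0} = N" using True unfolding N_def by auto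
    note fin = critical_finite_nonempty[OF m N(1)]
    define \<delta> where "\<delta> = slack N \<alpha>"
    define D where "D = 1 - t * m * \<delta>"
    have D: "D > 0" using push_denominator[OF m a t] unfolding critical_weights(3)[OF m a N] D_def \<delta>_def .
    have p: "push t \<alpha> v = (if v \<in> N then (\<alpha> v - t * \<delta>) / D else 0)" for v
      unfolding critical_weights(2)[OF m a N] D_def \<delta>_def ..
    have \<delta>: "0 \<le> \<delta>" "\<delta> \<le> weight N \<alpha>" using slack_bounds[OF m a N] unfolding \<delta>_def by auto
    have "t * \<delta> \<le> \<alpha> v" if "v \<in> N" for v
    proof -
      have "t * \<delta> \<le> 1 * \<delta>" using t \<delta> by (intro mult_right_mono) auto
      then show ?thesis using \<delta>(2) weight_le[OF fin(1) that, of \<alpha>] by simp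
    qed
    then have nonneg: "0 \<le> push t \<alpha> v" for v unfolding p using D by auto
    have out: "push t \<alpha> v = 0" if "v \<notin> N" for v using that unfolding p by simp
    have NK: "N \<in> K" "card N = m" using N(1) unfolding critical_def by auto
    have "sum (push t \<alpha>) N = (\<Sum>v\<in>N. \<alpha> v - t * \<delta>) / D"
      unfolding p sum_divide_distrib by (intro sum.cong) auto
    also have "(\<Sum>v\<in>N. \<alpha> v - t * \<delta>) = D"
      using weight_critical_pos(3)[OF m a N] NK(2) by (simp add: sum_subtractf D_def)
    finally have sum1: "sum (push t \<alpha>) N = 1" using D by simp
    have supp: "{v. push t \<alpha> v \<noteq> 0} \<subseteq> N" using out by blast
    have 1: "push t \<alpha> \<in> geo K"
      using face_subset[OF NK(1) supp] by (intro geoI[OF fin(1) nonneg out sum1])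
    have 2: "push t \<alpha> \<in> geo cone_part" if "t = 1" "total_weight \<alpha> \<le> 1 / (2 * m)"
    proof -
      have "2 * weight N \<alpha> \<le> 1 / m"
        using that(2) m unfolding critical_weights(1)[OF m a N] by (simp add: field_simps)
      then have "\<delta> = weight N \<alpha>" unfolding \<delta>_def slack_def by simp
      then obtain v where v: "v \<in> N" "\<alpha> v = \<delta>" using weight_attained[OF fin] by metis
      then have "push t \<alpha> v = 0" unfolding p using that(1) by simp
      then have "{v. push t \<alpha> v \<noteq> 0} \<subset> N" using supp v(1) by blast
      from psubset_card_mono[OF fin(1) this] have "{v. push t \<alpha> v \<noteq> 0} \<notin> critical"
        using NK(2) unfolding critical_def by auto
      then show ?thesis using geo_cone_part_iff[OF 1] by simp
    qed
    show ?thesis using 1 2 by blast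
  qed
  then show "push t \<alpha> \<in> geo K" "t = 1 \<Longrightarrow> total_weight \<alpha> \<le> 1 / (2 * m) \<Longrightarrow> push t \<alpha> \<in> geo cone_part"
    by auto
qed

lemma continuous_on_weight_critical:
  "0 < m \<Longrightarrow> N \<in> critical \<Longrightarrow> continuous_on S (weight N)"
  using critical_finite_nonempty by (intro continuous_on_weight)

lemma continuous_on_total_weight: "0 < m \<Longrightarrow> continuous_on S total_weight"
  unfolding total_weight_def by (intro continuous_on_sum continuous_on_weight_critical)

lemma continuous_on_slack: "0 < m \<Longrightarrow> N \<in> critical \<Longrightarrow> continuous_on S (slack N)"
  unfolding slack_def by (intro continuous_intros continuous_on_weight_critical)

lemma continuous_on_push:
  assumes m: "0 < m"
  shows "continuous_on ({0..1} \<times> geo K) (\<lambda>(t, \<alpha>). push t \<alpha>)"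
  unfolding case_prod_beta
proof (rule continuous_on_coordinatewise_then_product)
  fix v
  let ?S = "{0..1::real} \<times> geo K"
  have snd: "continuous_on ?S (\<lambda>x. f (snd x))" if "\<And>S. continuous_on S f" for f :: "('v \<Rightarrow> real) \<Rightarrow> real"
    using continuous_on_compose[OF continuous_on_snd[OF continuous_on_id] that, of ?S] by (simp add: o_def)
  have d: "continuous_on ?S (\<lambda>x. slack N (snd x))" if "N \<in> critical" for N
    by (rule snd) (rule continuous_on_slack[OF m that])
  have c: "continuous_on ?S (\<lambda>x. snd x v)" by (rule snd) (rule continuous_on_coord)
  have "continuous_on ?S (\<lambda>x. if v \<in> N then slack N (snd x) else 0)" if "N \<in> critical" for N
    using d[OF that] by (cases "v \<in> N") auto
  moreover have "1 - fst x * real m * (\<Sum>N\<in>critical. slack N (snd x)) \<noteq> 0" if "x \<in> ?S" for x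
    using push_denominator[OF m, of "snd x" "fst x"] that by auto
  ultimately show "continuous_on ?S (\<lambda>x. push (fst x) (snd x) v)"
    unfolding push_def using c d by (intro continuous_intros) auto
qed

text \<open>This carries out homotopy extension by hand. \<open>push\<close> opens a collar around
  the acyclic part, and a contraction \<open>h\<close> of that part is run on the collar for a time
  that fades to 0 at the outer edge. All stages preserve the acyclic part, and the end map is
  constant on it.\<close>

lemma homotopy_equivalent_cone_part_quotient:
  assumes m: "0 < m" and q: "quotient_map (top_of_set (geo K)) Y q"
    and q_eq: "\<And>\<alpha> \<beta>. \<alpha> \<in> geo K \<Longrightarrow> \<beta> \<in> geo K \<Longrightarrow>
      q \<alpha> = q \<beta> \<longleftrightarrow> \<alpha> = \<beta> \<or> \<alpha> \<in> geo cone_part \<and> \<beta> \<in> geo cone_part"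
  shows "top_of_set (geo K) homotopy_equivalent_space Y"
proof -
  let ?X = "top_of_set (geo K)"
  let ?A = "geo cone_part"
  have AK: "?A \<subseteq> geo K" by (rule geo_mono[OF cone_part_subset_K])
  let ?P = "\<lambda>f. \<forall>x\<in>topspace ?X. \<forall>y\<in>topspace ?X. q x = q y \<longrightarrow> q (f x) = q (f y)"
  have P: "?P f" if "f ` geo K \<subseteq> geo K" "f ` ?A \<subseteq> ?A" for f
  proof (intro ballI impI)
    fix x y assume "x \<in> topspace ?X" "y \<in> topspace ?X" "q x = q y"
    then have "x = y \<or> x \<in> ?A \<and> y \<in> ?A" using q_eq by auto
    then show "q (f x) = q (f y)"
    proof
      assume xy: "x \<in> ?A \<and> y \<in> ?A"
      then have "f x \<in> ?A" "f y \<in> ?A" using that(2) by auto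
      moreover have "f x \<in> geo K" "f y \<in> geo K" using that(1) AK xy by auto
      ultimately show ?thesis using q_eq by blast
    qed simp
  qed
  obtain a where "homotopic_with_canon (\<lambda>_. True) ?A ?A id (\<lambda>_. a)"
    using contractible_cone_part[OF m] unfolding contractible_def by blast
  then obtain h where h: "continuous_on ({0..1} \<times> ?A) h" "h \<in> {0..1} \<times> ?A \<rightarrow> ?A"
    "\<And>x. h (0::real, x) = x" "\<And>x. h (1, x) = a"
    unfolding homotopic_with_def by auto
  \<comment> \<open>At total weight 0 and \<open>s = 1\<close> the contraction runs to its end. At
    total weight \<open>1 / (2 * m)\<close> its time is 0, where \<open>h\<close> is the identity,
    so the two branches agree.\<close>
  define E where "E = (\<lambda>(s, \<alpha>). if total_weight \<alpha> \<le> 1 / (2 * m)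
    then h (s * (1 - 2 * m * total_weight \<alpha>), push 1 \<alpha>) else push 1 \<alpha>)"
  have tw: "0 \<le> total_weight \<alpha>" if "\<alpha> \<in> geo K" for \<alpha>
    unfolding total_weight_def
    by (intro sum_nonneg weight_nonneg[OF that] critical_finite_nonempty[OF m])
  have arg: "(s * (1 - 2 * m * total_weight \<alpha>), push 1 \<alpha>) \<in> {0..1} \<times> ?A"
    if "s \<in> {0..1}" "\<alpha> \<in> geo K" "total_weight \<alpha> \<le> 1 / (2 * m)" for s \<alpha>
  proof -
    have "0 \<le> 1 - 2 * m * total_weight \<alpha>" using that(3) m by (simp add: field_simps)
    moreover have "1 - 2 * m * total_weight \<alpha> \<le> 1" using tw[OF that(2)] by simp
    ultimately have "s * (1 - 2 * m * total_weight \<alpha>) \<in> {0..1}"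
      using that(1) by (simp add: mult_le_one)
    then show ?thesis using push_geo(2)[OF m that(2)] that(3) by simp
  qed
  have contE: "continuous_on ({0..1} \<times> geo K) E"
    unfolding E_def case_prod_beta
  proof (rule continuous_on_cases_le)
    let ?S = "{0..1::real} \<times> geo K"
    have cp: "continuous_on ?S (\<lambda>x. push 1 (snd x))"
    proof -
      have "continuous_on ?S ((\<lambda>(t, \<alpha>). push t \<alpha>) \<circ> (\<lambda>x. (1, snd x)))"
        by (intro continuous_on_compose continuous_intros continuous_on_subset[OF continuous_on_push[OF m]]) auto
      then show ?thesis by (simp add: o_def)
    qed
    show ct: "continuous_on ?S (\<lambda>x. total_weight (snd x))"
      using continuous_on_compose[OF continuous_on_snd[OF continuous_on_id] continuous_on_total_weight[OF m], of ?S]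
      by (simp add: o_def)
    let ?S1 = "{x \<in> ?S. total_weight (snd x) \<le> 1 / (2 * m)}"
    have "continuous_on ?S1 (h \<circ> (\<lambda>x. (fst x * (1 - 2 * m * total_weight (snd x)), push 1 (snd x))))"
    proof (intro continuous_on_compose)
      show "continuous_on ?S1 (\<lambda>x. (fst x * (1 - 2 * m * total_weight (snd x)), push 1 (snd x)))"
        by (intro continuous_intros continuous_on_subset[OF ct] continuous_on_subset[OF cp]) auto
      show "continuous_on ((\<lambda>x. (fst x * (1 - 2 * m * total_weight (snd x)), push 1 (snd x))) ` ?S1) h"
        by (rule continuous_on_subset[OF h(1)]) (use arg in auto)
    qed
    then show "continuous_on ?S1 (\<lambda>x. h (fst x * (1 - 2 * m * total_weight (snd x)), push 1 (snd x)))"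
      by (simp add: o_def)
    show "continuous_on {x \<in> ?S. 1 / (2 * m) \<le> total_weight (snd x)} (\<lambda>x. push 1 (snd x))"
      by (rule continuous_on_subset[OF cp]) auto
    fix x :: "real \<times> ('v \<Rightarrow> real)" assume "total_weight (snd x) = 1 / (2 * m)"
    then have "1 - 2 * m * total_weight (snd x) = 0" using m by simp
    then show "h (fst x * (1 - 2 * m * total_weight (snd x)), push 1 (snd x)) = push 1 (snd x)"
      using h(3) by simp
  qed
  have E_K: "E (s, \<alpha>) \<in> geo K" if "s \<in> {0..1}" "\<alpha> \<in> geo K" for s \<alpha>
    using arg[OF that] h(2) AK push_geo(1)[OF m that(2), of 1] unfolding E_def by (auto simp: Pi_iff)
  have E_A: "E (s, \<alpha>) = h (s, \<alpha>)" if "\<alpha> \<in> ?A" for s \<alpha>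
    using cone_part_weights[OF m that] unfolding E_def by simp
  have "homotopic_with ?P ?X ?X id (push 1)"
    unfolding homotopic_with_def
  proof (intro exI[of _ "\<lambda>(t, \<alpha>). push t \<alpha>"] conjI)
    have "(\<lambda>(t, \<alpha>). push t \<alpha>) \<in> {0..1} \<times> geo K \<rightarrow> geo K" using push_geo(1)[OF m] by auto
    then show "continuous_map (prod_topology (top_of_set {0..1}) ?X) ?X (\<lambda>(t, \<alpha>). push t \<alpha>)"
      using continuous_on_push[OF m] by simp
    show "\<forall>x. (\<lambda>(t, \<alpha>). push t \<alpha>) (0, x) = id x" unfolding push_def by auto
    show "\<forall>t\<in>{0..1}. ?P (\<lambda>x. (\<lambda>(t, \<alpha>). push t \<alpha>) (t, x))"
    proof
      fix t :: real assume "t \<in> {0..1}"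
      then show "?P (\<lambda>x. (\<lambda>(t, \<alpha>). push t \<alpha>) (t, x))"
        using push_geo(1)[OF m] cone_part_weights(2)[OF m] by (intro P) auto
    qed
  qed simp
  moreover have "homotopic_with ?P ?X ?X (push 1) (\<lambda>\<alpha>. E (1, \<alpha>))"
    unfolding homotopic_with_def
  proof (intro exI[of _ E] conjI)
    have "E \<in> {0..1} \<times> geo K \<rightarrow> geo K" using E_K by auto
    then show "continuous_map (prod_topology (top_of_set {0..1}) ?X) ?X E"
      using contE by simp
    show "\<forall>x. E (0, x) = push 1 x" unfolding E_def using h(3) by simp
    show "\<forall>t\<in>{0..1}. ?P (\<lambda>x. E (t, x))"
    proof
      fix t :: real assume "t \<in> {0..1}"
      then show "?P (\<lambda>x. E (t, x))"
        using E_K E_A h(2) by (intro P) (auto simp: Pi_iff)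
    qed
  qed simp
  ultimately have hom: "homotopic_with ?P ?X ?X id (\<lambda>\<alpha>. E (1, \<alpha>))" by (rule homotopic_with_trans)
  show ?thesis
  proof (rule homotopy_equivalent_quotient[OF q hom])
    fix x y assume "x \<in> topspace ?X" "y \<in> topspace ?X" "q x = q y"
    then have "x = y \<or> x \<in> ?A \<and> y \<in> ?A" using q_eq by auto
    then show "E (1, x) = E (1, y)" using E_A h(4) by auto
  qed
qed

end

subsection \<open>Wedges of spheres\<close>

definition euclidean_sphere :: "nat \<Rightarrow> (nat \<Rightarrow> real) set" where
  "euclidean_sphere d = {x. (\<Sum>i\<le>d. x i ^ 2) = 1 \<and> (\<forall>i>d. x i = 0)}"

definition base_point :: "nat \<Rightarrow> real" where
  "base_point = (\<lambda>i. if i = 0 then 1 else 0)"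

lemma nsphere_euclidean_sphere: "nsphere d = top_of_set (euclidean_sphere d)"
  unfolding nsphere euclidean_sphere_def euclidean_product_topology ..

lemma sum_atMost_shift: "(\<Sum>i\<le>d. f i) = f 0 + (\<Sum>i=1..d. f i)" for f :: "nat \<Rightarrow> real"
proof -
  have "{..d} = insert 0 {1..d}" by auto
  then show ?thesis by simp
qed

lemma base_point_in_sphere: "base_point \<in> euclidean_sphere d"
  unfolding euclidean_sphere_def base_point_def sum_atMost_shift by auto

text \<open>The base point is the pole with coordinate 0 equal to 1; the sphere equation then forces
  all other coordinates to vanish.\<close>

lemma euclidean_sphere_base_iff:
  assumes "x \<in> euclidean_sphere d"
  shows "x 0 \<le> 1" "x = base_point \<longleftrightarrow> x 0 = 1"
proof -
  have x: "x 0 ^ 2 + (\<Sum>i=1..d. x i ^ 2) = 1" "\<And>i. d < i \<Longrightarrow> x i = 0"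
    using assms unfolding euclidean_sphere_def sum_atMost_shift by auto
  have nonneg: "0 \<le> (\<Sum>i=1..d. x i ^ 2)" by (intro sum_nonneg) simp
  then have "x 0 ^ 2 \<le> 1" using x(1) by linarith
  then show "x 0 \<le> 1" by (simp add: abs_square_le_1)
  show "x = base_point \<longleftrightarrow> x 0 = 1"
  proof
    assume "x 0 = 1"
    then have "(\<Sum>i=1..d. x i ^ 2) = 0" using x(1) by simp
    then have "x i = 0" if "i \<in> {1..d}" for i using that by (simp add: sum_nonneg_eq_0_iff)
    then have "x i = (if i = 0 then 1 else 0)" for i
      using x(2)[of i] \<open>x 0 = 1\<close> by (cases "i = 0"; cases "i \<le> d") auto
    then show "x = base_point" unfolding base_point_def by (rule ext)
  qed (simp add: base_point_def)
qed

section \<open>Quotient topologies and the points of a wedge\<close>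

lemma topspace_quotient_topology:
  assumes "equiv (topspace X) r"
  shows "topspace (quotient_topology X r) = topspace X // r"
proof
  show "topspace (quotient_topology X r) \<subseteq> topspace X // r"
    using openin_quotient_topology[OF assms] openin_topspace by blast
  have "openin (quotient_topology X r) (topspace X // r)"
    unfolding openin_quotient_topology[OF assms] Union_quotient[OF assms] by simp
  then show "topspace X // r \<subseteq> topspace (quotient_topology X r)" by (rule openin_subset)
qed

lemma quotient_map_quotient_topology:
  assumes r: "equiv (topspace X) r"
  shows "quotient_map X (quotient_topology X r) (\<lambda>x. r `` {x})"
  unfolding quotient_map_def topspace_quotient_topology[OF r]
proof (intro conjI allI impI)
  show "(\<lambda>x. r `` {x}) ` topspace X = topspace X // r" unfolding quotient_def by blast
  fix U assume U: "U \<subseteq> topspace X // r"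
  have "{x \<in> topspace X. r `` {x} \<in> U} = \<Union>U"
  proof (intro equalityI subsetI)
    fix x assume "x \<in> {x \<in> topspace X. r `` {x} \<in> U}"
    then show "x \<in> \<Union>U" using equiv_class_self[OF r] by blast
  next
    fix x assume "x \<in> \<Union>U"
    then obtain C where C: "C \<in> U" "x \<in> C" by blast
    then obtain y where y: "y \<in> topspace X" "C = r `` {y}" using U unfolding quotient_def by blast
    then have "(y, x) \<in> r" using C by blast
    then have "r `` {x} = C" using equiv_class_eq[OF r] y(2) by blast
    moreover have "x \<in> topspace X" using \<open>(y, x) \<in> r\<close> equiv_type[OF r] by blast
    ultimately show "x \<in> {x \<in> topspace X. r `` {x} \<in> U}" using C(1) by simp
  qed
  then show "openin X {x \<in> topspace X. r `` {x} \<in> U} = openin (quotient_topology X r) U"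
    unfolding openin_quotient_topology[OF r] using U by simp
qed

definition wedge_point :: "nat \<Rightarrow> nat \<Rightarrow> nat \<Rightarrow> (nat \<Rightarrow> real) \<Rightarrow> (nat \<times> (nat \<Rightarrow> real)) set" where
  "wedge_point M d i y = wedge_rel (\<lambda>_. nsphere d) (\<lambda>_. base_point) {..<M} `` {(i, y)}"

lemma quotient_map_wedge_point:
  "quotient_map (sum_topology (\<lambda>_. nsphere d) {..<M}) (wedge_of_spheres M (int d)) (\<lambda>(i, y). wedge_point M d i y)"
proof -
  have "wedge_of_spheres M (int d) = quotient_topology (sum_topology (\<lambda>_. nsphere d) {..<M})
      (wedge_rel (\<lambda>_. nsphere d) (\<lambda>_. base_point) {..<M})"
    unfolding wedge_of_spheres_def wedge_topology_def sphere_topology_def base_point_def by simp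
  then show ?thesis
    using quotient_map_quotient_topology[OF equiv_wedge_rel, of "\<lambda>_. nsphere d" "{..<M}" "\<lambda>_. base_point"]
    unfolding wedge_point_def by (simp add: case_prod_unfold)
qed

lemma wedge_point_eq_iff:
  assumes "i < M" "j < M" "y \<in> euclidean_sphere d" "z \<in> euclidean_sphere d"
  shows "wedge_point M d i y = wedge_point M d j z \<longleftrightarrow> i = j \<and> y = z \<or> y = base_point \<and> z = base_point"
proof -
  have "wedge_point M d i y = wedge_point M d j z \<longleftrightarrow>
      ((i, y), (j, z)) \<in> wedge_rel (\<lambda>_. nsphere d) (\<lambda>_. base_point) {..<M}"
    unfolding wedge_point_def
    by (rule eq_equiv_class_iff[OF equiv_wedge_rel]) (use assms in \<open>auto simp: nsphere_euclidean_sphere\<close>)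
  then show ?thesis
    unfolding wedge_rel_def using assms by (auto simp: nsphere_euclidean_sphere)
qed

lemma continuous_map_wedge_point:
  assumes "i < M"
  shows "continuous_map (nsphere d) (wedge_of_spheres M (int d)) (wedge_point M d i)"
  using continuous_map_compose[OF continuous_map_component_injection[of i "{..<M}" "\<lambda>_. nsphere d"]
      quotient_imp_continuous_map[OF quotient_map_wedge_point]] assms by (simp add: o_def)

lemma topspace_wedge_of_spheres:
  "topspace (wedge_of_spheres M (int d)) = {wedge_point M d i y | i y. i < M \<and> y \<in> euclidean_sphere d}"
  unfolding quotient_imp_surjective_map[OF quotient_map_wedge_point, symmetric]
  by (force simp: nsphere_euclidean_sphere)

lemma closedin_wedge_of_spheres:
  assumes C: "C \<subseteq> topspace (wedge_of_spheres M (int d))"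
    and closed: "\<And>i. i < M \<Longrightarrow> closed {y \<in> euclidean_sphere d. wedge_point M d i y \<in> C}"
  shows "closedin (wedge_of_spheres M (int d)) C"
proof -
  let ?S = "sum_topology (\<lambda>_. nsphere d) {..<M}"
  have "closedin ?S {p \<in> topspace ?S. (\<lambda>(i, y). wedge_point M d i y) p \<in> C}"
    unfolding closedin_sum_topology
  proof (intro conjI ballI)
    fix i assume "i \<in> {..<M}"
    then have "{y. (i, y) \<in> {p \<in> topspace ?S. (\<lambda>(i, y). wedge_point M d i y) p \<in> C}} =
        {y \<in> euclidean_sphere d. wedge_point M d i y \<in> C}"
      by (auto simp: nsphere_euclidean_sphere)
    then show "closedin (nsphere d) {y. (i, y) \<in> {p \<in> topspace ?S. (\<lambda>(i, y). wedge_point M d i y) p \<in> C}}"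
      unfolding nsphere_euclidean_sphere using closed \<open>i \<in> {..<M}\<close>
      by (auto intro!: closed_subset)
  qed auto
  then show ?thesis
    using quotient_map_wedge_point[of d M] C unfolding quotient_map_closedin by blast
qed

text \<open>Compactness will make the map onto the wedge closed. Finitely many simplices are cut out
  of a cube, compact by Tychonoff, by coordinate equations.\<close>

lemma compact_geo:
  assumes "finite K" "\<And>F. F \<in> K \<Longrightarrow> finite F" "\<And>F G. F \<in> K \<Longrightarrow> G \<subseteq> F \<Longrightarrow> G \<in> K"
  shows "compact (geo K)"
proof -
  let ?C = "{\<alpha> :: 'a \<Rightarrow> real. \<forall>v. \<alpha> v \<in> {0..1}}"
  have "compactin (product_topology (\<lambda>_. euclideanreal) UNIV) (PiE UNIV (\<lambda>_ :: 'a. {0..1}))"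
    by (simp add: compactin_PiE)
  moreover have "PiE UNIV (\<lambda>_. {0..1}) = ?C" by auto
  ultimately have C: "compact ?C" by (simp add: euclidean_product_topology)
  have "geo K = (\<Union>F\<in>K. ?C \<inter> ((\<Inter>v\<in>-F. {\<alpha>. \<alpha> v = 0}) \<inter> {\<alpha>. sum \<alpha> F = 1}))" (is "_ = (\<Union>F\<in>K. ?G F)")
  proof (intro equalityI subsetI)
    fix \<alpha> assume a: "\<alpha> \<in> geo K"
    let ?F = "{v. \<alpha> v \<noteq> 0}"
    have F: "?F \<in> K" "finite ?F" using geo_support[OF a] assms by auto
    have sum: "sum \<alpha> ?F = 1" using geo_sum[OF a F(2)] by simp
    have "\<alpha> v \<le> 1" for v
    proof (cases "v \<in> ?F")
      case True
      then show ?thesis using member_le_sum[of v ?F \<alpha>] F geo_nonneg[OF a] sum by simp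
    qed auto
    then have "\<alpha> \<in> ?G ?F" using sum geo_nonneg[OF a] by auto
    then show "\<alpha> \<in> (\<Union>F\<in>K. ?G F)" using F(1) by blast
  next
    fix \<alpha> assume "\<alpha> \<in> (\<Union>F\<in>K. ?G F)"
    then obtain F where F: "F \<in> K" "\<And>v. 0 \<le> \<alpha> v" "\<And>v. v \<notin> F \<Longrightarrow> \<alpha> v = 0" "sum \<alpha> F = 1" by auto
    have "{v. \<alpha> v \<noteq> 0} \<subseteq> F" using F(3) by blast
    then show "\<alpha> \<in> geo K" using geoI[OF assms(2)[OF F(1)] F(2-4)] assms(3)[OF F(1)] by blast
  qed
  moreover have "compact (?G F)" for F
  proof (intro compact_Int_closed[OF C] closed_Int closed_INT ballI)
    show "closed {\<alpha> :: 'a \<Rightarrow> real. \<alpha> v = 0}" for v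
      by (intro closed_Collect_eq continuous_intros)
    show "closed {\<alpha> :: 'a \<Rightarrow> real. sum \<alpha> F = 1}"
      by (intro closed_Collect_eq continuous_intros)
  qed
  ultimately show ?thesis by (simp only: compact_UN[OF assms(1)])
qed

context partitioned_complex
begin

subsection \<open>Spherical charts of the critical facets\<close>

definition excess :: "'v set \<Rightarrow> (nat \<Rightarrow> 'v) \<Rightarrow> nat \<Rightarrow> ('v \<Rightarrow> real) \<Rightarrow> real" where
  "excess N e d \<alpha> = (\<Sum>i=1..d. (\<alpha> (e i) - \<alpha> (e 0)) ^ 2) + sum \<alpha> (\<Union>K - N)"

text \<open>Inverse stereographic projection of the differences \<open>\<alpha> (e i) - \<alpha> (e 0)\<close> divided by the
  weight, with denominators cleared. The mass outside \<open>N\<close> is added to the squared norm in order to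
  keep the denominator positive off \<open>N\<close>, where the weight vanishes.\<close>

definition chart :: "'v set \<Rightarrow> (nat \<Rightarrow> 'v) \<Rightarrow> nat \<Rightarrow> ('v \<Rightarrow> real) \<Rightarrow> nat \<Rightarrow> real" where
  "chart N e d \<alpha> i = (if i = 0 then (excess N e d \<alpha> - weight N \<alpha> ^ 2) / (excess N e d \<alpha> + weight N \<alpha> ^ 2)
     else if i \<le> d then 2 * weight N \<alpha> * (\<alpha> (e i) - \<alpha> (e 0)) / (excess N e d \<alpha> + weight N \<alpha> ^ 2) else 0)"

context
  fixes N :: "'v set" and e :: "nat \<Rightarrow> 'v" and d :: nat
  assumes m: "m = Suc d" and N: "N \<in> critical" and e: "bij_betw e {..d} N"
begin

lemma m_pos: "0 < m" using m by simp

lemma NK: "N \<in> K" "card N = m" using N unfolding critical_def by auto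

lemma N_finite: "finite N" "N \<noteq> {}" using critical_finite_nonempty[OF m_pos N] by auto

lemma e_in: "i \<le> d \<Longrightarrow> e i \<in> N" using bij_betwE[OF e] by simp

lemma e_surj: "v \<in> N \<Longrightarrow> \<exists>i\<le>d. v = e i"
  unfolding bij_betw_imp_surj_on[OF e, symmetric] by (simp add: image_iff Bex_def)

lemma sum_e: "sum f N = (\<Sum>i\<le>d. f (e i))"
  by (rule sum.reindex_bij_betw[OF e, symmetric])

lemma geo_sum_split:
  assumes "\<alpha> \<in> geo K"
  shows "sum \<alpha> N + sum \<alpha> (\<Union>K - N) = 1" "0 \<le> sum \<alpha> (\<Union>K - N)"
proof -
  have "N \<subseteq> \<Union>K" using NK by blast
  then have "sum \<alpha> (\<Union>K) = sum \<alpha> (\<Union>K - N) + sum \<alpha> N" by (rule sum.subset_diff[OF _ finite_verts])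
  moreover have "sum \<alpha> (\<Union>K) = 1"
    using geo_sum[OF assms finite_verts] geo_support[OF assms] by blast
  ultimately show "sum \<alpha> N + sum \<alpha> (\<Union>K - N) = 1" by simp
  show "0 \<le> sum \<alpha> (\<Union>K - N)" using geo_nonneg[OF assms] by (intro sum_nonneg)
qed

text \<open>If it vanished, the coordinates on \<open>N\<close> would all equal their minimum 0 and
  no mass would lie outside \<open>N\<close>, so the total mass would be 0 instead of 1.\<close>

lemma denominator_pos:
  assumes a: "\<alpha> \<in> geo K"
  shows "0 < excess N e d \<alpha> + weight N \<alpha> ^ 2"
proof (rule ccontr)
  assume "\<not> 0 < excess N e d \<alpha> + weight N \<alpha> ^ 2"
  moreover have "0 \<le> (\<Sum>i=1..d. (\<alpha> (e i) - \<alpha> (e 0)) ^ 2)" by (intro sum_nonneg) simp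
  moreover have "0 \<le> weight N \<alpha> ^ 2" by simp
  ultimately have z: "(\<Sum>i=1..d. (\<alpha> (e i) - \<alpha> (e 0)) ^ 2) = 0" "sum \<alpha> (\<Union>K - N) = 0" "weight N \<alpha> ^ 2 = 0"
    using geo_sum_split(2)[OF a] unfolding excess_def by linarith+
  have eq: "\<alpha> (e i) = \<alpha> (e 0)" if "i \<le> d" for i
    using z(1) that by (cases "i = 0") (auto simp: sum_nonneg_eq_0_iff)
  obtain v where v: "v \<in> N" "weight N \<alpha> = \<alpha> v" using weight_attained[OF N_finite] by blast
  obtain i where "i \<le> d" "v = e i" using e_surj[OF v(1)] by blast
  then have "\<alpha> (e 0) = 0" using z(3) v(2) eq[of i] by simp
  then have "\<alpha> (e i) = 0" if "i \<le> d" for i using eq[OF that] by (simp only:)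
  then have "sum \<alpha> N = 0" unfolding sum_e by (intro sum.neutral) auto
  then show False using geo_sum_split(1)[OF a] z(2) by simp
qed

lemma weight_pos_iff: "\<alpha> \<in> geo K \<Longrightarrow> 0 < weight N \<alpha> \<longleftrightarrow> {v. \<alpha> v \<noteq> 0} = N"
proof (rule iffI)
  assume a: "\<alpha> \<in> geo K" and "0 < weight N \<alpha>"
  then show "{v. \<alpha> v \<noteq> 0} = N" using weight_critical_0[OF m_pos a N] by (metis less_irrefl)
next
  assume "\<alpha> \<in> geo K" "{v. \<alpha> v \<noteq> 0} = N"
  then show "0 < weight N \<alpha>" using weight_critical_pos(1)[OF m_pos _ N] by blast
qed

text \<open>A positive weight forces the support to be \<open>N\<close>. The outside mass that was
  added to \<open>excess\<close> is thus invisible in the sphere equation.\<close>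

lemma weight_mult_outside: "\<alpha> \<in> geo K \<Longrightarrow> weight N \<alpha> ^ 2 * sum \<alpha> (\<Union>K - N) = 0"
proof (cases "{v. \<alpha> v \<noteq> 0} = N")
  case True
  then have "sum \<alpha> (\<Union>K - N) = 0" by (intro sum.neutral) auto
  then show ?thesis by simp
next
  case False
  moreover assume "\<alpha> \<in> geo K"
  ultimately show ?thesis using weight_critical_0[OF m_pos _ N] by simp
qed

lemma chart_in_sphere:
  assumes a: "\<alpha> \<in> geo K"
  shows "chart N e d \<alpha> \<in> euclidean_sphere d"
proof -
  define D where "D = excess N e d \<alpha> + weight N \<alpha> ^ 2"
  define S where "S = (\<Sum>i=1..d. (\<alpha> (e i) - \<alpha> (e 0)) ^ 2)"
  have D: "D > 0" using denominator_pos[OF a] unfolding D_def .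
  have S: "weight N \<alpha> ^ 2 * excess N e d \<alpha> = weight N \<alpha> ^ 2 * S"
    using weight_mult_outside[OF a] unfolding excess_def S_def by (simp add: distrib_left)
  have "(\<Sum>i=1..d. chart N e d \<alpha> i ^ 2) = 4 * weight N \<alpha> ^ 2 / D ^ 2 * S"
    unfolding chart_def D_def S_def sum_distrib_left
    by (intro sum.cong) (auto simp: power_divide power_mult_distrib)
  then have sq: "(\<Sum>i=1..d. chart N e d \<alpha> i ^ 2) = 4 * (weight N \<alpha> ^ 2 * S) / D ^ 2" by simp
  have c0: "chart N e d \<alpha> 0 = (excess N e d \<alpha> - weight N \<alpha> ^ 2) / D" unfolding chart_def D_def by simp
  have "(\<Sum>i\<le>d. chart N e d \<alpha> i ^ 2)
      = ((excess N e d \<alpha> - weight N \<alpha> ^ 2) ^ 2 + 4 * (weight N \<alpha> ^ 2 * excess N e d \<alpha>)) / D ^ 2"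
    unfolding sum_atMost_shift sq c0 S by (simp only: power_divide add_divide_distrib)
  \<comment> \<open>With \<open>a\<close> the excess and \<open>b\<close> the squared weight, this
    is \<open>(a - b)^2 + 4 a b = (a + b)^2\<close>, the identity behind stereographic
    projection.\<close>
  also have "(excess N e d \<alpha> - weight N \<alpha> ^ 2) ^ 2 + 4 * (weight N \<alpha> ^ 2 * excess N e d \<alpha>) = D ^ 2"
    unfolding D_def by (simp add: power2_eq_square algebra_simps)
  finally show ?thesis using D unfolding euclidean_sphere_def by (simp add: chart_def)
qed

lemma chart_0: "\<alpha> \<in> geo K \<Longrightarrow> 1 - chart N e d \<alpha> 0 = 2 * weight N \<alpha> ^ 2 / (excess N e d \<alpha> + weight N \<alpha> ^ 2)"
proof -
  assume "\<alpha> \<in> geo K"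
  then have "excess N e d \<alpha> + weight N \<alpha> ^ 2 \<noteq> 0" using denominator_pos by force
  moreover have "1 - (a - b) / (a + b) = 2 * b / (a + b)" if "a + b \<noteq> 0" for a b :: real
    using that by (simp add: field_simps)
  ultimately show ?thesis unfolding chart_def by simp
qed

lemma chart_base_iff:
  assumes a: "\<alpha> \<in> geo K"
  shows "chart N e d \<alpha> = base_point \<longleftrightarrow> {v. \<alpha> v \<noteq> 0} \<noteq> N"
proof -
  have "chart N e d \<alpha> = base_point \<longleftrightarrow> weight N \<alpha> = 0"
    using euclidean_sphere_base_iff(2)[OF chart_in_sphere[OF a]] chart_0[OF a] denominator_pos[OF a] by auto
  then show ?thesis using weight_pos_iff[OF a] weight_nonneg[OF a N_finite] by linarith
qed

text \<open>Stereographic projection from the base point undoes the chart. The entry for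
  \<open>i = 0\<close> is set to 0 because coordinate 0 of the sphere is the height, while
  \<open>e 0\<close> is the reference vertex.\<close>

lemma chart_ratio:
  assumes a: "\<alpha> \<in> geo K" "{v. \<alpha> v \<noteq> 0} = N" and i: "i \<le> d"
  shows "(if i = 0 then 0 else chart N e d \<alpha> i) / (1 - chart N e d \<alpha> 0) = \<alpha> (e i) / weight N \<alpha> - \<alpha> (e 0) / weight N \<alpha>"
proof -
  have "0 < weight N \<alpha>" using weight_pos_iff a by blast
  moreover have "2 * w * u / D / (2 * w ^ 2 / D) = u / w" if "0 < w" "0 < D" for w u D :: real
    using that by (simp add: field_simps power2_eq_square)
  ultimately show ?thesis
    unfolding chart_0[OF a(1)] diff_divide_distrib[symmetric] using denominator_pos[OF a(1)] i
    by (simp add: chart_def)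
qed

text \<open>The projection determines the coordinates divided by the weight up to a common shift
  \<kappa>. Both rescaled families have minimum 1, so the shift is 0, and total mass 1 fixes the
  scale.\<close>

lemma chart_inj:
  assumes a: "\<alpha> \<in> geo K" "{v. \<alpha> v \<noteq> 0} = N" and b: "\<beta> \<in> geo K" "{v. \<beta> v \<noteq> 0} = N"
    and eq: "chart N e d \<alpha> = chart N e d \<beta>"
  shows "\<alpha> = \<beta>"
proof -
  define \<kappa> where "\<kappa> = \<alpha> (e 0) / weight N \<alpha> - \<beta> (e 0) / weight N \<beta>"
  have pos: "0 < weight N \<alpha>" "0 < weight N \<beta>" using weight_pos_iff a b by blast+
  have k: "\<alpha> v / weight N \<alpha> = \<beta> v / weight N \<beta> + \<kappa>" if v: "v \<in> N" for v
  proof -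
    obtain i where i: "i \<le> d" "v = e i" using e_surj[OF v] by blast
    show ?thesis using chart_ratio[OF a i(1)] chart_ratio[OF b i(1)] unfolding eq i(2) \<kappa>_def by linarith
  qed
  have "\<kappa> = 0"
  proof (rule antisym)
    obtain v where v: "v \<in> N" "weight N \<alpha> = \<alpha> v" using weight_attained[OF N_finite] by blast
    have "1 \<le> \<beta> v / weight N \<beta>" using weight_le[OF N_finite(1) v(1), of \<beta>] pos by simp
    moreover have "\<alpha> v / weight N \<alpha> = 1" using v(2) pos by simp
    ultimately show "\<kappa> \<le> 0" using k[OF v(1)] by simp
    obtain w where w: "w \<in> N" "weight N \<beta> = \<beta> w" using weight_attained[OF N_finite] by blast
    have "1 \<le> \<alpha> w / weight N \<alpha>" using weight_le[OF N_finite(1) w(1), of \<alpha>] pos by simp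
    moreover have "\<beta> w / weight N \<beta> = 1" using w(2) pos by simp
    ultimately show "0 \<le> \<kappa>" using k[OF w(1)] by simp
  qed
  then have k0: "\<alpha> v / weight N \<alpha> = \<beta> v / weight N \<beta>" if "v \<in> N" for v using k[OF that] by simp
  have "sum \<alpha> N / weight N \<alpha> = sum \<beta> N / weight N \<beta>"
    unfolding sum_divide_distrib by (intro sum.cong refl k0)
  then have "weight N \<alpha> = weight N \<beta>"
    using weight_critical_pos(3)[OF m_pos a(1) N a(2)] weight_critical_pos(3)[OF m_pos b(1) N b(2)] by simp
  then have "\<alpha> v = \<beta> v" if "v \<in> N" for v using k0[OF that] pos by simp
  moreover have "\<alpha> v = 0" "\<beta> v = 0" if "v \<notin> N" for v using that a(2) b(2) by blast+
  ultimately have "\<alpha> v = \<beta> v" for v by (cases "v \<in> N") simp_all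
  then show ?thesis by (rule ext)
qed

lemma chart_surj:
  assumes x: "x \<in> euclidean_sphere d" "x \<noteq> base_point"
  shows "\<exists>\<alpha>\<in>geo K. {v. \<alpha> v \<noteq> 0} = N \<and> chart N e d \<alpha> = x"
proof -
  define c where "c = 1 - x 0"
  have c: "0 < c" using euclidean_sphere_base_iff[OF x(1)] x(2) unfolding c_def by fastforce
  have sq: "x 0 ^ 2 + (\<Sum>i=1..d. x i ^ 2) = 1" and high: "\<And>i. d < i \<Longrightarrow> x i = 0"
    using x(1) unfolding euclidean_sphere_def sum_atMost_shift by auto
  define y where "y i = (if i = 0 then 0 else x i / c)" for i
  \<comment> \<open>The shift makes the smallest value 1. After division by the sum \<open>Z\<close>
    all coordinates are positive and the weight is \<open>1 / Z\<close>.\<close>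
  define z where "z i = y i - Min (y ` {..d}) + 1" for i
  have z1: "1 \<le> z i" if "i \<le> d" for i using that unfolding z_def by simp
  obtain j where j: "j \<le> d" "z j = 1"
  proof -
    have "Min (y ` {..d}) \<in> y ` {..d}" by (intro Min_in) auto
    then obtain j where "Min (y ` {..d}) = y j" "j \<in> {..d}" by (rule imageE)
    then show ?thesis using that[of j] unfolding z_def by simp
  qed
  define Z where "Z = (\<Sum>i\<le>d. z i)"
  have "(\<Sum>i\<le>d. 1) \<le> Z" unfolding Z_def by (intro sum_mono z1) auto
  then have Z: "0 < Z" by simp
  define \<alpha> where "\<alpha> v = (if v \<in> N then z (inv_into {..d} e v) / Z else 0)" for v
  have ae: "\<alpha> (e i) = z i / Z" if "i \<le> d" for i
    unfolding \<alpha>_def using that e_in bij_betw_inv_into_left[OF e] by simp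
  have apos: "0 < \<alpha> v" if v: "v \<in> N" for v
  proof -
    obtain i where i: "i \<le> d" "v = e i" using e_surj[OF v] by blast
    then show ?thesis using ae[OF i(1)] z1[OF i(1)] Z by simp
  qed
  have out: "\<alpha> v = 0" if "v \<notin> N" for v using that unfolding \<alpha>_def by simp
  have supp: "{v. \<alpha> v \<noteq> 0} = N" using apos out by force
  have "sum \<alpha> N = (\<Sum>i\<le>d. z i / Z)" unfolding sum_e by (intro sum.cong) (auto simp: ae)
  then have sum1: "sum \<alpha> N = 1" using Z unfolding Z_def by (simp flip: sum_divide_distrib)
  have geo: "\<alpha> \<in> geo K"
  proof (rule geoI[OF N_finite(1) _ out sum1])
    show "0 \<le> \<alpha> v" for v using apos[of v] out[of v] by (cases "v \<in> N") auto
    show "{v. \<alpha> v \<noteq> 0} \<in> K" unfolding supp by (rule NK(1))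
  qed
  have w: "weight N \<alpha> = 1 / Z"
  proof (rule antisym)
    show "weight N \<alpha> \<le> 1 / Z" using weight_le[OF N_finite(1) e_in[OF j(1)], of \<alpha>] ae[OF j(1)] j(2) by simp
    obtain v where v: "v \<in> N" "weight N \<alpha> = \<alpha> v" using weight_attained[OF N_finite] by blast
    obtain i where i: "i \<le> d" "v = e i" using e_surj[OF v(1)] by blast
    then show "1 / Z \<le> weight N \<alpha>" using v(2) ae[OF i(1)] z1[OF i(1)] Z by (simp add: divide_right_mono)
  qed
  have diff: "\<alpha> (e i) - \<alpha> (e 0) = x i / (c * Z)" if "i \<in> {1..d}" for i
  proof -
    have "\<alpha> (e i) - \<alpha> (e 0) = (z i - z 0) / Z"
      using that ae[of i] ae[of 0] by (simp add: diff_divide_distrib)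
    also have "z i - z 0 = y i - y 0" unfolding z_def by simp
    also have "\<dots> = x i / c" using that unfolding y_def by simp
    finally show ?thesis by simp
  qed
  have "excess N e d \<alpha> = (\<Sum>i=1..d. (\<alpha> (e i) - \<alpha> (e 0)) ^ 2)"
  proof -
    have "sum \<alpha> (\<Union>K - N) = 0" by (intro sum.neutral ballI) (simp add: out)
    then show ?thesis unfolding excess_def by simp
  qed
  also have "\<dots> = (\<Sum>i=1..d. x i ^ 2) / (c * Z) ^ 2"
    unfolding sum_divide_distrib by (intro sum.cong refl) (simp add: diff power_divide)
  \<comment> \<open>This is \<open>1 - (x 0)^2\<close> with \<open>x 0 = 1 - c\<close>.\<close>
  also have "(\<Sum>i=1..d. x i ^ 2) = c * (2 - c)"
    using sq unfolding c_def by (simp add: power2_eq_square algebra_simps)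
  finally have ex: "excess N e d \<alpha> = (2 - c) / (c * Z ^ 2)"
    using c Z by (simp add: power_mult_distrib power2_eq_square)
  have den: "excess N e d \<alpha> + weight N \<alpha> ^ 2 = 2 / (c * Z ^ 2)"
    and num: "excess N e d \<alpha> - weight N \<alpha> ^ 2 = (2 - 2 * c) / (c * Z ^ 2)"
  proof -
    have "(1 / Z) ^ 2 = c / (c * Z ^ 2)" using c by (simp add: power_one_over)
    show "excess N e d \<alpha> + weight N \<alpha> ^ 2 = 2 / (c * Z ^ 2)"
      "excess N e d \<alpha> - weight N \<alpha> ^ 2 = (2 - 2 * c) / (c * Z ^ 2)"
      unfolding ex w \<open>(1 / Z) ^ 2 = _\<close> add_divide_distrib[symmetric] diff_divide_distrib[symmetric]
      by simp_all
  qed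
  have "chart N e d \<alpha> i = x i" for i
  proof -
    have "i = 0 \<or> i \<in> {1..d} \<or> d < i" by auto
    then consider "i = 0" | "i \<in> {1..d}" | "d < i" by (elim disjE)
    then show ?thesis
    proof cases
      case 1
      have "chart N e d \<alpha> 0 = (2 - 2 * c) / 2" unfolding chart_def den num using c Z by (simp del: diff_divide_distrib)
      then show ?thesis using 1 by (simp add: c_def)
    next
      case 2
      have "chart N e d \<alpha> i = 2 * (1 / Z) * (x i / (c * Z)) / (2 / (c * Z ^ 2))"
      proof -
        have "chart N e d \<alpha> i = 2 * weight N \<alpha> * (\<alpha> (e i) - \<alpha> (e 0)) / (excess N e d \<alpha> + weight N \<alpha> ^ 2)"
          using 2 by (simp add: chart_def)
        then show ?thesis by (simp only: den[unfolded w] diff[OF 2] w)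
      qed
      also have "\<dots> = x i"
      proof -
        have "2 * (1 / Z) * (x i / (c * Z)) = x i * (2 / (c * Z ^ 2))"
          by (simp add: power2_eq_square mult_ac)
        moreover have "2 / (c * Z ^ 2) \<noteq> 0" using c Z by simp
        moreover have "a * k / k = a" if "k \<noteq> 0" for a k :: real using that by simp
        ultimately show ?thesis by metis
      qed
      finally show ?thesis .
    next
      case 3
      then show ?thesis unfolding chart_def using high[OF 3] by simp
    qed
  qed
  then show ?thesis using geo supp by blast
qed

lemma continuous_on_chart: "continuous_on (geo K) (chart N e d)"
proof (rule continuous_on_coordinatewise_then_product)
  fix i
  have ex: "continuous_on (geo K) (excess N e d)" unfolding excess_def by (intro continuous_intros)
  have w: "continuous_on (geo K) (weight N)" by (intro continuous_intros N_finite)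
  have den: "\<forall>\<alpha>\<in>geo K. excess N e d \<alpha> + weight N \<alpha> ^ 2 \<noteq> 0"
    using denominator_pos by (metis less_irrefl)
  have "continuous_on (geo K) (\<lambda>\<alpha>. (excess N e d \<alpha> - weight N \<alpha> ^ 2) / (excess N e d \<alpha> + weight N \<alpha> ^ 2))"
    by (intro continuous_on_divide continuous_on_diff continuous_on_add continuous_on_power ex w den)
  moreover have "continuous_on (geo K)
      (\<lambda>\<alpha>. 2 * weight N \<alpha> * (\<alpha> (e i) - \<alpha> (e 0)) / (excess N e d \<alpha> + weight N \<alpha> ^ 2))"
    by (intro continuous_on_divide continuous_on_diff continuous_on_add continuous_on_mult
        continuous_on_power continuous_on_const continuous_on_coord ex w den)
  ultimately show "continuous_on (geo K) (\<lambda>\<alpha>. chart N e d \<alpha> i)"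
    unfolding chart_def by (cases "i = 0"; cases "i \<le> d") (simp_all only: if_True if_False continuous_on_const simp_thms)
qed

end

end

context partitioned_complex
begin

subsection \<open>The quotient by the acyclic part\<close>

lemma cone_part_geo_nonempty:
  assumes m: "0 < m"
  shows "geo cone_part \<noteq> {}"
proof -
  have N: "{} \<in> K" "{} \<subseteq> P" using empty_face by auto
  have "T {} \<noteq> {}" using card_T[OF N] m by auto
  then obtain v where v: "v \<in> T {}" by blast
  have "{v} \<in> K" using face_subset[OF T_face[OF N]] v by simp
  moreover have "v \<notin> P" using T_Int[OF N] v by blast
  ultimately have "{v} \<in> cone_part" unfolding cone_part_def critical_def by simp
  then have "(\<lambda>u. if u = v then 1 else 0) \<in> geo cone_part" by (intro geoI[of "{v}"]) auto
  then show ?thesis by blast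
qed

text \<open>The map \<open>q\<close> sends the acyclic part to the base point and each critical
  facet by its chart onto one sphere. It is continuous by gluing finitely many closed pieces, closed
  by compactness, and surjective, hence a quotient map that identifies points of the acyclic part
  only.\<close>

theorem realization_homotopy_equivalent_wedge:
  assumes m: "m = Suc d" and crit: "critical \<noteq> {}"
  shows "realization K homotopy_equivalent_space wedge_of_spheres (card critical) (int d)"
proof -
  define M where "M = card critical"
  let ?W = "wedge_of_spheres M (int d)"
  let ?A = "geo cone_part"
  have m0: "0 < m" using m by simp
  \<comment> \<open>Sphere number 0 supplies the base point of the wedge, so there has to be
    one.\<close>
  have M0: "0 < M" unfolding M_def using crit finite_critical by (simp add: card_gt_0_iff)
  have AK: "?A \<subseteq> geo K" by (rule geo_mono[OF cone_part_subset_K])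
  obtain \<nu> where nu: "bij_betw \<nu> {..<M} critical"
    using ex_bij_betw_nat_finite[OF finite_critical] unfolding M_def atLeast0LessThan by blast
  have nu_crit: "\<nu> i \<in> critical" if "i < M" for i using bij_betwE[OF nu] that by simp
  have nu_inj: "i = j" if "i < M" "j < M" "\<nu> i = \<nu> j" for i j
    using bij_betw_imp_inj_on[OF nu] that by (simp add: inj_on_def)
  have nu_surj: "\<exists>i<M. \<nu> i = N" if "N \<in> critical" for N
    using bij_betw_imp_surj_on[OF nu] that by (metis imageE lessThan_iff)
  have "\<exists>f. bij_betw f {..d} (\<nu> i)" if i: "i < M" for i
  proof -
    have "finite (\<nu> i)" "card (\<nu> i) = Suc d"
      using nu_crit[OF i] finite_face m unfolding critical_def by auto
    then show ?thesis using ex_bij_betw_nat_finite[of "\<nu> i"]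
      by (simp add: atLeast0LessThan lessThan_Suc_atMost)
  qed
  then obtain e where e: "\<And>i. i < M \<Longrightarrow> bij_betw (e i) {..d} (\<nu> i)" by metis
  define ch where "ch i = chart (\<nu> i) (e i) d" for i
  have ch_sphere: "ch i \<alpha> \<in> euclidean_sphere d" if "i < M" "\<alpha> \<in> geo K" for i \<alpha>
    unfolding ch_def using chart_in_sphere[OF m nu_crit e] that by blast
  have ch_base: "ch i \<alpha> = base_point \<longleftrightarrow> {v. \<alpha> v \<noteq> 0} \<noteq> \<nu> i" if "i < M" "\<alpha> \<in> geo K" for i \<alpha>
    unfolding ch_def using chart_base_iff[OF m nu_crit e] that by blast
  have ch_inj: "\<alpha> = \<beta>" if "i < M" "\<alpha> \<in> geo K" "{v. \<alpha> v \<noteq> 0} = \<nu> i" "\<beta> \<in> geo K" "{v. \<beta> v \<noteq> 0} = \<nu> i"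
    "ch i \<alpha> = ch i \<beta>" for i \<alpha> \<beta>
    using chart_inj[OF m nu_crit[OF that(1)] e[OF that(1)] that(2-5)] that(6) unfolding ch_def by blast
  have ch_surj: "\<exists>\<alpha>\<in>geo K. {v. \<alpha> v \<noteq> 0} = \<nu> i \<and> ch i \<alpha> = x"
    if "i < M" "x \<in> euclidean_sphere d" "x \<noteq> base_point" for i x
    using chart_surj[OF m nu_crit[OF that(1)] e[OF that(1)] that(2,3)] unfolding ch_def .
  have ch_cont: "continuous_on (geo K) (ch i)" if "i < M" for i
    unfolding ch_def by (rule continuous_on_chart[OF m nu_crit[OF that] e[OF that]])
  let ?wp = "wedge_point M d"
  have wp_eq: "?wp i y = ?wp j z \<longleftrightarrow> i = j \<and> y = z \<or> y = base_point \<and> z = base_point"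
    if "i < M" "j < M" "y \<in> euclidean_sphere d" "z \<in> euclidean_sphere d" for i j y z
    using wedge_point_eq_iff that by blast
  note base = base_point_in_sphere[of d]
  define ix where "ix \<alpha> = (SOME i. i < M \<and> \<nu> i = {v. \<alpha> v \<noteq> 0})" for \<alpha> :: "'v \<Rightarrow> real"
  define q where "q \<alpha> = (if {v. \<alpha> v \<noteq> 0} \<in> critical then ?wp (ix \<alpha>) (ch (ix \<alpha>) \<alpha>) else ?wp 0 base_point)" for \<alpha>
  have q_crit: "q \<alpha> = ?wp i (ch i \<alpha>)" if "i < M" "{v. \<alpha> v \<noteq> 0} = \<nu> i" for i \<alpha>
  proof -
    have "ix \<alpha> < M \<and> \<nu> (ix \<alpha>) = {v. \<alpha> v \<noteq> 0}"
      unfolding ix_def by (rule someI[of _ i]) (use that in simp)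
    then have "ix \<alpha> = i" using nu_inj that by simp
    then show ?thesis unfolding q_def using that nu_crit by simp
  qed
  have q_A: "q \<alpha> = ?wp 0 base_point" if "\<alpha> \<in> ?A" for \<alpha>
    using geo_support[OF that] unfolding q_def cone_part_def by simp
  have cases_geo: "\<alpha> \<in> ?A \<or> (\<exists>i<M. {v. \<alpha> v \<noteq> 0} = \<nu> i)" if "\<alpha> \<in> geo K" for \<alpha>
    using geo_cone_part_iff[OF that] nu_surj by metis
  have not_A: "\<alpha> \<notin> ?A" if "i < M" "{v. \<alpha> v \<noteq> 0} = \<nu> i" for \<alpha> i
    using geo_support[of \<alpha> cone_part] that nu_crit unfolding cone_part_def by auto
  \<comment> \<open>The closed facet, written as a zero set so that it is visibly closed: by
    nonnegativity, this one sum confines the support to \<open>\<nu> i\<close>.\<close>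
  define cell where "cell i = {\<alpha> \<in> geo K. sum \<alpha> (\<Union>K - \<nu> i) = 0}" for i
  have cell_iff: "\<alpha> \<in> cell i \<longleftrightarrow> {v. \<alpha> v \<noteq> 0} \<subseteq> \<nu> i" if "\<alpha> \<in> geo K" for \<alpha> i
  proof -
    have "sum \<alpha> (\<Union>K - \<nu> i) = 0 \<longleftrightarrow> (\<forall>v\<in>\<Union>K - \<nu> i. \<alpha> v = 0)"
      using finite_verts geo_nonneg[OF that] by (intro sum_nonneg_eq_0_iff) auto
    then have "\<alpha> \<in> cell i \<longleftrightarrow> (\<forall>v\<in>\<Union>K - \<nu> i. \<alpha> v = 0)" unfolding cell_def using that by simp
    also have "\<dots> \<longleftrightarrow> {v. \<alpha> v \<noteq> 0} \<subseteq> \<nu> i"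
    proof
      assume h: "\<forall>v\<in>\<Union>K - \<nu> i. \<alpha> v = 0"
      show "{v. \<alpha> v \<noteq> 0} \<subseteq> \<nu> i"
      proof
        fix v assume v: "v \<in> {v. \<alpha> v \<noteq> 0}"
        then have "v \<in> \<Union>K" using geo_support[OF \<open>\<alpha> \<in> geo K\<close>] by (rule UnionI[rotated])
        then show "v \<in> \<nu> i" using h v by auto
      qed
    qed auto
    finally show ?thesis .
  qed
  have cell_cases: "\<alpha> \<in> ?A \<or> {v. \<alpha> v \<noteq> 0} = \<nu> i" if a: "i < M" "\<alpha> \<in> geo K" "\<alpha> \<in> cell i" for i \<alpha>
  proof (rule disjCI)
    assume ne: "{v. \<alpha> v \<noteq> 0} \<noteq> \<nu> i"
    have sub: "{v. \<alpha> v \<noteq> 0} \<subseteq> \<nu> i" using cell_iff a by blast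
    have n: "\<nu> i \<in> K" "card (\<nu> i) = m" using nu_crit[OF a(1)] unfolding critical_def by auto
    have "card {v. \<alpha> v \<noteq> 0} < m"
      using psubset_card_mono[OF finite_face[OF n(1)], of "{v. \<alpha> v \<noteq> 0}"] sub ne n(2) by blast
    then have "{v. \<alpha> v \<noteq> 0} \<notin> critical" unfolding critical_def by simp
    then show "\<alpha> \<in> ?A" using geo_cone_part_iff[OF a(2)] by blast
  qed
  have q_cell: "q \<alpha> = ?wp i (ch i \<alpha>)" if a: "i < M" "\<alpha> \<in> geo K" "\<alpha> \<in> cell i" for i \<alpha>
    using cell_cases[OF a]
  proof
    assume A: "\<alpha> \<in> ?A"
    then have "ch i \<alpha> = base_point" using ch_base[OF a(1,2)] not_A[OF a(1)] by blast
    then show ?thesis using q_A[OF A] wp_eq[OF M0 a(1) base base] by simp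
  qed (rule q_crit[OF a(1)])
  have closed_cell: "closedin (top_of_set (geo K)) (cell i)" for i
    unfolding cell_def by (intro continuous_closedin_preimage_constant continuous_intros)
  have A_eq: "?A = {\<alpha> \<in> geo K. total_weight \<alpha> = 0}"
  proof (intro equalityI subsetI)
    fix \<alpha> assume "\<alpha> \<in> ?A"
    then show "\<alpha> \<in> {\<alpha> \<in> geo K. total_weight \<alpha> = 0}" using cone_part_weights(1)[OF m0] AK by auto
  next
    fix \<alpha> assume a: "\<alpha> \<in> {\<alpha> \<in> geo K. total_weight \<alpha> = 0}"
    then have aK: "\<alpha> \<in> geo K" by simp
    have "{v. \<alpha> v \<noteq> 0} \<notin> critical"
    proof
      assume c: "{v. \<alpha> v \<noteq> 0} \<in> critical"
      show False
        using critical_weights(1)[OF m0 aK c refl] weight_critical_pos(1)[OF m0 aK c refl] a by simp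
    qed
    then show "\<alpha> \<in> ?A" using geo_cone_part_iff[OF aK] by blast
  qed
  have closed_A: "closedin (top_of_set (geo K)) ?A"
    unfolding A_eq by (intro continuous_closedin_preimage_constant continuous_on_total_weight[OF m0])
  have cont: "continuous_map (top_of_set (geo K)) ?W q"
  \<comment> \<open>The extra index \<open>M\<close> stands for the acyclic part.\<close>
  proof (rule pasting_lemma_closed[where I = "{..M}" and T = "\<lambda>i. if i < M then cell i else ?A"
        and f = "\<lambda>i. if i < M then ?wp i \<circ> ch i else (\<lambda>_. ?wp 0 base_point)"])
    show "closedin (top_of_set (geo K)) (if i < M then cell i else ?A)" for i
      using closed_cell closed_A by simp
    show "continuous_map (subtopology (top_of_set (geo K)) (if i < M then cell i else ?A)) ?W
        (if i < M then ?wp i \<circ> ch i else (\<lambda>_. ?wp 0 base_point))" for i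
    proof (cases "i < M")
      case True
      have "continuous_map (top_of_set (geo K)) (nsphere d) (ch i)"
        unfolding nsphere_euclidean_sphere using ch_cont[OF True] ch_sphere[OF True] by simp
      then have "continuous_map (top_of_set (geo K)) ?W (?wp i \<circ> ch i)"
        by (rule continuous_map_compose[OF _ continuous_map_wedge_point[OF True]])
      then show ?thesis using True continuous_map_from_subtopology by auto
    next
      case False
      have "?wp 0 base_point \<in> topspace ?W" unfolding topspace_wedge_of_spheres using M0 base by blast
      then show ?thesis using False by simp
    qed
    have q_piece: "q \<alpha> = (if i < M then ?wp i \<circ> ch i else (\<lambda>_. ?wp 0 base_point)) \<alpha>"
      if "\<alpha> \<in> geo K" "\<alpha> \<in> (if i < M then cell i else ?A)" for i \<alpha>
      using that q_cell q_A by (cases "i < M") auto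
    show "(if i < M then ?wp i \<circ> ch i else (\<lambda>_. ?wp 0 base_point)) \<alpha> =
        (if j < M then ?wp j \<circ> ch j else (\<lambda>_. ?wp 0 base_point)) \<alpha>"
      if "i \<in> {..M}" "j \<in> {..M}" "\<alpha> \<in> topspace (top_of_set (geo K)) \<inter> (if i < M then cell i else ?A)
        \<inter> (if j < M then cell j else ?A)" for i j \<alpha>
      using q_piece[of \<alpha> i] q_piece[of \<alpha> j] that(3) by auto
    show "\<exists>j. j \<in> {..M} \<and> \<alpha> \<in> (if j < M then cell j else ?A) \<and>
        q \<alpha> = (if j < M then ?wp j \<circ> ch j else (\<lambda>_. ?wp 0 base_point)) \<alpha>"
      if "\<alpha> \<in> topspace (top_of_set (geo K))" for \<alpha>
    proof -
      have aK: "\<alpha> \<in> geo K" using that by simp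
      from cases_geo[OF aK] show ?thesis
      proof
        assume "\<alpha> \<in> ?A"
        then show ?thesis using q_A by (intro exI[of _ M]) simp
      next
        assume "\<exists>i<M. {v. \<alpha> v \<noteq> 0} = \<nu> i"
        then obtain i where i: "i < M" "{v. \<alpha> v \<noteq> 0} = \<nu> i" by blast
        then have "\<alpha> \<in> cell i" using cell_iff[OF aK] by blast
        then show ?thesis using i q_cell[OF i(1) aK] by (intro exI[of _ i]) simp
      qed
    qed
  qed simp
  have compact_K: "compact (geo K)" by (rule compact_geo[OF finite_K finite_face face_subset])
  have "closed_map (top_of_set (geo K)) ?W q"
    unfolding closed_map_def
  proof (intro allI impI)
    fix C assume C: "closedin (top_of_set (geo K)) C"
    then have CK: "C \<subseteq> geo K" using closedin_imp_subset by blast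
    show "closedin ?W (q ` C)"
    proof (rule closedin_wedge_of_spheres)
      show "q ` C \<subseteq> topspace ?W" using continuous_map_image_subset_topspace[OF cont] CK by auto
      fix i assume i: "i < M"
      \<comment> \<open>Seen in one sphere, the image of \<open>C\<close> is the chart image of a
        compact set, with the base point added as soon as \<open>C\<close> meets the acyclic part
        anywhere.\<close>
      have "{y \<in> euclidean_sphere d. ?wp i y \<in> q ` C} =
          ch i ` (C \<inter> cell i) \<union> (if C \<inter> ?A = {} then {} else {base_point})" (is "?L = ?R")
      proof (intro equalityI subsetI)
        fix y assume "y \<in> ?L"
        then obtain \<alpha> where y: "y \<in> euclidean_sphere d" "\<alpha> \<in> C" "?wp i y = q \<alpha>" by auto
        then have aK: "\<alpha> \<in> geo K" using CK by blast
        from cases_geo[OF aK] show "y \<in> ?R"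
        proof
          assume A: "\<alpha> \<in> ?A"
          then have "y = base_point" using q_A[OF A] wp_eq[OF i M0 y(1) base] y(3) by auto
          then show ?thesis using A y(2) by auto
        next
          assume "\<exists>j<M. {v. \<alpha> v \<noteq> 0} = \<nu> j"
          then obtain j where j: "j < M" "{v. \<alpha> v \<noteq> 0} = \<nu> j" by blast
          have "ch j \<alpha> \<noteq> base_point" using ch_base[OF j(1) aK] j(2) by simp
          then have "i = j \<and> y = ch j \<alpha>"
            using y(3) q_crit[OF j] wp_eq[OF i j(1) y(1) ch_sphere[OF j(1) aK]] by simp
          moreover have "\<alpha> \<in> cell j" using cell_iff[OF aK] j(2) by blast
          ultimately show ?thesis using y(2) by blast
        qed
      next
        fix y assume "y \<in> ?R"
        then consider \<alpha> where "\<alpha> \<in> C" "\<alpha> \<in> cell i" "y = ch i \<alpha>" | \<alpha> where "\<alpha> \<in> C" "\<alpha> \<in> ?A" "y = base_point"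
          by (auto split: if_splits)
        then show "y \<in> ?L"
        proof cases
          case 1
          then have "\<alpha> \<in> geo K" using CK by blast
          then show ?thesis using 1 q_cell[OF i] ch_sphere[OF i] by force
        next
          case 2
          have "?wp i y = q \<alpha>" using q_A[OF 2(2)] wp_eq[OF i M0 base base] 2(3) by simp
          then show ?thesis using 2 base by blast
        qed
      qed
      moreover have "compact (ch i ` (C \<inter> cell i))"
      proof (rule compact_continuous_image)
        show "continuous_on (C \<inter> cell i) (ch i)" using ch_cont[OF i] CK by (meson continuous_on_subset inf.coboundedI1)
        show "compact (C \<inter> cell i)"
          using closedin_compact[OF compact_K] closedin_Int[OF C closed_cell] by blast
      qed
      ultimately show "closed {y \<in> euclidean_sphere d. ?wp i y \<in> q ` C}"
        by (auto intro!: closed_Un compact_imp_closed)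
    qed
  qed
  moreover have "q ` topspace (top_of_set (geo K)) = topspace ?W"
  proof
    show "q ` topspace (top_of_set (geo K)) \<subseteq> topspace ?W" by (rule continuous_map_image_subset_topspace[OF cont])
    show "topspace ?W \<subseteq> q ` topspace (top_of_set (geo K))"
    proof
      fix w assume "w \<in> topspace ?W"
      then obtain i y where w: "w = ?wp i y" "i < M" "y \<in> euclidean_sphere d"
        unfolding topspace_wedge_of_spheres by blast
      show "w \<in> q ` topspace (top_of_set (geo K))"
      proof (cases "y = base_point")
        case True
        obtain \<alpha> where a: "\<alpha> \<in> ?A" using cone_part_geo_nonempty[OF m0] by blast
        then have "q \<alpha> = w" using q_A w True wp_eq[OF w(2) M0 base base] by simp
        then show ?thesis using a AK by auto
      next
        case False
        then obtain \<alpha> where "\<alpha> \<in> geo K" "{v. \<alpha> v \<noteq> 0} = \<nu> i" "ch i \<alpha> = y"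
          using ch_surj[OF w(2,3)] by blast
        then have "\<alpha> \<in> geo K" "q \<alpha> = w" using q_crit[OF w(2)] w(1) by auto
        then show ?thesis by auto
      qed
    qed
  qed
  ultimately have qm: "quotient_map (top_of_set (geo K)) ?W q"
    by (intro continuous_closed_imp_quotient_map cont)
  have "q \<alpha> = q \<beta> \<longleftrightarrow> \<alpha> = \<beta> \<or> \<alpha> \<in> ?A \<and> \<beta> \<in> ?A" if a: "\<alpha> \<in> geo K" and b: "\<beta> \<in> geo K" for \<alpha> \<beta>
  proof
    assume "\<alpha> = \<beta> \<or> \<alpha> \<in> ?A \<and> \<beta> \<in> ?A"
    then show "q \<alpha> = q \<beta>" using q_A by auto
  next
    assume eq: "q \<alpha> = q \<beta>"
    have base_q: "\<alpha> \<in> ?A" if a: "\<alpha> \<in> geo K" and q: "q \<alpha> = ?wp 0 base_point" for \<alpha>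
    proof (rule ccontr)
      assume "\<alpha> \<notin> ?A"
      then obtain i where i: "i < M" "{v. \<alpha> v \<noteq> 0} = \<nu> i" using cases_geo[OF a] by blast
      then show False
        using q_crit[OF i] q wp_eq[OF i(1) M0 ch_sphere[OF i(1) a] base] ch_base[OF i(1) a] by auto
    qed
    show "\<alpha> = \<beta> \<or> \<alpha> \<in> ?A \<and> \<beta> \<in> ?A"
    proof (cases "\<alpha> \<in> ?A \<or> \<beta> \<in> ?A")
      case True
      then have "q \<alpha> = ?wp 0 base_point" "q \<beta> = ?wp 0 base_point" using q_A eq by auto
      then show ?thesis using base_q a b by blast
    next
      case False
      then obtain i j where i: "i < M" "{v. \<alpha> v \<noteq> 0} = \<nu> i" and j: "j < M" "{v. \<beta> v \<noteq> 0} = \<nu> j"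
        using cases_geo[OF a] cases_geo[OF b] by blast
      have "ch i \<alpha> \<noteq> base_point" using ch_base[OF i(1) a] i(2) by simp
      then have ij: "i = j" "ch i \<alpha> = ch j \<beta>"
        using eq q_crit[OF i] q_crit[OF j] wp_eq[OF i(1) j(1) ch_sphere[OF i(1) a] ch_sphere[OF j(1) b]] by auto
      then show ?thesis using ch_inj[OF i(1) a i(2) b] j(2) by simp
    qed
  qed
  then have "top_of_set (geo K) homotopy_equivalent_space ?W"
    by (intro homotopy_equivalent_cone_part_quotient[OF m0 qm]) blast
  then show ?thesis unfolding realization_geo M_def .
qed

end

subsection \<open>Spanning trees\<close>

text \<open>By the count of roots, having one arc fewer than vertices means having exactly one root,
  and every vertex is reached from some root.\<close>

lemma directed_tree_iff_branching:
  assumes V: "finite (pverts T)"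
  shows "(\<exists>x. directed_tree T x) \<longleftrightarrow>
    branching (parcs T) \<and> parcs T \<subseteq> pverts T \<times> pverts T \<and> Suc (card (parcs T)) = card (pverts T)"
proof
  assume "\<exists>x. directed_tree T x"
  then obtain x where x: "directed_tree T x" by blast
  have br: "branching (parcs T)" using branching_directed_tree[OF x] .
  have sub: "parcs T \<subseteq> pverts T \<times> pverts T" using directed_tree_wf[OF x] by auto
  have xV: "x \<in> pverts T" using x unfolding directed_tree_def by blast
  have reach: "(x, y) \<in> (parcs T)\<^sup>*" if "y \<in> pverts T" for y
    using x that unfolding directed_tree_def awalk_with_proj rtrancl_iff_pcas by blast
  have "x \<notin> Range (parcs T)"
  proof
    assume "x \<in> Range (parcs T)"
    then obtain u where u: "(u, x) \<in> parcs T" by blast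
    then have "(x, u) \<in> (parcs T)\<^sup>*" using reach sub by blast
    then have "(x, x) \<in> (parcs T)\<^sup>+" using u by (rule rtrancl_into_trancl1)
    then show False using br unfolding branching_def acyclic_def by blast
  qed
  moreover have "y \<in> Range (parcs T)" if "y \<in> pverts T" "y \<noteq> x" for y
    using reach[OF that(1)] that(2) by (metis Range.intros rtranclE)
  ultimately have "pverts T - Range (parcs T) = {x}" using xV by blast
  then have "card (pverts T) - card (parcs T) = 1" using card_branching_roots[OF br sub V] by simp
  then show "branching (parcs T) \<and> parcs T \<subseteq> pverts T \<times> pverts T \<and> Suc (card (parcs T)) = card (pverts T)"
    using br sub by simp
next
  assume a: "branching (parcs T) \<and> parcs T \<subseteq> pverts T \<times> pverts T \<and> Suc (card (parcs T)) = card (pverts T)"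
  then have br: "branching (parcs T)" and sub: "parcs T \<subseteq> pverts T \<times> pverts T" by auto
  have fin: "finite (parcs T)" using sub V by (meson finite_SigmaI finite_subset)
  have "card (pverts T - Range (parcs T)) = 1" unfolding card_branching_roots[OF br sub V] using a by arith
  then obtain x where x: "pverts T - Range (parcs T) = {x}" by (auto simp: card_1_singleton_iff)
  have reach: "(x, v) \<in> (parcs T)\<^sup>*" if v: "v \<in> pverts T" for v
  proof -
    obtain r where r: "r \<notin> Range (parcs T)" "(r, v) \<in> (parcs T)\<^sup>*"
      using branching_root_exists[OF br fin] by blast
    then have "r \<in> pverts T - Range (parcs T)" using rtrancl_mem[OF r(2) sub] v by blast
    then show ?thesis using x r(2) by simp
  qed
  have xV: "x \<in> pverts T" "x \<notin> Range (parcs T)" using x by auto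
  have "(parcs T)\<^sup>* `` {x} = pverts T" using reach rtrancl_mem[OF _ sub] xV(1) by blast
  moreover have "{(u, v) \<in> parcs T. (x, u) \<in> (parcs T)\<^sup>*} = parcs T" using reach sub by auto
  ultimately have "directed_tree \<lparr>pverts = pverts T, parcs = parcs T\<rparr> x"
    using directed_tree_below_root[OF br xV(2)] by simp
  moreover have "\<lparr>pverts = pverts T, parcs = parcs T\<rparr> = T" by (cases T) simp
  ultimately show "\<exists>x. directed_tree T x" by metis
qed

section \<open>The complete digraph\<close>

lemma pair_digraph_complete: "pair_digraph (complete_digraph_upto n)"
proof
  show "finite (parcs (complete_digraph_upto n))"
    by (rule finite_subset[of _ "{1..n} \<times> {1..n}"]) (auto simp: complete_digraph_upto_def)
qed (auto simp: complete_digraph_upto_def)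

lemma complete_source_complete: "1 \<le> n \<Longrightarrow> complete_source (complete_digraph_upto n) 1"
  unfolding complete_source_def complete_digraph_upto_def by auto

locale complete_forest_complex =
  fixes n :: nat
  assumes n: "1 \<le> n"
begin

abbreviation "Kn \<equiv> forest_complex (complete_digraph_upto n)"

sublocale partitioned_complex Kn "{e. fst e \<noteq> 1}" "source_completion {1..n} 1" "n - 1"
  using partitioned_forest_complex[OF pair_digraph_complete complete_source_complete[OF n]]
  by (simp add: complete_digraph_upto_def)

text \<open>Acyclicity excludes loops, so all pairs of vertices may stand in for the arcs of the
  complete digraph.\<close>

lemma face_iff: "N \<in> Kn \<longleftrightarrow> N \<subseteq> {1..n} \<times> {1..n} \<and> branching N"
proof -
  have "(a, a) \<notin> N" if "branching N" for a
    using that r_into_trancl[of a a N] unfolding branching_def acyclic_def by metis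
  then show ?thesis
    unfolding forest_complex_eq[OF pair_digraph_complete] mem_Collect_eq
    by (auto simp: complete_digraph_upto_def subset_iff)
qed

lemma critical_eq: "critical = branchings_avoiding {1..n} 1 (n - 1)"
  unfolding critical_def branchings_avoiding_def face_iff by (rule Collect_cong) auto

lemma card_critical: "card critical = (n - 1) ^ (n - 1)"
  unfolding critical_eq using card_branchings_avoiding[of "{1..n}" 1 "n - 1"] n by simp

text \<open>The vertex set of a spanning tree is fixed, so its arcs determine it. That vertex 1 is a
  leaf says that all arcs lie in the set playing the role of \<open>P\<close>.\<close>

lemma bij_betw_trees_critical:
  "bij_betw parcs {T \<in> spanning_directed_trees (complete_digraph_upto n). is_leaf T 1} critical"
proof (rule bij_betw_imageI)
  let ?I = "{T \<in> spanning_directed_trees (complete_digraph_upto n). is_leaf T 1}"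
  have V: "pverts T = {1..n}" if "T \<in> ?I" for T
    using that unfolding spanning_directed_trees_def spanning_def by (simp add: complete_digraph_upto_def)
  show "inj_on parcs ?I"
  proof (rule inj_onI)
    fix S T assume "S \<in> ?I" "T \<in> ?I" "parcs S = parcs T"
    then show "S = T" using V by (intro pair_pre_digraph.equality) simp_all
  qed
  show "parcs ` ?I = critical"
  proof (intro equalityI subsetI)
    fix N assume "N \<in> parcs ` ?I"
    then obtain T where T: "T \<in> ?I" "N = parcs T" by blast
    have "\<exists>x. directed_tree T x" and leaf: "1 \<notin> Domain (parcs T)"
      using T(1) unfolding spanning_directed_trees_def is_leaf_def by auto
    then have "branching N" "N \<subseteq> {1..n} \<times> {1..n}" "Suc (card N) = n"
      using directed_tree_iff_branching[of T] V[OF T(1)] T(2) by auto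
    then show "N \<in> critical" unfolding critical_eq branchings_avoiding_def using T(2) leaf by auto
  next
    fix N assume N: "N \<in> critical"
    let ?T = "\<lparr>pverts = {1..n}, parcs = N\<rparr>"
    have b: "branching N" "N \<subseteq> {1..n} \<times> {1..n}" "card N = n - 1" "1 \<notin> Domain N"
      using N unfolding critical_eq branchings_avoiding_def by auto
    then have "\<exists>x. directed_tree ?T x" using directed_tree_iff_branching[of ?T] n by simp
    moreover have "spanning (with_proj ?T) (with_proj (complete_digraph_upto n))"
    proof -
      interpret G: pair_digraph "complete_digraph_upto n" by (rule pair_digraph_complete)
      have "N \<subseteq> parcs (complete_digraph_upto n)"
        using N critical_def forest_complex_eq[OF pair_digraph_complete] by auto
      then show ?thesis
        unfolding spanning_def subgraph_def compatible_def
        using b(2) G.wf_digraph_axioms by (auto simp: wf_digraph_def complete_digraph_upto_def)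
    qed
    moreover have "is_leaf ?T 1" unfolding is_leaf_def using b(4) n by auto
    ultimately have "?T \<in> ?I" unfolding spanning_directed_trees_def by simp
    then show "N \<in> parcs ` ?I" by (rule image_eqI[rotated]) simp
  qed
qed

lemma shellable_complete: "shellable Kn"
  by (rule shellable)

lemma realization_complete:
  "realization Kn homotopy_equivalent_space wedge_of_spheres ((n - 1) ^ (n - 1)) (int n - 2)"
\<comment> \<open>For \<open>n = 1\<close> the realization is empty, since only the empty face
  exists. As \<open>0 ^ 0 = 1\<close>, the other side is a wedge of one sphere of dimension -1,
  which is empty too.\<close>
proof (cases "n = 1")
  case True
  have "geo Kn = {}"
  proof -
    have "\<sigma> = {}" if "\<sigma> \<in> Kn" for \<sigma>
      using card_face[OF that] finite_face[OF that] True by simp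
    then have "Kn \<subseteq> {{}}" by blast
    moreover have "geo {{}} = {}" unfolding geo_def by auto
    ultimately show ?thesis using geo_mono by blast
  qed
  then have "realization Kn = trivial_topology" unfolding realization_geo by simp
  moreover have "wedge_of_spheres 1 (int n - 2) = trivial_topology"
  proof -
    let ?S = "sum_topology (\<lambda>_. sphere_topology (int n - 2)) {..<1::nat}"
    have "topspace ?S = {}" using True by (simp add: sphere_topology_def)
    then have "topspace (wedge_of_spheres 1 (int n - 2)) = {}"
      unfolding wedge_of_spheres_def wedge_topology_def topspace_quotient_topology[OF equiv_wedge_rel]
      by simp
    then show ?thesis by simp
  qed
  ultimately show ?thesis
    using True by (simp add: homeomorphic_imp_homotopy_equivalent_space homeomorphic_empty_space_eq)
next
  case False
  then obtain d where d: "n - 1 = Suc d" using n by (cases "n - 1") auto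
  have "critical \<noteq> {}" using card_critical False n by auto
  then have "realization Kn homotopy_equivalent_space wedge_of_spheres (card critical) (int d)"
    using realization_homotopy_equivalent_wedge[OF d] by blast
  moreover have "int n - 2 = int d" using d by simp
  ultimately show ?thesis using card_critical by simp
qed

lemma cohomology_complete:
  assumes r: "linear_order_on (parcs (complete_digraph_upto n)) r"
  shows "finite_int_basis (reduced_cohomology r Kn (int n - 2))
    (\<lambda>T. cohomology_class r Kn (int n - 2) (indicator_cochain (parcs T)))
    {T \<in> spanning_directed_trees (complete_digraph_upto n). is_leaf T 1}"
proof (rule cohomology_basis[OF r])
  show "\<Union>Kn \<subseteq> parcs (complete_digraph_upto n)"
    unfolding forest_complex_eq[OF pair_digraph_complete] by blast
  show "int n - 2 = int (n - 1) - 1" using n by simp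
  show "bij_betw parcs {T \<in> spanning_directed_trees (complete_digraph_upto n). is_leaf T 1} critical"
    by (rule bij_betw_trees_critical)
  then show "finite {T \<in> spanning_directed_trees (complete_digraph_upto n). is_leaf T 1}"
    using finite_critical by (simp add: bij_betw_finite)
qed

end

theorem theorem4p3p1:
  shows "(\<forall>G :: 'a pair_pre_digraph.
            pair_digraph G \<and> (\<exists>x. complete_source G x) \<longrightarrow> shellable (forest_complex G)) \<and>
         (\<forall>n\<ge>1. shellable (forest_complex (complete_digraph_upto n))) \<and>
         (\<forall>n\<ge>1. realization (forest_complex (complete_digraph_upto n))
            homotopy_equivalent_space wedge_of_spheres ((n - 1) ^ (n - 1)) (int n - 2)) \<and>
         (\<forall>n\<ge>1. \<forall>r. linear_order_on (parcs (complete_digraph_upto n)) r \<longrightarrow>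
            finite_int_basis
              (reduced_cohomology r (forest_complex (complete_digraph_upto n)) (int n - 2))
              (\<lambda>T. cohomology_class r (forest_complex (complete_digraph_upto n)) (int n - 2)
                 (indicator_cochain (parcs T)))
              {T \<in> spanning_directed_trees (complete_digraph_upto n). is_leaf T 1})"
proof (intro conjI allI impI)
  fix G :: "'a pair_pre_digraph"
  assume "pair_digraph G \<and> (\<exists>x. complete_source G x)"
  then obtain x where "pair_digraph G" "complete_source G x" by blast
  then show "shellable (forest_complex G)"
    by (rule partitioned_complex.shellable[OF partitioned_forest_complex])
qed (use complete_forest_complex.shellable_complete complete_forest_complex.realization_complete
      complete_forest_complex.cohomology_complete in \<open>simp_all add: complete_forest_complex_def\<close>)

end
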